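(* Let $J\in\mathcal J_{\mathbb F}(S,T;\mathbb R^{d\times d})$ be a $\ast$-Volterra kernel and $K\in\mathcal K_{\mathbb F}(S,T;\mathbb R^{d\times d})$ a $\star$-Volterra kernel, and suppose that $(J,K)$ has a $(\ast,\star)$-resolvent $(Q,R)\in\mathcal J_{\mathbb F}(S,T;\mathbb R^{d\times d})\times\mathcal K_{\mathbb F}(S,T;\mathbb R^{d\times d})$. For $\varphi,\psi\in L^2_{\mathbb F}(S,T;\mathbb R^d)$, let $X,Y\in L^2_{\mathbb F}(S,T;\mathbb R^d)$ be the solutions of $$X=\varphi+J\ast X+K\star X\qquad\text{and}\qquad Y=\psi+J^\top\overset{\leftarrow}{\ast}Y+K^\top\overset{\leftarrow}{\star}Y,$$ respectively. Then $$\langle X,\psi\rangle_{L^2_{\mathbb F}(S,T)}=\langle\varphi,Y\rangle_{L^2_{\mathbb F}(S,T)},$$ where $\langle\xi_1,\xi_2\rangle_{L^2_{\mathbb F}(S,T)}=\mathbb E\big[\int_S^T\langle\xi_1(t),\xi_2(t)\rangle dt\big]$.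
   Context: Fix $0\le S<T<\infty$ and $d\in\mathbb N$; $\mathbb N_0=\mathbb N\cup\{0\}$. $(\Omega,\mathcal F,\mathbb P)$ is a complete probability space with a one-dimensional Brownian motion $W$; for $s\le t$, $\mathcal F^s_t$ is the $\mathbb P$-augmentation of the $\sigma$-field generated by $W(r)-W(s)$, $s\le r\le t$; $\mathcal F_t=\mathcal F^0_t$ and $\mathbb E_t=\mathbb E[\cdot|\mathcal F_t]$. $\Delta_n(S,T)=\{(t_1,\dots,t_n): T>t_1>\cdots>t_n>S\}$. $|A|$ is the Frobenius norm and $|A|_{\mathrm{op}}$ the operator norm of a matrix. $L^2(\Delta_n(S,T);\mathbb R^{d_1\times d_2})$ is the usual deterministic $L^2$ space (Frobenius norm). $L^2_{\mathbb F}(S,T;\mathbb R^{d_1\times d_2})$ is the space of measurable processes $\xi$ on $(S,T)$ with $\xi(t)$ $\mathcal F^S_t$-measurable and $\|\xi\|^2_{L^2_{\mathbb F}(S,T)}=\mathbb E\int_S^T|\xi(t)|^2dt<\infty$. $L^2_{\mathbb F,\ast}(\Delta_2(S,T);\mathbb R^{d_1\times d_2})$ is the space of measurable random fields $\Xi$ on $\Delta_2(S,T)$ with $\Xi(t,s)$ $\mathcal F^s_t$-measurable and $\mathbb E\int_S^T\int_S^t|\Xi(t,s)|^2ds\,dt<\infty$. Chaos expansions: $\mathfrak W_0[f_0](t)=f_0(t)$, and $\mathfrak W_n[f_n](t)=\int_S^t\int_S^{t_1}\cdots\int_S^{t_{n-1}}f_n(t,t_1,\dots,t_n)\,dW(t_n)\cdots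 dW(t_1)$ for $f_n\in L^2(\Delta_{n+1}(S,T))$; each $\xi\in L^2_{\mathbb F}(S,T)$ is uniquely $\xi=\sum_{n\ge0}\mathfrak W_n[\mathfrak F_n[\xi]]$ with $\mathfrak F_n[\xi]\in L^2(\Delta_{n+1}(S,T))$ and $\|\xi\|^2=\sum_n\|\mathfrak F_n[\xi]\|^2$. Similarly $\overline{\mathfrak W}_0[g_0]=g_0$, $\overline{\mathfrak W}_n[g_n](t,s)=\int_s^t\int_s^{t_1}\cdots\int_s^{t_{n-1}}g_n(t,t_1,\dots,t_n,s)\,dW(t_n)\cdots dW(t_1)$, and each $\Xi\in L^2_{\mathbb F,\ast}(\Delta_2(S,T))$ is uniquely $\Xi=\sum_{n\ge0}\overline{\mathfrak W}_n[\overline{\mathfrak F}_n[\Xi]]$ with $\overline{\mathfrak F}_n[\Xi]\in L^2(\Delta_{n+2}(S,T))$. $\mathcal V_{n+1}(S,T;\mathbb R^{d\times d})$ is the set of measurable $k:\Delta_{n+1}(S,T)\to\mathbb R^{d\times d}$ with finite norm $\|k\|_{\mathcal V_1}=\operatorname{ess\,sup}_t|k(t)|_{\mathrm{op}}$ (if $n=0$), $\|k\|_{\mathcal V_{n+1}}=\operatorname{ess\,sup}_{t\in(S,T)}(\int_{\Delta_n(t,T)}|k(s,t)|_{\mathrm{op}}^2ds)^{1/2}$ (if $n\ge1$). For $f$ on $\Delta_{m+1}(S,T)$ and $g$ on $\Delta_{n+1}(S,T)$ ($m,n\in\mathbb N_0$), $(f\triangleright g)(t_0,\dots,t_{m+n})=f(t_0,\dots,t_m)g(t_m,\dots,t_{m+n})$.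 $\star$-Volterra kernels: $\mathcal K_{\mathbb F}(S,T;\mathbb R^{d\times d})=\{K\in L^2_{\mathbb F}(S,T;\mathbb R^{d\times d}):\mathfrak F_n[K]\in\mathcal V_{n+1}\ \forall n,\ \sum_{n\ge0}\|\mathfrak F_n[K]\|_{\mathcal V_{n+1}}<\infty\}$. $\ast$-Volterra kernels: $\mathcal J_{\mathbb F}(S,T;\mathbb R^{d\times d})=\{J\in L^2_{\mathbb F,\ast}(\Delta_2(S,T);\mathbb R^{d\times d}):\sum_{n\ge0}(\int_{\Delta_{n+2}(S,T)}|\overline{\mathfrak F}_n[J](t)|_{\mathrm{op}}^2dt)^{1/2}<\infty\}$. Forward products, for $K\in\mathcal K_{\mathbb F}$, $\xi\in L^2_{\mathbb F}(S,T;\mathbb R^{d\times d_1})$, $\Xi\in L^2_{\mathbb F,\ast}(\Delta_2(S,T);\mathbb R^{d\times d_1})$, $J\in\mathcal J_{\mathbb F}$: $\mathfrak F_n[K\star\xi]=\sum_{k=0}^n\mathfrak F_{n-k}[K]\triangleright\mathfrak F_k[\xi]$; $\overline{\mathfrak F}_n[K\star\Xi]=\sum_{k=0}^n\mathfrak F_{n-k}[K]\triangleright\overline{\mathfrak F}_k[\Xi]$; $(J\ast\xi)(t)=\int_S^tJ(t,s)\xi(s)ds$; $(J\ast\Xi)(t,s)=\int_s^tJ(t,r)\Xi(r,s)dr$. Backward products: $K\overset{\leftarrow}{\star}\xi\in L^2_{\mathbb F}(S,T;\mathbb R^{d\times d_1})$ is defined by the chaos expansion $\mathfrak F_n[K\overset{\leftarrow}{\star}\xi](t_0,t)=\sum_{k=n}^\infty\int_{\Delta_{k-n}(t_0,T)}\mathfrak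 F_{k-n}[K](s,t_0)\,\mathfrak F_k[\xi](s,t_0,t)\,ds$ for $(t_0,t)=(t_0,t_1,\dots,t_n)\in\Delta_{n+1}(S,T)$, $n\in\mathbb N_0$ (for $k=n$ the integral over $\Delta_0$ is just the integrand $\mathfrak F_0[K](t_0)\mathfrak F_n[\xi](t_0,t)$); and $(J\overset{\leftarrow}{\ast}\xi)(t)=\mathbb E_t[\int_t^TJ(s,t)\xi(s)ds]$. A pair $(Q,R)\in\mathcal J_{\mathbb F}\times\mathcal K_{\mathbb F}$ is a $(\ast,\star)$-resolvent of $(J,K)$ if $Q=J+J\ast Q+K\star Q=J+Q\ast J+R\star J$ and $R=K+J\ast R+K\star R=K+Q\ast K+R\star K$. *)

theory Defs
  imports "HOL-Probability.Probability"
begin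

section \<open>Brownian motion and its augmented filtrations\<close>

definition brownian_motion :: "'w measure \<Rightarrow> (real \<Rightarrow> 'w \<Rightarrow> real) \<Rightarrow> bool" where
  "brownian_motion M W \<longleftrightarrow>
     (\<forall>t\<ge>0. W t \<in> borel_measurable M) \<and>
     (AE \<omega> in M. W 0 \<omega> = 0) \<and>
     (AE \<omega> in M. continuous_on {0..} (\<lambda>t. W t \<omega>)) \<and>
     (\<forall>s t. 0 \<le> s \<and> s < t \<longrightarrow>
        distributed M lborel (\<lambda>\<omega>. W t \<omega> - W s \<omega>) (\<lambda>x. ennreal (normal_density 0 (sqrt (t - s)) x))) \<and>
     (\<forall>(n::nat) \<tau>. 0 \<le> \<tau> 0 \<and> (\<forall>i<n. \<tau> i < \<tau> (Suc i)) \<longrightarrow>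
        prob_space.indep_vars M (\<lambda>_. borel) (\<lambda>i \<omega>. W (\<tau> (Suc i)) \<omega> - W (\<tau> i) \<omega>) {..<n})"

definition filt :: "'w measure \<Rightarrow> (real \<Rightarrow> 'w \<Rightarrow> real) \<Rightarrow> real \<Rightarrow> real \<Rightarrow> 'w measure" where
  "filt M W s t = sigma (space M)
     ({(\<lambda>\<omega>. W r \<omega> - W s \<omega>) -` B \<inter> space M | r B. r \<in> {s..t} \<and> B \<in> sets borel} \<union> null_sets M)"


section \<open>Processes and random fields\<close>

text \<open>Elements of the spaces below are represented by functions; they are identified when they
  agree almost everywhere for \<open>process_measure\<close> (respectively \<open>field_measure\<close>).\<close>

definition process_measure :: "'w measure \<Rightarrow> real \<Rightarrow> real \<Rightarrow> (real \<times> 'w) measure" where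
  "process_measure M S T = restrict_space lborel {S<..<T} \<Otimes>\<^sub>M M"

definition sqnorm :: "'w measure \<Rightarrow> real \<Rightarrow> real \<Rightarrow> (real \<Rightarrow> 'w \<Rightarrow> 'v::euclidean_space) \<Rightarrow> ennreal" where
  "sqnorm M S T \<xi> = (\<integral>\<^sup>+(t, \<omega>). ennreal ((norm (\<xi> t \<omega>))\<^sup>2) \<partial>process_measure M S T)"

text \<open>The parameter \<open>r\<close> is the origin of the filtration: \<open>\<xi> t\<close> is measurable for \<open>filt M W r t\<close>.
  The norm on \<open>real ^ 'm ^ 'n\<close> is the Frobenius norm.\<close>

definition adapted_L2 ::
  "'w measure \<Rightarrow> (real \<Rightarrow> 'w \<Rightarrow> real) \<Rightarrow> real \<Rightarrow> real \<Rightarrow> real \<Rightarrow> (real \<Rightarrow> 'w \<Rightarrow> 'v::euclidean_space) set" where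
  "adapted_L2 M W r a b = {\<xi>.
     (\<lambda>(t, \<omega>). \<xi> t \<omega>) \<in> borel_measurable (process_measure M a b) \<and>
     (\<forall>t\<in>{a<..<b}. \<xi> t \<in> borel_measurable (filt M W r t)) \<and>
     sqnorm M a b \<xi> < \<infinity>}"

definition L2_F ::
  "'w measure \<Rightarrow> (real \<Rightarrow> 'w \<Rightarrow> real) \<Rightarrow> real \<Rightarrow> real \<Rightarrow> (real \<Rightarrow> 'w \<Rightarrow> 'v::euclidean_space) set" where
  "L2_F M W S T = adapted_L2 M W S S T"

definition L2_F_inner ::
  "'w measure \<Rightarrow> real \<Rightarrow> real \<Rightarrow> (real \<Rightarrow> 'w \<Rightarrow> 'v::euclidean_space) \<Rightarrow> (real \<Rightarrow> 'w \<Rightarrow> 'v) \<Rightarrow> real" where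
  "L2_F_inner M S T \<xi> \<eta> = (LINT \<omega>|M. (LINT t:{S<..<T}|lborel. \<xi> t \<omega> \<bullet> \<eta> t \<omega>))"

definition triangle :: "real \<Rightarrow> real \<Rightarrow> (real \<times> real) set" where
  "triangle S T = {(t, s). S < s \<and> s < t \<and> t < T}"

definition field_measure :: "'w measure \<Rightarrow> real \<Rightarrow> real \<Rightarrow> ((real \<times> real) \<times> 'w) measure" where
  "field_measure M S T = restrict_space (lborel \<Otimes>\<^sub>M lborel) (triangle S T) \<Otimes>\<^sub>M M"

definition field_sqnorm ::
  "'w measure \<Rightarrow> real \<Rightarrow> real \<Rightarrow> (real \<Rightarrow> real \<Rightarrow> 'w \<Rightarrow> 'v::euclidean_space) \<Rightarrow> ennreal" where
  "field_sqnorm M S T \<Xi> = (\<integral>\<^sup>+((t, s), \<omega>). ennreal ((norm (\<Xi> t s \<omega>))\<^sup>2) \<partial>field_measure M S T)"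

definition L2_F_ast ::
  "'w measure \<Rightarrow> (real \<Rightarrow> 'w \<Rightarrow> real) \<Rightarrow> real \<Rightarrow> real \<Rightarrow> (real \<Rightarrow> real \<Rightarrow> 'w \<Rightarrow> 'v::euclidean_space) set" where
  "L2_F_ast M W S T = {\<Xi>.
     (\<lambda>((t, s), \<omega>). \<Xi> t s \<omega>) \<in> borel_measurable (field_measure M S T) \<and>
     (\<forall>(t, s)\<in>triangle S T. \<Xi> t s \<in> borel_measurable (filt M W s t)) \<and>
     field_sqnorm M S T \<Xi> < \<infinity>}"


section \<open>Ito integral and iterated Ito integrals\<close>

text \<open>Integrals of simple processes \<open>\<Sum>i<n. indicator {\<tau> i<..\<tau> (i+1)} \<zeta>\<^sub>i\<close> with \<open>\<zeta>\<^sub>i\<close> bounded and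
  measurable at time \<open>\<tau> i\<close>; the Ito integral over \<open>(a,b)\<close> is the \<open>L\<^sup>2\<close>-closure.  It is determined
  only up to null sets, so \<open>ito_integral M W a b X I\<close> says that \<open>I\<close> is a version of
  the integral of \<open>X\<close>.\<close>

definition simple_integrand ::
  "'w measure \<Rightarrow> (real \<Rightarrow> 'w \<Rightarrow> real) \<Rightarrow> real \<Rightarrow> real \<Rightarrow> nat \<Rightarrow> (nat \<Rightarrow> real) \<Rightarrow> (nat \<Rightarrow> 'w \<Rightarrow> 'v::euclidean_space) \<Rightarrow> bool" where
  "simple_integrand M W a b n \<tau> \<zeta> \<longleftrightarrow>
     a \<le> \<tau> 0 \<and> (\<forall>i<n. \<tau> i < \<tau> (Suc i)) \<and> \<tau> n \<le> b \<and>
     (\<forall>i<n. \<zeta> i \<in> borel_measurable (filt M W 0 (\<tau> i)) \<and> bounded (\<zeta> i ` space M))"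

definition simple_process ::
  "nat \<Rightarrow> (nat \<Rightarrow> real) \<Rightarrow> (nat \<Rightarrow> 'w \<Rightarrow> 'v::euclidean_space) \<Rightarrow> real \<Rightarrow> 'w \<Rightarrow> 'v" where
  "simple_process n \<tau> \<zeta> t \<omega> = (\<Sum>i<n. indicator {\<tau> i<..\<tau> (Suc i)} t *\<^sub>R \<zeta> i \<omega>)"

definition simple_integral ::
  "(real \<Rightarrow> 'w \<Rightarrow> real) \<Rightarrow> nat \<Rightarrow> (nat \<Rightarrow> real) \<Rightarrow> (nat \<Rightarrow> 'w \<Rightarrow> 'v::euclidean_space) \<Rightarrow> 'w \<Rightarrow> 'v" where
  "simple_integral W n \<tau> \<zeta> \<omega> = (\<Sum>i<n. (W (\<tau> (Suc i)) \<omega> - W (\<tau> i) \<omega>) *\<^sub>R \<zeta> i \<omega>)"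

definition ito_integral ::
  "'w measure \<Rightarrow> (real \<Rightarrow> 'w \<Rightarrow> real) \<Rightarrow> real \<Rightarrow> real \<Rightarrow> (real \<Rightarrow> 'w \<Rightarrow> 'v::euclidean_space) \<Rightarrow> ('w \<Rightarrow> 'v) \<Rightarrow> bool" where
  "ito_integral M W a b X I \<longleftrightarrow>
     X \<in> adapted_L2 M W 0 a b \<and> I \<in> borel_measurable M \<and>
     (\<exists>n \<tau> \<zeta>. (\<forall>j. simple_integrand M W a b (n j) (\<tau> j) (\<zeta> j)) \<and>
        (\<lambda>j. sqnorm M a b (\<lambda>t \<omega>. X t \<omega> - simple_process (n j) (\<tau> j) (\<zeta> j) t \<omega>)) \<longlonglongrightarrow> 0 \<and>
        (\<lambda>j. \<integral>\<^sup>+\<omega>. ennreal ((norm (I \<omega> - simple_integral W (n j) (\<tau> j) (\<zeta> j) \<omega>))\<^sup>2) \<partial>M) \<longlonglongrightarrow> 0)"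

text \<open>A point \<open>(t\<^sub>1,\<dots>,t\<^sub>n)\<close> is an element of \<open>{..<n} \<rightarrow>\<^sub>E UNIV\<close>, i.e. indices are shifted by one;
  \<open>case_nat t x\<close> is \<open>(t, x\<^sub>1, \<dots>, x\<^sub>n)\<close>, and \<open>x(n := t)\<close> is \<open>(x\<^sub>1, \<dots>, x\<^sub>n, t)\<close>.
  The only point of the zero-dimensional space is \<open>\<lambda>_. undefined\<close>.

  \<open>iterated_ito M W a n b f I\<close>: \<open>I\<close> is a version of the \<open>n\<close>-fold iterated integral of \<open>f\<close>
  over \<open>b > t\<^sub>1 > \<dots> > t\<^sub>n > a\<close>, the outermost integral being the one in \<open>dW(t\<^sub>1)\<close>.  The integrand \<open>X t\<close>
  of the outermost integral is a version of the remaining \<open>(n-1)\<close>-fold integral up to \<open>t\<close>,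
  for almost every \<open>t\<close>, chosen jointly measurable in \<open>(t, \<omega>)\<close>.\<close>

primrec iterated_ito ::
  "'w measure \<Rightarrow> (real \<Rightarrow> 'w \<Rightarrow> real) \<Rightarrow> real \<Rightarrow> nat \<Rightarrow> real \<Rightarrow> ((nat \<Rightarrow> real) \<Rightarrow> 'v::euclidean_space) \<Rightarrow> ('w \<Rightarrow> 'v) \<Rightarrow> bool" where
  "iterated_ito M W a 0 b f I \<longleftrightarrow> (AE \<omega> in M. I \<omega> = f (\<lambda>_. undefined))"
| "iterated_ito M W a (Suc n) b f I \<longleftrightarrow>
     (\<exists>X. (AE t in lborel. t \<in> {a<..<b} \<longrightarrow> iterated_ito M W a n t (\<lambda>x. f (case_nat t x)) (X t)) \<and>
          ito_integral M W a b X I)"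


section \<open>Simplices and chaos expansions\<close>

definition ordered_simplex :: "nat \<Rightarrow> real \<Rightarrow> real \<Rightarrow> (nat \<Rightarrow> real) set" where
  "ordered_simplex n a b = {t \<in> {..<n} \<rightarrow>\<^sub>E UNIV.
     (\<forall>i<n. a < t i \<and> t i < b) \<and> (\<forall>i j. i < j \<and> j < n \<longrightarrow> t j < t i)}"

text \<open>For \<open>n = 0\<close> this is the unit mass at the only point.\<close>

definition simplex_measure :: "nat \<Rightarrow> real \<Rightarrow> real \<Rightarrow> (nat \<Rightarrow> real) measure" where
  "simplex_measure n a b = restrict_space (PiM {..<n} (\<lambda>_. lborel)) (ordered_simplex n a b)"

definition L2_simplex :: "nat \<Rightarrow> real \<Rightarrow> real \<Rightarrow> ((nat \<Rightarrow> real) \<Rightarrow> 'v::euclidean_space) set" where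
  "L2_simplex n a b = {f. f \<in> borel_measurable (simplex_measure n a b) \<and>
     (\<integral>\<^sup>+t. ennreal ((norm (f t))\<^sup>2) \<partial>simplex_measure n a b) < \<infinity>}"

text \<open>\<open>chaos M W S T \<xi> F\<close>: \<open>F n\<close> is the \<open>n\<close>-th chaos coefficient of \<open>\<xi>\<close> for every \<open>n\<close>,
  i.e. \<open>\<xi>\<close> is the \<open>L\<^sup>2\<close>-sum of the \<open>n\<close>-fold iterated integrals of \<open>F n\<close>.  By the Wiener--Ito
  decomposition every \<open>\<xi>\<close> in \<open>L2_F\<close> has such an \<open>F\<close>, unique almost everywhere.\<close>

definition chaos ::
  "'w measure \<Rightarrow> (real \<Rightarrow> 'w \<Rightarrow> real) \<Rightarrow> real \<Rightarrow> real \<Rightarrow> (real \<Rightarrow> 'w \<Rightarrow> 'v::euclidean_space) \<Rightarrow> (nat \<Rightarrow> (nat \<Rightarrow> real) \<Rightarrow> 'v) \<Rightarrow> bool" where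
  "chaos M W S T \<xi> F \<longleftrightarrow>
     \<xi> \<in> L2_F M W S T \<and> (\<forall>n. F n \<in> L2_simplex (Suc n) S T) \<and>
     (\<exists>Z. (\<forall>n. Z n \<in> L2_F M W S T \<and>
             (AE t in lborel. t \<in> {S<..<T} \<longrightarrow>
                iterated_ito M W S n t (\<lambda>x. F n (case_nat t x)) (Z n t))) \<and>
          (\<lambda>N. sqnorm M S T (\<lambda>t \<omega>. \<xi> t \<omega> - (\<Sum>n<N. Z n t \<omega>))) \<longlonglongrightarrow> 0)"

text \<open>The same for random fields, where the \<open>n\<close>-th coefficient is a function of
  \<open>(t, t\<^sub>1, \<dots>, t\<^sub>n, s)\<close> and the iterated integral is over \<open>t > t\<^sub>1 > \<dots> > t\<^sub>n > s\<close>.\<close>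

definition field_chaos ::
  "'w measure \<Rightarrow> (real \<Rightarrow> 'w \<Rightarrow> real) \<Rightarrow> real \<Rightarrow> real \<Rightarrow> (real \<Rightarrow> real \<Rightarrow> 'w \<Rightarrow> 'v::euclidean_space) \<Rightarrow> (nat \<Rightarrow> (nat \<Rightarrow> real) \<Rightarrow> 'v) \<Rightarrow> bool" where
  "field_chaos M W S T \<Xi> G \<longleftrightarrow>
     \<Xi> \<in> L2_F_ast M W S T \<and> (\<forall>n. G n \<in> L2_simplex (Suc (Suc n)) S T) \<and>
     (\<exists>Z. (\<forall>n. Z n \<in> L2_F_ast M W S T \<and>
             (AE p in lborel \<Otimes>\<^sub>M lborel. p \<in> triangle S T \<longrightarrow>
                (case p of (t, s) \<Rightarrow>
                  iterated_ito M W s n t (\<lambda>x. G n ((case_nat t x)(Suc n := s))) (Z n t s)))) \<and>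
          (\<lambda>N. field_sqnorm M S T (\<lambda>t s \<omega>. \<Xi> t s \<omega> - (\<Sum>n<N. Z n t s \<omega>))) \<longlonglongrightarrow> 0)"


section \<open>Volterra kernels\<close>

type_synonym 'd sqmat = "real ^ 'd ^ 'd"

definition opnorm :: "real ^ 'm ^ 'n \<Rightarrow> real" where
  "opnorm A = onorm ((*v) A)"

definition ennreal_sqrt :: "ennreal \<Rightarrow> ennreal" where
  "ennreal_sqrt x = (if x = \<infinity> then \<infinity> else ennreal (sqrt (enn2real x)))"

text \<open>\<open>V_norm n\<close> is the norm of \<open>\<V>\<^sub>n\<^sub>+\<^sub>1\<close>; for \<open>n = 0\<close> the inner integral is just the
  integrand, so that this is the essential supremum of the operator norm.\<close>

definition V_norm :: "nat \<Rightarrow> real \<Rightarrow> real \<Rightarrow> ((nat \<Rightarrow> real) \<Rightarrow> 'd::finite sqmat) \<Rightarrow> ennreal" where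
  "V_norm n S T k = esssup (restrict_space lborel {S<..<T})
     (\<lambda>t. ennreal_sqrt (\<integral>\<^sup>+s. ennreal ((opnorm (k (s(n := t))))\<^sup>2) \<partial>simplex_measure n t T))"

definition V_space :: "nat \<Rightarrow> real \<Rightarrow> real \<Rightarrow> ((nat \<Rightarrow> real) \<Rightarrow> 'd::finite sqmat) set" where
  "V_space n S T = {k. k \<in> borel_measurable (simplex_measure (Suc n) S T) \<and> V_norm n S T k < \<infinity>}"

definition star_kernels ::
  "'w measure \<Rightarrow> (real \<Rightarrow> 'w \<Rightarrow> real) \<Rightarrow> real \<Rightarrow> real \<Rightarrow> (real \<Rightarrow> 'w \<Rightarrow> 'd::finite sqmat) set" where
  "star_kernels M W S T = {K \<in> L2_F M W S T.
     \<exists>F. chaos M W S T K F \<and> (\<forall>n. F n \<in> V_space n S T) \<and> (\<Sum>n. V_norm n S T (F n)) < \<infinity>}"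

definition ast_kernels ::
  "'w measure \<Rightarrow> (real \<Rightarrow> 'w \<Rightarrow> real) \<Rightarrow> real \<Rightarrow> real \<Rightarrow> (real \<Rightarrow> real \<Rightarrow> 'w \<Rightarrow> 'd::finite sqmat) set" where
  "ast_kernels M W S T = {J \<in> L2_F_ast M W S T.
     \<exists>G. field_chaos M W S T J G \<and>
       (\<Sum>n. ennreal_sqrt (\<integral>\<^sup>+t. ennreal ((opnorm (G n t))\<^sup>2) \<partial>simplex_measure (Suc (Suc n)) S T)) < \<infinity>}"


section \<open>Forward and backward products\<close>

text \<open>The kernels multiply vectors as well as matrices; the parameter \<open>mul\<close> is the
  respective product, \<open>(*v)\<close> or \<open>(**)\<close>.

  Here \<open>f\<close> lives on a simplex in dimension \<open>m + 1\<close> and \<open>g\<close> on one in dimension \<open>n + 1\<close>.\<close>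

definition tri ::
  "('m \<Rightarrow> 'v \<Rightarrow> 'u) \<Rightarrow> nat \<Rightarrow> nat \<Rightarrow> ((nat \<Rightarrow> real) \<Rightarrow> 'm) \<Rightarrow> ((nat \<Rightarrow> real) \<Rightarrow> 'v) \<Rightarrow> (nat \<Rightarrow> real) \<Rightarrow> 'u" where
  "tri mul m n f g t = mul (f (restrict t {..m})) (g (restrict (\<lambda>i. t (m + i)) {..n}))"

text \<open>\<open>star_prod mul M W S T K \<xi> Z\<close>: \<open>Z\<close> is (a version of) \<open>K \<star> \<xi>\<close>; similarly for
  \<open>field_star_prod\<close>, \<open>back_star_prod\<close> and \<open>back_ast_prod\<close>.\<close>

definition star_prod ::
  "('d::finite sqmat \<Rightarrow> 'v::euclidean_space \<Rightarrow> 'v) \<Rightarrow> 'w measure \<Rightarrow> (real \<Rightarrow> 'w \<Rightarrow> real) \<Rightarrow> real \<Rightarrow> real \<Rightarrow>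
   (real \<Rightarrow> 'w \<Rightarrow> 'd sqmat) \<Rightarrow> (real \<Rightarrow> 'w \<Rightarrow> 'v) \<Rightarrow> (real \<Rightarrow> 'w \<Rightarrow> 'v) \<Rightarrow> bool" where
  "star_prod mul M W S T K \<xi> Z \<longleftrightarrow>
     (\<exists>FK F\<xi> FZ. chaos M W S T K FK \<and> chaos M W S T \<xi> F\<xi> \<and> chaos M W S T Z FZ \<and>
        (\<forall>n. AE t in simplex_measure (Suc n) S T.
           FZ n t = (\<Sum>k\<le>n. tri mul (n - k) k (FK (n - k)) (F\<xi> k) t)))"

definition field_star_prod ::
  "('d::finite sqmat \<Rightarrow> 'v::euclidean_space \<Rightarrow> 'v) \<Rightarrow> 'w measure \<Rightarrow> (real \<Rightarrow> 'w \<Rightarrow> real) \<Rightarrow> real \<Rightarrow> real \<Rightarrow>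
   (real \<Rightarrow> 'w \<Rightarrow> 'd sqmat) \<Rightarrow> (real \<Rightarrow> real \<Rightarrow> 'w \<Rightarrow> 'v) \<Rightarrow> (real \<Rightarrow> real \<Rightarrow> 'w \<Rightarrow> 'v) \<Rightarrow> bool" where
  "field_star_prod mul M W S T K \<Xi> Z \<longleftrightarrow>
     (\<exists>FK G\<Xi> GZ. chaos M W S T K FK \<and> field_chaos M W S T \<Xi> G\<Xi> \<and> field_chaos M W S T Z GZ \<and>
        (\<forall>n. AE t in simplex_measure (Suc (Suc n)) S T.
           GZ n t = (\<Sum>k\<le>n. tri mul (n - k) (Suc k) (FK (n - k)) (G\<Xi> k) t)))"

definition ast_prod ::
  "('m \<Rightarrow> 'v \<Rightarrow> 'v::euclidean_space) \<Rightarrow> real \<Rightarrow> (real \<Rightarrow> real \<Rightarrow> 'w \<Rightarrow> 'm) \<Rightarrow> (real \<Rightarrow> 'w \<Rightarrow> 'v) \<Rightarrow> real \<Rightarrow> 'w \<Rightarrow> 'v" where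
  "ast_prod mul S J \<xi> t \<omega> = (LINT s:{S<..<t}|lborel. mul (J t s \<omega>) (\<xi> s \<omega>))"

definition field_ast_prod ::
  "('m \<Rightarrow> 'v \<Rightarrow> 'v::euclidean_space) \<Rightarrow> (real \<Rightarrow> real \<Rightarrow> 'w \<Rightarrow> 'm) \<Rightarrow> (real \<Rightarrow> real \<Rightarrow> 'w \<Rightarrow> 'v) \<Rightarrow> real \<Rightarrow> real \<Rightarrow> 'w \<Rightarrow> 'v" where
  "field_ast_prod mul J \<Xi> t s \<omega> = (LINT r:{s<..<t}|lborel. mul (J t r \<omega>) (\<Xi> r s \<omega>))"

text \<open>With \<open>t = (t\<^sub>0, t\<^sub>1, \<dots>, t\<^sub>n)\<close> and \<open>k = n + j\<close>, the \<open>j\<close>-th term integrates over \<open>s\<close> in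
  dimension \<open>j\<close>; the arguments are \<open>(s, t\<^sub>0)\<close> and \<open>(s, t\<^sub>0, t\<^sub>1, \<dots>, t\<^sub>n)\<close>.\<close>

definition back_star_prod ::
  "('d::finite sqmat \<Rightarrow> 'v::euclidean_space \<Rightarrow> 'v) \<Rightarrow> 'w measure \<Rightarrow> (real \<Rightarrow> 'w \<Rightarrow> real) \<Rightarrow> real \<Rightarrow> real \<Rightarrow>
   (real \<Rightarrow> 'w \<Rightarrow> 'd sqmat) \<Rightarrow> (real \<Rightarrow> 'w \<Rightarrow> 'v) \<Rightarrow> (real \<Rightarrow> 'w \<Rightarrow> 'v) \<Rightarrow> bool" where
  "back_star_prod mul M W S T K \<xi> Z \<longleftrightarrow>
     (\<exists>FK F\<xi> FZ. chaos M W S T K FK \<and> chaos M W S T \<xi> F\<xi> \<and> chaos M W S T Z FZ \<and>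
        (\<forall>n. AE t in simplex_measure (Suc n) S T.
           FZ n t = (\<Sum>j. (LINT s|simplex_measure j (t 0) T.
              mul (FK j (s(j := t 0)))
                  (F\<xi> (n + j) (\<lambda>i. if i < j then s i else t (i - j)))))))"

text \<open>The conditional expectation is taken componentwise.\<close>

definition back_ast_prod ::
  "('m \<Rightarrow> 'v \<Rightarrow> 'v::euclidean_space) \<Rightarrow> 'w measure \<Rightarrow> (real \<Rightarrow> 'w \<Rightarrow> real) \<Rightarrow> real \<Rightarrow> real \<Rightarrow>
   (real \<Rightarrow> real \<Rightarrow> 'w \<Rightarrow> 'm) \<Rightarrow> (real \<Rightarrow> 'w \<Rightarrow> 'v) \<Rightarrow> (real \<Rightarrow> 'w \<Rightarrow> 'v) \<Rightarrow> bool" where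
  "back_ast_prod mul M W S T J \<xi> Z \<longleftrightarrow>
     Z \<in> L2_F M W S T \<and>
     (AE t in lborel. t \<in> {S<..<T} \<longrightarrow>
        (\<forall>b\<in>Basis. AE \<omega> in M. Z t \<omega> \<bullet> b =
           real_cond_exp M (filt M W 0 t) (\<lambda>\<omega>. (LINT s:{t<..<T}|lborel. mul (J s t \<omega>) (\<xi> s \<omega>)) \<bullet> b) \<omega>))"


section \<open>Resolvents and Volterra equations\<close>

definition resolvent ::
  "'w measure \<Rightarrow> (real \<Rightarrow> 'w \<Rightarrow> real) \<Rightarrow> real \<Rightarrow> real \<Rightarrow>
   (real \<Rightarrow> real \<Rightarrow> 'w \<Rightarrow> 'd::finite sqmat) \<Rightarrow> (real \<Rightarrow> 'w \<Rightarrow> 'd sqmat) \<Rightarrow>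
   (real \<Rightarrow> real \<Rightarrow> 'w \<Rightarrow> 'd sqmat) \<Rightarrow> (real \<Rightarrow> 'w \<Rightarrow> 'd sqmat) \<Rightarrow> bool" where
  "resolvent M W S T J K Q R \<longleftrightarrow>
     Q \<in> ast_kernels M W S T \<and> R \<in> star_kernels M W S T \<and>
     (\<exists>KQ RJ KR RK.
        field_star_prod (**) M W S T K Q KQ \<and> field_star_prod (**) M W S T R J RJ \<and>
        star_prod (**) M W S T K R KR \<and> star_prod (**) M W S T R K RK \<and>
        (AE ((t, s), \<omega>) in field_measure M S T.
           Q t s \<omega> = J t s \<omega> + field_ast_prod (**) J Q t s \<omega> + KQ t s \<omega> \<and>
           Q t s \<omega> = J t s \<omega> + field_ast_prod (**) Q J t s \<omega> + RJ t s \<omega>) \<and>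
        (AE (t, \<omega>) in process_measure M S T.
           R t \<omega> = K t \<omega> + ast_prod (**) S J R t \<omega> + KR t \<omega> \<and>
           R t \<omega> = K t \<omega> + ast_prod (**) S Q K t \<omega> + RK t \<omega>))"

definition forward_solution ::
  "'w measure \<Rightarrow> (real \<Rightarrow> 'w \<Rightarrow> real) \<Rightarrow> real \<Rightarrow> real \<Rightarrow>
   (real \<Rightarrow> real \<Rightarrow> 'w \<Rightarrow> 'd::finite sqmat) \<Rightarrow> (real \<Rightarrow> 'w \<Rightarrow> 'd sqmat) \<Rightarrow>
   (real \<Rightarrow> 'w \<Rightarrow> real ^ 'd) \<Rightarrow> (real \<Rightarrow> 'w \<Rightarrow> real ^ 'd) \<Rightarrow> bool" where
  "forward_solution M W S T J K \<phi> X \<longleftrightarrow>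
     X \<in> L2_F M W S T \<and>
     (\<exists>KX. star_prod (*v) M W S T K X KX \<and>
        (AE (t, \<omega>) in process_measure M S T.
           X t \<omega> = \<phi> t \<omega> + ast_prod (*v) S J X t \<omega> + KX t \<omega>))"

definition backward_solution ::
  "'w measure \<Rightarrow> (real \<Rightarrow> 'w \<Rightarrow> real) \<Rightarrow> real \<Rightarrow> real \<Rightarrow>
   (real \<Rightarrow> real \<Rightarrow> 'w \<Rightarrow> 'd::finite sqmat) \<Rightarrow> (real \<Rightarrow> 'w \<Rightarrow> 'd sqmat) \<Rightarrow>
   (real \<Rightarrow> 'w \<Rightarrow> real ^ 'd) \<Rightarrow> (real \<Rightarrow> 'w \<Rightarrow> real ^ 'd) \<Rightarrow> bool" where
  "backward_solution M W S T J K \<psi> Y \<longleftrightarrow>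
     Y \<in> L2_F M W S T \<and>
     (\<exists>JY KY. back_ast_prod (*v) M W S T J Y JY \<and> back_star_prod (*v) M W S T K Y KY \<and>
        (AE (t, \<omega>) in process_measure M S T. Y t \<omega> = \<psi> t \<omega> + JY t \<omega> + KY t \<omega>))"

end

theory Submission
  imports Defs
begin

text \<open>Inserting the two equations gives
  \<open>\<langle>X, \<psi>\<rangle> = \<langle>X, Y\<rangle> - \<langle>X, J\<^sup>T\<leftarrow>\<ast>Y\<rangle> - \<langle>X, K\<^sup>T\<leftarrow>\<star>Y\<rangle>\<close> and \<open>\<langle>\<phi>, Y\<rangle> = \<langle>X, Y\<rangle> - \<langle>J\<ast>X, Y\<rangle> - \<langle>K\<star>X, Y\<rangle>\<close>,
  so it suffices that each backward product is adjoint to the forward one.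

  For \<open>\<ast>\<close> this is Fubini's theorem: \<open>J(t,s)\<close> and \<open>X(s)\<close> are independent, being determined by increments
  after and before \<open>s\<close>, which makes \<open>|J(t,s)| |X(s)| |Y(t)|\<close> integrable; the conditional expectation
  disappears because \<open>X(s)\<close> is measurable at time \<open>s\<close>.

  For \<open>\<star>\<close> both inner products are expanded by Parseval's identity for chaos coefficients, a consequence of
  the Ito isometry.  Splitting a simplex at the variable \<open>t\<^sub>0\<close> shared by the two factors turns both
  sides into the same double series over \<open>(n, j)\<close>, where \<open>j\<close> is the order of the coefficient of \<open>K\<close>
  and \<open>n\<close> that of \<open>X\<close>: the forward side sums it along the diagonals \<open>n + j = N\<close>, the backward
  side along the rows.  Summability of the \<open>\<V>\<close>-norms makes the series converge absolutely.\<close>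

section \<open>Square integrable functions\<close>

text \<open>The definitions are relational: \<open>chaos\<close>, \<open>star_prod\<close> and
  \<open>back_star_prod\<close> each assert that some coefficient family exists. So the family
  behind the bound in \<open>star_kernels\<close>, the one inside the forward product and the one of
  the transposed kernel inside the backward product are a priori unrelated. They are matched almost
  everywhere by \<open>chaos_unique\<close>, which is itself Parseval applied to a difference; the
  transpose enters because it is a Frobenius isometry and therefore passes through iterated
  integrals. The Ito isometry needs independence of the past and the future as sigma-algebras,
  whereas \<open>brownian_motion\<close> supplies only independence of consecutive increments of a
  finite partition. For the double series, the term of index (n, j) is bounded by \<open>w j\<close>
  times the sum of the squared norms of the coefficients \<open>X n\<close> and
  \<open>Y (n + j)\<close>. This is summable over both indices because \<open>w\<close> and, by
  Parseval, both families of squared norms are summable. Integrals default to 0 where they do not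
  exist, so a series or an integral can be moved past an inner product only after separating the
  points where the other factor vanishes.\<close>

abbreviation interval_measure :: "real \<Rightarrow> real \<Rightarrow> real measure" where
  "interval_measure a b \<equiv> restrict_space lborel {a<..<b}"

text \<open>Kept in \<open>ennreal\<close> because the limits in \<open>ito_integral\<close> and
  \<open>chaos\<close> are stated there; finiteness is then a separate fact. \<open>sqnorm\<close>
  is the instance on \<open>process_measure\<close>.\<close>

definition sq_int :: "'a measure \<Rightarrow> ('a \<Rightarrow> 'v::euclidean_space) \<Rightarrow> ennreal" where
  "sq_int N f = (\<integral>\<^sup>+x. ennreal ((norm (f x))\<^sup>2) \<partial>N)"

lemma sq_int_add:
  assumes [measurable]: "f \<in> borel_measurable N" "g \<in> borel_measurable N"
  shows "sq_int N (\<lambda>x. f x + g x) \<le> 2 * sq_int N f + 2 * sq_int N g"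
proof -
  have "(norm (f x + g x))\<^sup>2 \<le> 2 * (norm (f x))\<^sup>2 + 2 * (norm (g x))\<^sup>2" for x
  proof -
    have "(norm (f x + g x))\<^sup>2 \<le> (norm (f x) + norm (g x))\<^sup>2"
      by (intro power_mono norm_triangle_ineq) auto
    also have "\<dots> \<le> 2 * (norm (f x))\<^sup>2 + 2 * (norm (g x))\<^sup>2"
      using sum_squares_bound[of "norm (f x)" "norm (g x)"] by (simp add: power2_sum)
    finally show ?thesis .
  qed
  then have "sq_int N (\<lambda>x. f x + g x) \<le> (\<integral>\<^sup>+x. ennreal (2 * (norm (f x))\<^sup>2 + 2 * (norm (g x))\<^sup>2) \<partial>N)"
    unfolding sq_int_def by (intro nn_integral_mono ennreal_leI)
  also have "\<dots> = 2 * sq_int N f + 2 * sq_int N g"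
    unfolding sq_int_def by (simp add: ennreal_plus ennreal_mult nn_integral_add nn_integral_cmult)
  finally show ?thesis .
qed

lemma sq_int_add_finite:
  assumes "f \<in> borel_measurable N" "g \<in> borel_measurable N" "sq_int N f < \<infinity>" "sq_int N g < \<infinity>"
  shows "sq_int N (\<lambda>x. f x + g x) < \<infinity>"
proof -
  have "2 * sq_int N f + 2 * sq_int N g < \<infinity>"
    using assms(3,4) by (simp add: ennreal_mult_less_top)
  then show ?thesis using sq_int_add[OF assms(1,2)] by (rule le_less_trans[rotated])
qed

lemma sq_int_diff_finite:
  assumes "f \<in> borel_measurable N" "g \<in> borel_measurable N" "sq_int N f < \<infinity>" "sq_int N g < \<infinity>"
  shows "sq_int N (\<lambda>x. f x - g x) < \<infinity>"
  using sq_int_add_finite[of f N "\<lambda>x. - g x"] assms by (simp add: sq_int_def)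

lemma nn_integral_inner_CS:
  assumes [measurable]: "f \<in> borel_measurable N" "g \<in> borel_measurable N"
  shows "(\<integral>\<^sup>+x. ennreal (norm (f x) * norm (g x)) \<partial>N)\<^sup>2 \<le> sq_int N f * sq_int N g"
  using Cauchy_Schwarz_nn_integral[of "\<lambda>x. ennreal (norm (f x))" N "\<lambda>x. ennreal (norm (g x))"]
  by (simp add: sq_int_def ennreal_mult ennreal_power)

lemma integrable_inner_sq_int:
  assumes [measurable]: "f \<in> borel_measurable N" "g \<in> borel_measurable N"
    and "sq_int N f < \<infinity>" "sq_int N g < \<infinity>"
  shows "integrable N (\<lambda>x. f x \<bullet> g x)"
proof (rule integrableI_bounded)
  have "(\<integral>\<^sup>+x. ennreal (norm (f x) * norm (g x)) \<partial>N)\<^sup>2 < \<infinity>"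
    using nn_integral_inner_CS[of f N g] assms by (auto simp: ennreal_mult_less_top intro: le_less_trans)
  then have "(\<integral>\<^sup>+x. ennreal (norm (f x) * norm (g x)) \<partial>N) < \<infinity>"
    by (simp add: power_less_top_ennreal)
  moreover have "(\<integral>\<^sup>+x. ennreal (norm (f x \<bullet> g x)) \<partial>N) \<le> (\<integral>\<^sup>+x. ennreal (norm (f x) * norm (g x)) \<partial>N)"
    by (intro nn_integral_mono ennreal_leI) (use Cauchy_Schwarz_ineq2 in auto)
  ultimately show "(\<integral>\<^sup>+x. ennreal (norm (f x \<bullet> g x)) \<partial>N) < \<infinity>" by auto
qed auto

lemma integral_inner_self:
  assumes [measurable]: "f \<in> borel_measurable N" and "sq_int N f < \<infinity>"
  shows "ennreal (\<integral>x. f x \<bullet> f x \<partial>N) = sq_int N f"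
  using nn_integral_eq_integral[OF integrable_inner_sq_int[of f N f]] assms
  by (simp add: sq_int_def power2_norm_eq_inner)

lemma integral_inner_CS:
  assumes [measurable]: "f \<in> borel_measurable N" "g \<in> borel_measurable N"
    and "sq_int N f < \<infinity>" "sq_int N g < \<infinity>"
  shows "ennreal ((\<integral>x. f x \<bullet> g x \<partial>N)\<^sup>2) \<le> sq_int N f * sq_int N g"
proof -
  have "ennreal \<bar>\<integral>x. f x \<bullet> g x \<partial>N\<bar> \<le> (\<integral>\<^sup>+x. ennreal (norm (f x) * norm (g x)) \<partial>N)"
  proof -
    have "ennreal \<bar>\<integral>x. f x \<bullet> g x \<partial>N\<bar> \<le> (\<integral>\<^sup>+x. ennreal (norm (f x \<bullet> g x)) \<partial>N)"
      using integral_norm_bound_ennreal[OF integrable_inner_sq_int[OF assms]] by simp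
    also have "\<dots> \<le> (\<integral>\<^sup>+x. ennreal (norm (f x) * norm (g x)) \<partial>N)"
      by (intro nn_integral_mono ennreal_leI) (use Cauchy_Schwarz_ineq2 in auto)
    finally show ?thesis .
  qed
  then have "(ennreal \<bar>\<integral>x. f x \<bullet> g x \<partial>N\<bar>)\<^sup>2 \<le> (\<integral>\<^sup>+x. ennreal (norm (f x) * norm (g x)) \<partial>N)\<^sup>2"
    by (intro power_mono) auto
  also have "\<dots> \<le> sq_int N f * sq_int N g" by (rule nn_integral_inner_CS) auto
  finally show ?thesis by (simp add: ennreal_power)
qed

text \<open>Cauchy-Schwarz. The bound on \<open>v\<close> is asked for only eventually, since in the
  application it comes from a second sequence that tends to 0.\<close>

lemma integral_inner_tendsto_0:
  assumes [measurable]: "\<And>j::nat. u j \<in> borel_measurable N" "\<And>j. v j \<in> borel_measurable N"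
    and u: "(\<lambda>j. sq_int N (u j)) \<longlonglongrightarrow> 0" and v: "\<forall>\<^sub>F j in sequentially. sq_int N (v j) \<le> C" "C < \<infinity>"
  shows "(\<lambda>j. \<integral>x. u j x \<bullet> v j x \<partial>N) \<longlonglongrightarrow> 0"
proof -
  have "(\<lambda>j. sq_int N (u j) * C) \<longlonglongrightarrow> 0 * C"
    using ennreal_tendsto_cmult[OF _ u, of C] v(2) by (simp add: mult.commute)
  then have lim: "(\<lambda>j. sq_int N (u j) * C) \<longlonglongrightarrow> 0" by simp
  have "\<forall>\<^sub>F j in sequentially. sq_int N (u j) < \<infinity>"
    using order_tendstoD(2)[OF u, of \<infinity>] by simp
  with v(1) have bound: "\<forall>\<^sub>F j in sequentially. ennreal ((\<integral>x. u j x \<bullet> v j x \<partial>N)\<^sup>2) \<le> sq_int N (u j) * C"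
  proof eventually_elim
    case (elim j)
    have "ennreal ((\<integral>x. u j x \<bullet> v j x \<partial>N)\<^sup>2) \<le> sq_int N (u j) * sq_int N (v j)"
      using elim v(2) by (intro integral_inner_CS) auto
    also have "\<dots> \<le> sq_int N (u j) * C" using elim by (intro mult_left_mono) auto
    finally show ?case .
  qed
  have "(\<lambda>j. ennreal ((\<integral>x. u j x \<bullet> v j x \<partial>N)\<^sup>2)) \<longlonglongrightarrow> 0"
    by (rule tendsto_sandwich[OF always_eventually bound tendsto_const lim]) simp
  then have "(\<lambda>j. (\<integral>x. u j x \<bullet> v j x \<partial>N)\<^sup>2) \<longlonglongrightarrow> 0"
    using tendsto_ennreal_iff[of "\<lambda>j. (\<integral>x. u j x \<bullet> v j x \<partial>N)\<^sup>2" sequentially 0] by (simp only: ennreal_0) simp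
  then have "(\<lambda>j. sqrt ((\<integral>x. u j x \<bullet> v j x \<partial>N)\<^sup>2)) \<longlonglongrightarrow> sqrt 0"
    by (rule tendsto_real_sqrt)
  then show ?thesis by (simp add: tendsto_rabs_zero_iff)
qed

text \<open>With the errors \<open>p = f - u\<close> and \<open>q = g - v\<close>, the product of
  \<open>u\<close> and \<open>v\<close> is that of \<open>f\<close> and \<open>g\<close> up to three
  terms that each contain an error. As \<open>u j\<close> and \<open>v j\<close> are not assumed
  square integrable, the terms can be split only once the errors have norm below 1.\<close>

lemma integral_inner_tendsto:
  assumes [measurable]: "\<And>j::nat. u j \<in> borel_measurable N" "\<And>j. v j \<in> borel_measurable N"
      "f \<in> borel_measurable N" "g \<in> borel_measurable N"
    and fin: "sq_int N f < \<infinity>" "sq_int N g < \<infinity>"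
    and u: "(\<lambda>j. sq_int N (\<lambda>x. f x - u j x)) \<longlonglongrightarrow> 0" and v: "(\<lambda>j. sq_int N (\<lambda>x. g x - v j x)) \<longlonglongrightarrow> 0"
  shows "(\<lambda>j. \<integral>x. u j x \<bullet> v j x \<partial>N) \<longlonglongrightarrow> (\<integral>x. f x \<bullet> g x \<partial>N)"
proof -
  define p where "p j x = f x - u j x" for j x
  define q where "q j x = g x - v j x" for j x
  have [measurable]: "p j \<in> borel_measurable N" "q j \<in> borel_measurable N" for j
    by (simp_all add: p_def[abs_def] q_def[abs_def])
  have u: "(\<lambda>j. sq_int N (p j)) \<longlonglongrightarrow> 0" and v: "(\<lambda>j. sq_int N (q j)) \<longlonglongrightarrow> 0"
    using u v by (auto simp: p_def[abs_def] q_def[abs_def])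
  have evu: "\<forall>\<^sub>F j in sequentially. sq_int N (p j) < 1" and evv: "\<forall>\<^sub>F j in sequentially. sq_int N (q j) < 1"
    using order_tendstoD(2)[OF u, of 1] order_tendstoD(2)[OF v, of 1] by auto
  have 1: "(\<lambda>j. \<integral>x. p j x \<bullet> q j x \<partial>N) \<longlonglongrightarrow> 0"
    using evv by (intro integral_inner_tendsto_0[OF _ _ u, where C=1]) (auto elim: eventually_mono)
  have 2: "(\<lambda>j. \<integral>x. p j x \<bullet> g x \<partial>N) \<longlonglongrightarrow> 0"
    using fin by (intro integral_inner_tendsto_0[OF _ _ u, where C="sq_int N g"]) auto
  have 3: "(\<lambda>j. \<integral>x. q j x \<bullet> f x \<partial>N) \<longlonglongrightarrow> 0"
    using fin by (intro integral_inner_tendsto_0[OF _ _ v, where C="sq_int N f"]) auto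
  have "(\<lambda>j. (\<integral>x. f x \<bullet> g x \<partial>N) - (\<integral>x. q j x \<bullet> f x \<partial>N) - (\<integral>x. p j x \<bullet> g x \<partial>N) + (\<integral>x. p j x \<bullet> q j x \<partial>N))
     \<longlonglongrightarrow> (\<integral>x. f x \<bullet> g x \<partial>N) - 0 - 0 + 0"
    by (intro tendsto_intros 1 2 3)
  then have lim: "(\<lambda>j. (\<integral>x. f x \<bullet> g x \<partial>N) - (\<integral>x. q j x \<bullet> f x \<partial>N) - (\<integral>x. p j x \<bullet> g x \<partial>N) + (\<integral>x. p j x \<bullet> q j x \<partial>N))
     \<longlonglongrightarrow> (\<integral>x. f x \<bullet> g x \<partial>N)" by simp
  have "\<forall>\<^sub>F j in sequentially. (\<integral>x. f x \<bullet> g x \<partial>N) - (\<integral>x. q j x \<bullet> f x \<partial>N) - (\<integral>x. p j x \<bullet> g x \<partial>N) + (\<integral>x. p j x \<bullet> q j x \<partial>N)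
      = (\<integral>x. u j x \<bullet> v j x \<partial>N)"
    using evu evv
  proof eventually_elim
    case (elim j)
    then have e: "sq_int N (p j) < \<infinity>" "sq_int N (q j) < \<infinity>" by (auto intro: less_trans)
    have i: "integrable N (\<lambda>x. f x \<bullet> g x)" "integrable N (\<lambda>x. q j x \<bullet> f x)"
        "integrable N (\<lambda>x. p j x \<bullet> g x)" "integrable N (\<lambda>x. p j x \<bullet> q j x)"
      using e fin by (intro integrable_inner_sq_int; simp)+
    have "(\<integral>x. u j x \<bullet> v j x \<partial>N) = (\<integral>x. f x \<bullet> g x - q j x \<bullet> f x - p j x \<bullet> g x + p j x \<bullet> q j x \<partial>N)"
      by (intro Bochner_Integration.integral_cong) (auto simp: p_def q_def inner_diff_left inner_diff_right inner_commute)
    also have "\<dots> = (\<integral>x. f x \<bullet> g x \<partial>N) - (\<integral>x. q j x \<bullet> f x \<partial>N) - (\<integral>x. p j x \<bullet> g x \<partial>N) + (\<integral>x. p j x \<bullet> q j x \<partial>N)"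
      using i by simp
    finally show ?case by simp
  qed
  from Lim_transform_eventually[OF lim this] show ?thesis .
qed

text \<open>\<open>ito_integral\<close> requires its value to be measurable only; square
  integrability follows because some simple integral lies at finite distance.\<close>

lemma sq_int_finite_of_limit:
  assumes [measurable]: "\<And>j::nat. u j \<in> borel_measurable N" "f \<in> borel_measurable N"
    and fin: "\<And>j. sq_int N (u j) < \<infinity>" and u: "(\<lambda>j. sq_int N (\<lambda>x. f x - u j x)) \<longlonglongrightarrow> 0"
  shows "sq_int N f < \<infinity>"
proof -
  obtain j where "sq_int N (\<lambda>x. f x - u j x) < 1"
    using order_tendstoD(2)[OF u, of 1] by (auto simp: eventually_sequentially)
  then have "sq_int N (\<lambda>x. f x - u j x) < \<infinity>" by (auto intro: less_trans)
  from sq_int_add_finite[OF _ _ this fin[of j]] show ?thesis by simp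
qed

lemma
  fixes f :: "nat \<Rightarrow> nat \<Rightarrow> 'a \<Rightarrow> real"
  assumes "\<And>i j. i < n \<Longrightarrow> j < m \<Longrightarrow> integrable N (f i j)"
  shows integrable_double_sum: "integrable N (\<lambda>x. \<Sum>i<n. \<Sum>j<m. f i j x)"
    and integral_double_sum: "(\<integral>x. (\<Sum>i<n. \<Sum>j<m. f i j x) \<partial>N) = (\<Sum>i<n. \<Sum>j<m. integral\<^sup>L N (f i j))"
proof -
  have row: "integrable N (\<lambda>x. \<Sum>j<m. f i j x)" if "i < n" for i
    using assms that by (intro Bochner_Integration.integrable_sum) auto
  then show "integrable N (\<lambda>x. \<Sum>i<n. \<Sum>j<m. f i j x)" by (rule Bochner_Integration.integrable_sum) simp
  have "(\<integral>x. (\<Sum>i<n. \<Sum>j<m. f i j x) \<partial>N) = (\<Sum>i<n. \<integral>x. (\<Sum>j<m. f i j x) \<partial>N)"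
    by (rule Bochner_Integration.integral_sum) (use row in auto)
  also have "\<dots> = (\<Sum>i<n. \<Sum>j<m. integral\<^sup>L N (f i j))"
    by (intro sum.cong refl, rule Bochner_Integration.integral_sum) (use assms in auto)
  finally show "(\<integral>x. (\<Sum>i<n. \<Sum>j<m. f i j x) \<partial>N) = (\<Sum>i<n. \<Sum>j<m. integral\<^sup>L N (f i j))" .
qed

lemma integral_pair_mult:
  fixes f :: "'a \<Rightarrow> real" and g :: "'b \<Rightarrow> real"
  assumes "sigma_finite_measure N" "sigma_finite_measure N'"
    and f: "integrable N f" and g: "integrable N' g"
  shows "integrable (N \<Otimes>\<^sub>M N') (\<lambda>(x, y). f x * g y)"
    and "(\<integral>(x, y). f x * g y \<partial>(N \<Otimes>\<^sub>M N')) = integral\<^sup>L N f * integral\<^sup>L N' g"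
proof -
  interpret M: sigma_finite_measure N by fact
  interpret N: sigma_finite_measure N' by fact
  interpret pair_sigma_finite N N' ..
  have [measurable]: "f \<in> borel_measurable N" "g \<in> borel_measurable N'" using f g by auto
  show *: "integrable (N \<Otimes>\<^sub>M N') (\<lambda>(x, y). f x * g y)"
  proof (rule Fubini_integrable)
    show "integrable N (\<lambda>x. \<integral>y. norm (case (x, y) of (x, y) \<Rightarrow> f x * g y) \<partial>N')"
      unfolding prod.case real_norm_def abs_mult
      by (simp only: integral_mult_right_zero) (intro integrable_mult_left integrable_abs f)
    show "AE x in N. integrable N' (\<lambda>y. case (x, y) of (x, y) \<Rightarrow> f x * g y)"
      unfolding prod.case by (intro AE_I2 integrable_mult_right g)
  qed simp
  show "(\<integral>(x, y). f x * g y \<partial>(N \<Otimes>\<^sub>M N')) = integral\<^sup>L N f * integral\<^sup>L N' g"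
    by (subst integral_fst'[OF *, symmetric]) (simp only: prod.case integral_mult_right_zero integral_mult_left_zero)
qed


section \<open>Independence of Brownian increments\<close>

locale brownian = prob_space M for M :: "'w measure" +
  fixes W :: "real \<Rightarrow> 'w \<Rightarrow> real"
  assumes brownian: "brownian_motion M W"
begin

definition increment_events :: "real \<Rightarrow> real \<Rightarrow> 'w set set" where
  "increment_events s t = {(\<lambda>\<omega>. W r \<omega> - W s \<omega>) -` B \<inter> space M | r B. r \<in> {s..t} \<and> B \<in> sets borel}"

text \<open>The events in \<open>increment_events\<close> constrain a single time and are not closed
  under intersection. These finite-dimensional events are, and so serve as the pi-system generating
  \<open>filt\<close> up to null sets.\<close>

definition cylinders :: "real \<Rightarrow> real \<Rightarrow> 'w set set" where
  "cylinders r c = {{\<omega>\<in>space M. \<forall>x\<in>F. W x \<omega> - W r \<omega> \<in> B x} | F B.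
     finite F \<and> F \<subseteq> {r..c} \<and> (\<forall>x\<in>F. B x \<in> sets borel)}"

lemma W_measurable [measurable (raw)]: "0 \<le> t \<Longrightarrow> W t \<in> borel_measurable M"
  using brownian by (auto simp: brownian_motion_def)

lemma Int_stable_cylinders: "Int_stable (cylinders r c)"
proof (rule Int_stableI)
  fix A A' assume "A \<in> cylinders r c" "A' \<in> cylinders r c"
  then obtain F B F' B' where
    A: "A = {\<omega>\<in>space M. \<forall>x\<in>F. W x \<omega> - W r \<omega> \<in> B x}" "finite F" "F \<subseteq> {r..c}" "\<forall>x\<in>F. B x \<in> sets borel" and
    A': "A' = {\<omega>\<in>space M. \<forall>x\<in>F'. W x \<omega> - W r \<omega> \<in> B' x}" "finite F'" "F' \<subseteq> {r..c}" "\<forall>x\<in>F'. B' x \<in> sets borel"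
    by (auto simp: cylinders_def)
  define C where "C x = (if x \<in> F then B x else UNIV) \<inter> (if x \<in> F' then B' x else UNIV)" for x
  have "A \<inter> A' = {\<omega>\<in>space M. \<forall>x\<in>F \<union> F'. W x \<omega> - W r \<omega> \<in> C x}"
    using A(1) A'(1) by (auto simp: C_def)
  moreover have "\<forall>x\<in>F \<union> F'. C x \<in> sets borel"
    using A(4) A'(4) by (auto simp: C_def)
  ultimately show "A \<inter> A' \<in> cylinders r c"
    unfolding cylinders_def using A(2,3) A'(2,3) by blast
qed

lemma cylinders_events: "0 \<le> r \<Longrightarrow> cylinders r c \<subseteq> events"
proof
  fix A assume r: "0 \<le> r" and "A \<in> cylinders r c"
  then obtain F B where
    A: "A = {\<omega>\<in>space M. \<forall>x\<in>F. W x \<omega> - W r \<omega> \<in> B x}" "finite F" "F \<subseteq> {r..c}" "\<forall>x\<in>F. B x \<in> sets borel"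
    by (auto simp: cylinders_def)
  have "{\<omega>\<in>space M. W x \<omega> - W r \<omega> \<in> B x} \<in> events" if "x \<in> F" for x
  proof -
    have "0 \<le> x" "B x \<in> sets borel" using that A r by auto
    then show ?thesis using r by measurable
  qed
  then show "A \<in> events"
    unfolding A(1) using A(2) by (rule sets.sets_Collect_finite_All)
qed

lemma prob_Int_cylinders:
  assumes rct: "0 \<le> r" "r \<le> c" "c \<le> t" and "A \<in> cylinders r c" "B \<in> cylinders c t"
  shows "prob (A \<inter> B) = prob A * prob B"
proof -
  obtain F U where
    A: "A = {\<omega>\<in>space M. \<forall>x\<in>F. W x \<omega> - W r \<omega> \<in> U x}" "finite F" "F \<subseteq> {r..c}" "\<forall>x\<in>F. U x \<in> sets borel"
    using assms(4) by (auto simp: cylinders_def)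
  obtain G V where
    B: "B = {\<omega>\<in>space M. \<forall>x\<in>G. W x \<omega> - W c \<omega> \<in> V x}" "finite G" "G \<subseteq> {c..t}" "\<forall>x\<in>G. V x \<in> sets borel"
    using assms(5) by (auto simp: cylinders_def)
  \<comment> \<open>Sorting all times involved turns the two events into events of disjoint blocks of consecutive increments.\<close>
  define H where "H = insert r (insert c (F \<union> G))"
  define xs where "xs = sorted_list_of_set H"
  define n where "n = length xs - 1"
  define X where "X i \<omega> = W (xs ! Suc i) \<omega> - W (xs ! i) \<omega>" for i \<omega>
  have fH: "finite H" using A B by (auto simp: H_def)
  have set_xs: "set xs = H" and sorted: "sorted_wrt (<) xs"
    using fH by (simp_all add: xs_def)
  have len: "length xs = Suc n"
    using set_xs by (cases xs) (auto simp: n_def H_def)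
  have mono: "xs ! i < xs ! j" if "i < j" "j \<le> n" for i j
    using sorted that len by (simp add: sorted_wrt_iff_nth_less)
  have monoD: "i \<le> j" if "xs ! i \<le> xs ! j" "i \<le> n" "j \<le> n" for i j
    using mono[of j i] that by (metis leI not_le)
  have ge: "r \<le> x" if "x \<in> H" for x
    using that A B rct by (auto simp: H_def)
  have x0: "xs ! 0 = r"
  proof -
    obtain i where i: "i \<le> n" "xs ! i = r"
      using set_xs len by (metis H_def in_set_conv_nth insertI1 less_Suc_eq_le)
    have "xs ! 0 \<in> H" using set_xs len by (metis nth_mem zero_less_Suc)
    then have "i \<le> 0" using monoD[of i 0] ge i by auto
    then show ?thesis using i by simp
  qed
  \<comment> \<open>The position of \<open>c\<close> in the sorted list is where the two blocks
    meet: increments with index below \<open>k\<close> lie before \<open>c\<close>, the others after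
    it.\<close>
  obtain k where k: "k \<le> n" "xs ! k = c"
    using set_xs len by (metis H_def in_set_conv_nth insertCI less_Suc_eq_le)
  have "\<forall>x\<in>H. \<exists>i. i \<le> n \<and> xs ! i = x"
    using set_xs len by (metis in_set_conv_nth less_Suc_eq_le)
  then obtain ix where ix: "\<And>x. x \<in> H \<Longrightarrow> ix x \<le> n \<and> xs ! ix x = x" by metis
  have ixF: "ix x \<le> k" if "x \<in> F" for x
    using that ix[of x] k monoD[of "ix x" k] A by (auto simp: H_def)
  have ixG: "k \<le> ix x" if "x \<in> G" for x
    using that ix[of x] k monoD[of k "ix x"] B by (auto simp: H_def)
  have "indep_vars (\<lambda>_. borel) X {..<n}"
    using brownian x0 rct mono unfolding brownian_motion_def X_def by (auto simp: Suc_le_eq)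
  then have iv: "indep_var (PiM {..<k} (\<lambda>_. borel)) (\<lambda>\<omega>. restrict (\<lambda>i. X i \<omega>) {..<k})
      (PiM {k..<n} (\<lambda>_. borel)) (\<lambda>\<omega>. restrict (\<lambda>i. X i \<omega>) {k..<n})"
    using k by (intro indep_var_restrict) auto
  \<comment> \<open>By telescoping, the increment from \<open>r\<close> to \<open>x\<close> is the
    sum of the first \<open>ix x\<close> consecutive increments, and the one from \<open>c\<close>
    is the sum starting at \<open>k\<close>. So \<open>A\<close> and \<open>B\<close> are preimages
    of sets that read one block each.\<close>
  define A' where "A' = {y\<in>space (PiM {..<k} (\<lambda>_. borel)). \<forall>x\<in>F. (\<Sum>l<ix x. y l) \<in> U x}"
  define B' where "B' = {y\<in>space (PiM {k..<n} (\<lambda>_. borel)). \<forall>x\<in>G. (\<Sum>l=k..<ix x. y l) \<in> V x}"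
  have A'm: "A' \<in> sets (PiM {..<k} (\<lambda>_. borel))" unfolding A'_def
  proof (rule sets.sets_Collect_finite_All[OF _ A(2)])
    fix x assume x: "x \<in> F"
    have "(\<lambda>y. \<Sum>l<ix x. y l :: real) \<in> borel_measurable (PiM {..<k} (\<lambda>_. borel))"
      using ixF[OF x] by (intro borel_measurable_sum measurable_component_singleton) auto
    moreover have "U x \<in> sets borel" using A x by auto
    ultimately show "{y \<in> space (Pi\<^sub>M {..<k} (\<lambda>_. borel)). (\<Sum>l<ix x. y l) \<in> U x} \<in> sets (Pi\<^sub>M {..<k} (\<lambda>_. borel))"
      by measurable
  qed
  have B'm: "B' \<in> sets (PiM {k..<n} (\<lambda>_. borel))" unfolding B'_def
  proof (rule sets.sets_Collect_finite_All[OF _ B(2)])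
    fix x assume x: "x \<in> G"
    have "ix x \<le> n" using ix x by (auto simp: H_def)
    then have "(\<lambda>y. \<Sum>l=k..<ix x. y l :: real) \<in> borel_measurable (PiM {k..<n} (\<lambda>_. borel))"
      by (intro borel_measurable_sum measurable_component_singleton) auto
    moreover have "V x \<in> sets borel" using B x by auto
    ultimately show "{y \<in> space (Pi\<^sub>M {k..<n} (\<lambda>_. borel)). (\<Sum>l=k..<ix x. y l) \<in> V x} \<in> sets (Pi\<^sub>M {k..<n} (\<lambda>_. borel))"
      by measurable
  qed
  have sumF: "(\<Sum>l<ix x. X l \<omega>) = W x \<omega> - W r \<omega>" if "x \<in> F" for x \<omega>
    using sum_lessThan_telescope[of "\<lambda>i. W (xs ! i) \<omega>" "ix x"] ix[of x] that x0
    by (auto simp: X_def H_def)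
  have sumG: "(\<Sum>l=k..<ix x. X l \<omega>) = W x \<omega> - W c \<omega>" if "x \<in> G" for x \<omega>
    using sum_Suc_diff'[of k "ix x" "\<lambda>i. W (xs ! i) \<omega>"] ix[of x] that k ixG
    by (auto simp: X_def H_def)
  have A_eq: "(\<lambda>\<omega>. restrict (\<lambda>i. X i \<omega>) {..<k}) -` A' \<inter> space M = A"
  proof -
    have "(\<Sum>l<ix x. restrict (\<lambda>i. X i \<omega>) {..<k} l) = W x \<omega> - W r \<omega>" if "x \<in> F" for x \<omega>
      using ixF[OF that] by (subst sumF[OF that, symmetric]) (auto intro!: sum.cong)
    then show ?thesis unfolding A'_def A(1) by (auto simp: space_PiM)
  qed
  have B_eq: "(\<lambda>\<omega>. restrict (\<lambda>i. X i \<omega>) {k..<n}) -` B' \<inter> space M = B"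
  proof -
    have "(\<Sum>l=k..<ix x. restrict (\<lambda>i. X i \<omega>) {k..<n} l) = W x \<omega> - W c \<omega>" if "x \<in> G" for x \<omega>
      using ix[of x] that by (subst sumG[OF that, symmetric]) (auto intro!: sum.cong simp: H_def)
    then show ?thesis unfolding B'_def B(1) by (auto simp: space_PiM)
  qed
  have "A \<inter> B = (\<lambda>\<omega>. (restrict (\<lambda>i. X i \<omega>) {..<k}, restrict (\<lambda>i. X i \<omega>) {k..<n})) -` (A' \<times> B') \<inter> space M"
    using A_eq B_eq by auto
  then show ?thesis
    using indep_varD[OF iv A'm B'm] A_eq B_eq by simp
qed

lemma increment_events_cylinders: "increment_events s t \<subseteq> cylinders s t"
proof -
  have "(\<lambda>\<omega>. W x \<omega> - W s \<omega>) -` B \<inter> space M \<in> cylinders s t" if "x \<in> {s..t}" "B \<in> sets borel" for x B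
    unfolding cylinders_def using that by (intro CollectI exI[of _ "{x}"] exI[of _ "\<lambda>_. B"]) auto
  then show ?thesis unfolding increment_events_def by blast
qed

section \<open>Measurability and independence for the augmented filtrations\<close>

lemma space_filt [simp]: "space (filt M W s t) = space M"
  unfolding filt_def by (rule space_measure_of_conv)

lemma sets_filt: "sets (filt M W s t) = sigma_sets (space M) (increment_events s t \<union> null_sets M)"
proof -
  have "increment_events s t \<union> null_sets M \<subseteq> Pow (space M)"
    unfolding increment_events_def using sets.sets_into_space by blast
  then show ?thesis unfolding filt_def increment_events_def by (rule sets_measure_of)
qed

lemma filt_le:
  assumes "0 \<le> s" shows "sets (filt M W s t) \<subseteq> sigma_sets (space M) (cylinders s t \<union> null_sets M)"
    and "sigma_sets (space M) (cylinders s t \<union> null_sets M) \<subseteq> events"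
  unfolding sets_filt
  using increment_events_cylinders[of s t] cylinders_events[OF assms, of t]
  by (intro sigma_sets_mono' sets.sigma_sets_subset; blast)+

lemma subalgebra_filt: "0 \<le> s \<Longrightarrow> subalgebra M (filt M W s t)"
  unfolding subalgebra_def using filt_le[of s t] by auto

lemma filt_measurable: "0 \<le> s \<Longrightarrow> f \<in> borel_measurable (filt M W s t) \<Longrightarrow> f \<in> borel_measurable M"
  by (meson subalgebra_filt measurable_from_subalg)

lemma measurable_increment_filt:
  assumes "s \<le> r" "r \<le> t" shows "(\<lambda>\<omega>. W r \<omega> - W s \<omega>) \<in> borel_measurable (filt M W s t)"
  using assms by (intro measurableI) (auto simp: sets_filt increment_events_def intro!: sigma_sets.Basic)

text \<open>The two filtrations count increments from different origins, so generators do not simply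
  include. An increment from \<open>s\<close> is the difference of two increments from
  \<open>r\<close>.\<close>

lemma filt_mono:
  assumes "r \<le> s" "t \<le> t'" shows "sets (filt M W s t) \<subseteq> sets (filt M W r t')"
proof -
  have "(\<lambda>\<omega>. W x \<omega> - W s \<omega>) -` B \<inter> space M \<in> sets (filt M W r t')" if "x \<in> {s..t}" "B \<in> sets borel" for x B
  proof -
    have "(\<lambda>\<omega>. (W x \<omega> - W r \<omega>) - (W s \<omega> - W r \<omega>)) \<in> borel_measurable (filt M W r t')"
      using that assms by (intro borel_measurable_diff measurable_increment_filt) auto
    from measurable_sets[OF this that(2)] show ?thesis by simp
  qed
  then have "increment_events s t \<union> null_sets M \<subseteq> sets (filt M W r t')"
    by (auto simp: increment_events_def sets_filt)
  from sets.sigma_sets_subset[OF this] show ?thesis by (simp add: sets_filt[of s t])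
qed

lemma measurable_filt_mono:
  assumes "f \<in> borel_measurable (filt M W s t)" "r \<le> s" "t \<le> t'"
  shows "f \<in> borel_measurable (filt M W r t')"
  using assms(1) filt_mono[OF assms(2,3)] by (intro measurable_from_subalg[OF _ assms(1)]) (auto simp: subalgebra_def)

text \<open>Adjoining the null sets keeps the cylinders intersection-stable, and a null event is
  independent of every event. Independence of the two pi-systems then extends to the sigma-algebras
  they generate, which contain those of \<open>filt\<close>.\<close>

lemma indep_set_filt:
  assumes "0 \<le> r" "r \<le> c" "c \<le> t"
  shows "indep_set (sets (filt M W r c)) (sets (filt M W c t))"
proof -
  have stable: "Int_stable (cylinders a b \<union> null_sets M)" if "0 \<le> a" for a b
  proof (rule Int_stableI)
    fix A B assume "A \<in> cylinders a b \<union> null_sets M" "B \<in> cylinders a b \<union> null_sets M"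
    then show "A \<inter> B \<in> cylinders a b \<union> null_sets M"
      using Int_stableD[OF Int_stable_cylinders, of A a b B] cylinders_events[OF that]
      by (auto intro: null_set_Int1 null_set_Int2)
  qed
  have "prob (A \<inter> B) = prob A * prob B"
    if A: "A \<in> cylinders r c \<union> null_sets M" and B: "B \<in> cylinders c t \<union> null_sets M" for A B
  proof (cases "A \<in> null_sets M \<or> B \<in> null_sets M")
    case True
    moreover have "A \<in> events" "B \<in> events"
      using A B assms cylinders_events[of r c] cylinders_events[of c t] by auto
    ultimately have "A \<inter> B \<in> null_sets M" by (auto intro: null_set_Int1 null_set_Int2)
    then show ?thesis using True measure_eq_0_null_sets[of _ M] by auto
  next
    case False
    then show ?thesis using A B prob_Int_cylinders[OF assms] by auto
  qed
  then have "indep_set (cylinders r c \<union> null_sets M) (cylinders c t \<union> null_sets M)"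
    unfolding indep_sets2_eq using cylinders_events[of r c] cylinders_events[of c t] assms by auto
  then have "indep_set (sigma_sets (space M) (cylinders r c \<union> null_sets M))
     (sigma_sets (space M) (cylinders c t \<union> null_sets M))"
    using assms by (intro indep_set_sigma_sets stable) auto
  then show ?thesis
    unfolding indep_sets2_eq using filt_le[of r c] filt_le[of c t] assms
    by (meson order_trans subset_iff)
qed

lemma indep_var_filt:
  fixes f g :: "'w \<Rightarrow> 'a::topological_space"
  assumes "0 \<le> r" "r \<le> c" "c \<le> t"
    and f: "f \<in> borel_measurable (filt M W r c)" and g: "g \<in> borel_measurable (filt M W c t)"
  shows "indep_var borel f borel g"
proof -
  have fM: "f \<in> borel_measurable M" and gM: "g \<in> borel_measurable M"
    using filt_measurable[OF _ f] filt_measurable[OF _ g] assms by auto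
  have sub: "sigma_sets (space M) {h -` A \<inter> space M | A. A \<in> sets borel} \<subseteq> sets (filt M W a b)"
    if "h \<in> borel_measurable (filt M W a b)" for h :: "'w \<Rightarrow> 'c::topological_space" and a b
  proof -
    have "{h -` A \<inter> space M | A. A \<in> sets borel} \<subseteq> sets (filt M W a b)"
      using measurable_sets[OF that] by auto
    from sets.sigma_sets_subset[OF this] show ?thesis by simp
  qed
  show ?thesis
    unfolding indep_var_eq using indep_set_filt[OF assms(1-3)] sub[OF f] sub[OF g] fM gM
    unfolding indep_sets2_eq by (meson order_trans subset_iff)
qed

lemma
  fixes f g :: "'w \<Rightarrow> real"
  assumes "0 \<le> r" "r \<le> c" "c \<le> t"
    and "f \<in> borel_measurable (filt M W r c)" "g \<in> borel_measurable (filt M W c t)"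
    and "integrable M f" "integrable M g"
  shows integrable_mult_filt: "integrable M (\<lambda>\<omega>. f \<omega> * g \<omega>)"
    and expectation_mult_filt: "expectation (\<lambda>\<omega>. f \<omega> * g \<omega>) = expectation f * expectation g"
  using indep_var_integrable[OF indep_var_filt[OF assms(1-5)] assms(6,7)]
    indep_var_lebesgue_integral[OF indep_var_filt[OF assms(1-5)] assms(6,7)] by auto

text \<open>The joint law is the product of the marginals, so Tonelli applies without integrability.
  This is the form needed for \<open>J t s\<close> and \<open>X s\<close>, whose second moments at a
  given time may be infinite.\<close>

lemma nn_integral_mult_filt:
  fixes f g :: "'w \<Rightarrow> ennreal"
  assumes "0 \<le> r" "r \<le> c" "c \<le> t"
    and f: "f \<in> borel_measurable (filt M W r c)" and g: "g \<in> borel_measurable (filt M W c t)"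
  shows "(\<integral>\<^sup>+\<omega>. f \<omega> * g \<omega> \<partial>M) = (\<integral>\<^sup>+\<omega>. f \<omega> \<partial>M) * (\<integral>\<^sup>+\<omega>. g \<omega> \<partial>M)"
proof -
  have [measurable]: "f \<in> borel_measurable M" "g \<in> borel_measurable M"
    using filt_measurable[OF _ f] filt_measurable[OF _ g] assms by auto
  have eq: "distr M borel f \<Otimes>\<^sub>M distr M borel g = distr M (borel \<Otimes>\<^sub>M borel) (\<lambda>\<omega>. (f \<omega>, g \<omega>))"
    using indep_var_filt[OF assms] unfolding indep_var_distribution_eq by simp
  interpret G: prob_space "distr M borel g" by (rule prob_space_distr) simp
  have "(\<integral>\<^sup>+\<omega>. f \<omega> * g \<omega> \<partial>M) = (\<integral>\<^sup>+p. fst p * snd p \<partial>distr M (borel \<Otimes>\<^sub>M borel) (\<lambda>\<omega>. (f \<omega>, g \<omega>)))"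
    by (subst nn_integral_distr) auto
  also have "\<dots> = (\<integral>\<^sup>+x. \<integral>\<^sup>+y. x * y \<partial>distr M borel g \<partial>distr M borel f)"
    unfolding eq[symmetric] by (subst G.nn_integral_fst[symmetric]) auto
  also have "\<dots> = (\<integral>\<^sup>+\<omega>. f \<omega> \<partial>M) * (\<integral>\<^sup>+\<omega>. g \<omega> \<partial>M)"
    by (simp add: nn_integral_cmult nn_integral_multc nn_integral_distr)
  finally show ?thesis .
qed

end


section \<open>The Ito isometry\<close>

lemma integrable_bounded_mult:
  fixes u g :: "'a \<Rightarrow> real"
  assumes "u \<in> borel_measurable M" "\<And>x. x \<in> space M \<Longrightarrow> \<bar>u x\<bar> \<le> C" "integrable M g"
  shows "integrable M (\<lambda>x. u x * g x)"
proof (rule Bochner_Integration.integrable_bound)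
  show "integrable M (\<lambda>x. C * g x)" using assms by simp
  show "(\<lambda>x. u x * g x) \<in> borel_measurable M" using assms by measurable
  show "AE x in M. norm (u x * g x) \<le> norm (C * g x)"
  proof (rule AE_I2)
    fix x assume "x \<in> space M"
    then have "\<bar>u x\<bar> \<le> \<bar>C\<bar>" using assms(2) abs_ge_self order_trans by blast
    then show "norm (u x * g x) \<le> norm (C * g x)"
      by (auto simp: abs_mult intro: mult_right_mono)
  qed
qed

lemma integral_interval_overlap:
  fixes a0 a b c d b0 :: real
  assumes "a0 \<le> a" "a \<le> b" "b \<le> b0" "a0 \<le> c" "c \<le> d" "d \<le> b0"
  shows "integrable (interval_measure a0 b0) (\<lambda>t. indicator {a<..b} t * indicator {c<..d} t :: real)"
    and "(\<integral>t. indicator {a<..b} t * indicator {c<..d} t \<partial>interval_measure a0 b0) = max 0 (min b d - max a c)"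
proof -
  have eq: "indicator {a0<..<b0} t *\<^sub>R (indicator {a<..b} t * indicator {c<..d} t :: real) = indicator ({max a c<..min b d} \<inter> {a0<..<b0}) t" for t
    by (auto simp: indicator_def)
  \<comment> \<open>The half-open overlap can contain \<open>b0\<close>, which the open interval of
    integration omits; this single point is the only difference.\<close>
  have ae: "AE t in lborel. (indicator ({max a c<..min b d} \<inter> {a0<..<b0}) t :: real) = indicator {max a c<..min b d} t"
    using AE_lborel_singleton[of b0]
    by eventually_elim (use assms in \<open>auto simp: indicator_def\<close>)
  have i: "integrable lborel (indicator {max a c<..min b d} :: real \<Rightarrow> real)"
    by (cases "max a c \<le> min b d") (auto simp: integrable_indicator_iff)
  have v: "(\<integral>t. indicator {max a c<..min b d} t \<partial>lborel) = max 0 (min b d - max a c)"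
  proof (cases "max a c \<le> min b d")
    case False
    then have e: "{max a c<..min b d} = {}" by auto
    show ?thesis unfolding e using False by (simp del: min.bounded_iff max.bounded_iff)
  qed simp
  have i': "integrable lborel (indicator ({max a c<..min b d} \<inter> {a0<..<b0}) :: real \<Rightarrow> real)"
    by (rule integrable_cong_AE_imp[OF i]) (use ae in auto)
  have v': "(\<integral>t. indicator ({max a c<..min b d} \<inter> {a0<..<b0}) t \<partial>lborel) = max 0 (min b d - max a c)"
    unfolding v[symmetric] by (rule integral_cong_AE[OF _ _ ae]) auto
  show "integrable (interval_measure a0 b0) (\<lambda>t. indicator {a<..b} t * indicator {c<..d} t :: real)"
    by (subst integrable_restrict_space) (simp_all only: eq i', simp)
  show "(\<integral>t. indicator {a<..b} t * indicator {c<..d} t \<partial>interval_measure a0 b0) = max 0 (min b d - max a c)"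
    by (subst integral_restrict_space) (simp_all only: eq v', simp)
qed

context brownian begin

abbreviation process_inner :: "real \<Rightarrow> real \<Rightarrow> (real \<Rightarrow> 'w \<Rightarrow> 'v::euclidean_space) \<Rightarrow> (real \<Rightarrow> 'w \<Rightarrow> 'v) \<Rightarrow> real" where
  "process_inner a b \<xi> \<eta> \<equiv> (\<integral>(t, \<omega>). \<xi> t \<omega> \<bullet> \<eta> t \<omega> \<partial>process_measure M a b)"

lemma
  assumes "0 \<le> s" "s \<le> t"
  shows integrable_increment: "integrable M (\<lambda>\<omega>. W t \<omega> - W s \<omega>)"
    and expectation_increment: "expectation (\<lambda>\<omega>. W t \<omega> - W s \<omega>) = 0"
    and integrable_increment_sq: "integrable M (\<lambda>\<omega>. (W t \<omega> - W s \<omega>)\<^sup>2)"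
    and expectation_increment_sq: "expectation (\<lambda>\<omega>. (W t \<omega> - W s \<omega>)\<^sup>2) = t - s"
proof -
  let ?D = "\<lambda>\<omega>. W t \<omega> - W s \<omega>"
  have "integrable M ?D \<and> expectation ?D = 0 \<and> integrable M (\<lambda>\<omega>. (?D \<omega>)\<^sup>2) \<and> expectation (\<lambda>\<omega>. (?D \<omega>)\<^sup>2) = t - s"
  proof (cases "s = t")
    case False
    then have st: "s < t" using assms by simp
    define \<sigma> where "\<sigma> = sqrt (t - s)"
    have \<sigma>: "0 < \<sigma>" using st by (simp add: \<sigma>_def)
    have D: "distributed M lborel ?D (\<lambda>x. ennreal (normal_density 0 \<sigma> x))"
      using brownian st assms by (auto simp: brownian_motion_def \<sigma>_def)
    have e0: "expectation ?D = 0" using normal_distributed_expectation[OF \<sigma> D] .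
    have "variance ?D = \<sigma>\<^sup>2" using normal_distributed_variance[OF \<sigma> D] .
    then have e2: "expectation (\<lambda>\<omega>. (?D \<omega>)\<^sup>2) = t - s" using e0 st by (simp add: \<sigma>_def)
    have "integrable lborel (\<lambda>x. normal_density 0 \<sigma> x * x)"
      using integrable_normal_moment[OF \<sigma>, of 0 1] by simp
    then have i1: "integrable M ?D"
      using distributed_integrable[OF D, of "\<lambda>x. x"] by simp
    have "integrable lborel (\<lambda>x. normal_density 0 \<sigma> x * x\<^sup>2)"
      using integrable_normal_moment[OF \<sigma>, of 0 2] by simp
    then have i2: "integrable M (\<lambda>\<omega>. (?D \<omega>)\<^sup>2)"
      using distributed_integrable[OF D, of "\<lambda>x. x\<^sup>2"] by simp
    show ?thesis using e0 e2 i1 i2 by simp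
  qed simp
  then show "integrable M ?D" "expectation ?D = 0" "integrable M (\<lambda>\<omega>. (?D \<omega>)\<^sup>2)" "expectation (\<lambda>\<omega>. (?D \<omega>)\<^sup>2) = t - s"
    by auto
qed

lemma increment_product:
  assumes "0 \<le> c" "c \<le> b" "c \<le> d"
  shows "integrable M (\<lambda>\<omega>. (W b \<omega> - W c \<omega>) * (W d \<omega> - W c \<omega>)) \<and>
    expectation (\<lambda>\<omega>. (W b \<omega> - W c \<omega>) * (W d \<omega> - W c \<omega>)) = min b d - c"
  using assms
proof (induction b d rule: linorder_wlog)
  case (le b d)
  \<comment> \<open>Cut the longer increment at \<open>b\<close>: the remainder is centred and
    independent of what precedes \<open>b\<close>, so only the square survives.\<close>
  have eq: "(W b \<omega> - W c \<omega>) * (W d \<omega> - W c \<omega>) =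
      (W b \<omega> - W c \<omega>)\<^sup>2 + (W b \<omega> - W c \<omega>) * (W d \<omega> - W b \<omega>)" for \<omega>
    by (simp add: algebra_simps power2_eq_square)
  have m: "(\<lambda>\<omega>. W b \<omega> - W c \<omega>) \<in> borel_measurable (filt M W c b)"
    "(\<lambda>\<omega>. W d \<omega> - W b \<omega>) \<in> borel_measurable (filt M W b d)"
    using le by (auto intro: measurable_increment_filt)
  have i: "integrable M (\<lambda>\<omega>. W b \<omega> - W c \<omega>)" "integrable M (\<lambda>\<omega>. W d \<omega> - W b \<omega>)"
    using le by (auto intro: integrable_increment)
  have "integrable M (\<lambda>\<omega>. (W b \<omega> - W c \<omega>) * (W d \<omega> - W b \<omega>))"
    "expectation (\<lambda>\<omega>. (W b \<omega> - W c \<omega>) * (W d \<omega> - W b \<omega>)) = 0"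
    using integrable_mult_filt[OF _ _ _ m i] expectation_mult_filt[OF _ _ _ m i] le
    by (auto simp: expectation_increment)
  then show ?case unfolding eq using integrable_increment_sq[of c b] expectation_increment_sq[of c b] le by simp
next
  case (sym b d)
  then show ?case by (simp add: mult.commute min.commute)
qed

text \<open>The factor in front is the length of the overlap of \<open>{a<..b}\<close> and
  \<open>{c<..d}\<close>. Assume \<open>a \<le> c\<close> by symmetry. If the intervals are
  disjoint, the later increment is centred and independent of everything else. Otherwise the earlier
  interval is cut at \<open>c\<close>: its first part contributes 0 for the same reason, and the
  rest is a product of increments from \<open>c\<close>, independent of the weights.\<close>

lemma weighted_increments:
  fixes \<zeta> \<zeta>' :: "'w \<Rightarrow> 'v::euclidean_space"
  assumes "0 \<le> a" "a \<le> b" "0 \<le> c" "c \<le> d"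
    and "\<zeta> \<in> borel_measurable (filt M W 0 a)" "\<zeta>' \<in> borel_measurable (filt M W 0 c)"
    and "bounded (\<zeta> ` space M)" "bounded (\<zeta>' ` space M)"
  shows "integrable M (\<lambda>\<omega>. ((W b \<omega> - W a \<omega>) *\<^sub>R \<zeta> \<omega>) \<bullet> ((W d \<omega> - W c \<omega>) *\<^sub>R \<zeta>' \<omega>)) \<and>
    expectation (\<lambda>\<omega>. ((W b \<omega> - W a \<omega>) *\<^sub>R \<zeta> \<omega>) \<bullet> ((W d \<omega> - W c \<omega>) *\<^sub>R \<zeta>' \<omega>)) =
      max 0 (min b d - max a c) * expectation (\<lambda>\<omega>. \<zeta> \<omega> \<bullet> \<zeta>' \<omega>)"
proof -
  have "integrable M (\<lambda>\<omega>. ((W b \<omega> - W a \<omega>) *\<^sub>R \<zeta> \<omega>) \<bullet> ((W d \<omega> - W c \<omega>) *\<^sub>R \<zeta>' \<omega>)) \<and>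
    expectation (\<lambda>\<omega>. ((W b \<omega> - W a \<omega>) *\<^sub>R \<zeta> \<omega>) \<bullet> ((W d \<omega> - W c \<omega>) *\<^sub>R \<zeta>' \<omega>)) =
      max 0 (min b d - max a c) * expectation (\<lambda>\<omega>. \<zeta> \<omega> \<bullet> \<zeta>' \<omega>)"
    if ac: "a \<le> c" and abcd: "0 \<le> a" "a \<le> b" "c \<le> d"
      and meas: "\<zeta> \<in> borel_measurable (filt M W 0 a)" "\<zeta>' \<in> borel_measurable (filt M W 0 c)"
      and bdd: "bounded (\<zeta> ` space M)" "bounded (\<zeta>' ` space M)"
    for a b c d and \<zeta> \<zeta>' :: "'w \<Rightarrow> 'v"
  proof -
    define u where "u \<omega> = \<zeta> \<omega> \<bullet> \<zeta>' \<omega>" for \<omega>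
    obtain C C' where C: "\<And>\<omega>. \<omega> \<in> space M \<Longrightarrow> norm (\<zeta> \<omega>) \<le> C" "\<And>\<omega>. \<omega> \<in> space M \<Longrightarrow> norm (\<zeta>' \<omega>) \<le> C'"
      using bdd unfolding bounded_iff by auto
    have uC: "\<bar>u \<omega>\<bar> \<le> C * C'" if "\<omega> \<in> space M" for \<omega>
      unfolding u_def by (rule order_trans[OF Cauchy_Schwarz_ineq2])
        (intro mult_mono C[OF that] order_trans[OF norm_ge_zero C(1)[OF that]] norm_ge_zero)
    have um: "u \<in> borel_measurable (filt M W 0 c)"
      unfolding u_def[abs_def] using measurable_filt_mono[OF meas(1), of 0 c] meas(2) ac by simp
    then have uM: "u \<in> borel_measurable M" by (rule filt_measurable[rotated]) simp
    have ui: "integrable M u"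
      using integrable_bounded_mult[OF uM uC, of "\<lambda>_. 1"] by simp
    have eq: "((W b \<omega> - W a \<omega>) *\<^sub>R \<zeta> \<omega>) \<bullet> ((W d \<omega> - W c \<omega>) *\<^sub>R \<zeta>' \<omega>) = (u \<omega> * (W b \<omega> - W a \<omega>)) * (W d \<omega> - W c \<omega>)" for \<omega>
      by (simp add: u_def)
    have incr: "(\<lambda>\<omega>. W y \<omega> - W x \<omega>) \<in> borel_measurable (filt M W 0 z)" if "0 \<le> x" "x \<le> y" "y \<le> z" for x y z
      using measurable_filt_mono[OF measurable_increment_filt[of x y z], of 0 z] that by simp
    \<comment> \<open>Used with \<open>e = b\<close> for disjoint intervals and with
      \<open>e = c\<close> for the part of the earlier interval that precedes
      \<open>c\<close>.\<close>
    have ortho: "integrable M (\<lambda>\<omega>. (u \<omega> * (W e \<omega> - W a \<omega>)) * (W d \<omega> - W c \<omega>)) \<and>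
        expectation (\<lambda>\<omega>. (u \<omega> * (W e \<omega> - W a \<omega>)) * (W d \<omega> - W c \<omega>)) = 0" if e: "a \<le> e" "e \<le> c" for e
    proof -
      have m: "(\<lambda>\<omega>. u \<omega> * (W e \<omega> - W a \<omega>)) \<in> borel_measurable (filt M W 0 c)"
        using um incr[of a e c] e abcd by simp
      have m': "(\<lambda>\<omega>. W d \<omega> - W c \<omega>) \<in> borel_measurable (filt M W c d)"
        using abcd by (intro measurable_increment_filt) auto
      have i: "integrable M (\<lambda>\<omega>. u \<omega> * (W e \<omega> - W a \<omega>))"
        using e abcd by (intro integrable_bounded_mult[OF uM uC] integrable_increment) auto
      have i': "integrable M (\<lambda>\<omega>. W d \<omega> - W c \<omega>)" using ac abcd by (intro integrable_increment) auto
      show ?thesis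
        using integrable_mult_filt[OF _ _ _ m m' i i'] expectation_mult_filt[OF _ _ _ m m' i i'] expectation_increment[of c d] ac abcd
        by auto
    qed
    show ?thesis
    proof (cases "b \<le> c")
      case True
      then show ?thesis unfolding eq using ortho[of b] abcd ac by (simp add: max_def min_def)
    next
      case False
      have eq': "(u \<omega> * (W b \<omega> - W a \<omega>)) * (W d \<omega> - W c \<omega>) =
          (u \<omega> * (W c \<omega> - W a \<omega>)) * (W d \<omega> - W c \<omega>) + u \<omega> * ((W b \<omega> - W c \<omega>) * (W d \<omega> - W c \<omega>))" for \<omega>
        by (simp add: algebra_simps)
      have p: "integrable M (\<lambda>\<omega>. (W b \<omega> - W c \<omega>) * (W d \<omega> - W c \<omega>))"
        "expectation (\<lambda>\<omega>. (W b \<omega> - W c \<omega>) * (W d \<omega> - W c \<omega>)) = min b d - c"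
        using increment_product[of c b d] False abcd ac by auto
      have m: "(\<lambda>\<omega>. (W b \<omega> - W c \<omega>) * (W d \<omega> - W c \<omega>)) \<in> borel_measurable (filt M W c (max b d))"
        using False abcd by (intro borel_measurable_times measurable_increment_filt) auto
      have "integrable M (\<lambda>\<omega>. u \<omega> * ((W b \<omega> - W c \<omega>) * (W d \<omega> - W c \<omega>)))"
        "expectation (\<lambda>\<omega>. u \<omega> * ((W b \<omega> - W c \<omega>) * (W d \<omega> - W c \<omega>))) = expectation u * (min b d - c)"
        using integrable_mult_filt[OF _ _ _ um m ui p(1)] expectation_mult_filt[OF _ _ _ um m ui p(1)] p(2) False ac abcd
        by auto
      moreover have "max 0 (min b d - max a c) = min b d - c"
        using False ac abcd by (simp add: max_def min_def)
      ultimately show ?thesis unfolding eq eq' using ortho[of c] abcd ac by (simp add: u_def[abs_def])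
    qed
  qed
  from this[of a c b d \<zeta> \<zeta>'] this[of c a d b \<zeta>' \<zeta>] assms show ?thesis
    by (cases "a \<le> c") (simp_all add: inner_commute min.commute max.commute mult.commute)
qed


lemma sqnorm_eq: "sqnorm M a b \<xi> = sq_int (process_measure M a b) (\<lambda>(t, \<omega>). \<xi> t \<omega>)"
  by (simp add: sqnorm_def sq_int_def case_prod_unfold)

lemma sigma_finite_interval: "sigma_finite_measure (interval_measure a b)"
  by (rule sigma_finite_measure_restrict_space) (auto simp: sigma_finite_lborel)

lemma simple_integrandD:
  assumes "simple_integrand M W a b n \<tau> \<zeta>" "i < n"
  shows "a \<le> \<tau> i" "\<tau> i \<le> \<tau> (Suc i)" "\<tau> (Suc i) \<le> b" "\<zeta> i \<in> borel_measurable (filt M W 0 (\<tau> i))"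
    "\<zeta> i \<in> borel_measurable M" "bounded (\<zeta> i ` space M)"
proof -
  have step: "\<tau> k \<le> \<tau> (Suc k)" if "k < n" for k
    using assms(1) that by (auto simp: simple_integrand_def intro: less_imp_le)
  have "\<tau> 0 \<le> \<tau> i" using assms(2)
  proof (induction i)
    case (Suc i)
    then show ?case using step[of i] by auto
  qed simp
  then show "a \<le> \<tau> i" using assms(1) by (auto simp: simple_integrand_def)
  have "Suc i \<le> n" using assms(2) by simp
  then have "\<tau> (Suc i) \<le> \<tau> n"
  proof (induction rule: inc_induct)
    case (step m)
    then show ?case using \<open>\<And>k. k < n \<Longrightarrow> \<tau> k \<le> \<tau> (Suc k)\<close>[of m] by auto
  qed simp
  then show "\<tau> (Suc i) \<le> b" using assms(1) by (auto simp: simple_integrand_def)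
  show "\<tau> i \<le> \<tau> (Suc i)" using step assms(2) by simp
  show z: "\<zeta> i \<in> borel_measurable (filt M W 0 (\<tau> i))" "bounded (\<zeta> i ` space M)"
    using assms by (auto simp: simple_integrand_def)
  show "\<zeta> i \<in> borel_measurable M" by (rule filt_measurable[OF _ z(1)]) simp
qed

lemma integrable_inner_bounded:
  fixes f g :: "'w \<Rightarrow> 'v::euclidean_space"
  assumes [measurable]: "f \<in> borel_measurable M" "g \<in> borel_measurable M"
    and "bounded (f ` space M)" "bounded (g ` space M)"
  shows "integrable M (\<lambda>\<omega>. f \<omega> \<bullet> g \<omega>)"
proof -
  obtain C C' where C: "\<And>\<omega>. \<omega> \<in> space M \<Longrightarrow> norm (f \<omega>) \<le> C" "\<And>\<omega>. \<omega> \<in> space M \<Longrightarrow> norm (g \<omega>) \<le> C'"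
    using assms(3,4) unfolding bounded_iff by auto
  have "\<bar>f \<omega> \<bullet> g \<omega>\<bar> \<le> C * C'" if "\<omega> \<in> space M" for \<omega>
    by (rule order_trans[OF Cauchy_Schwarz_ineq2])
      (intro mult_mono C[OF that] order_trans[OF norm_ge_zero C(1)[OF that]] norm_ge_zero)
  then show ?thesis by (intro integrable_const_bound[where B="C * C'"]) auto
qed

text \<open>The two processes may have different partitions. Both sides expand into the same double
  sum \<open>c i j\<close>, the overlap length of two cells times the mean inner product of their
  weights: on the left by \<open>weighted_increments\<close>, on the right by Fubini.\<close>

lemma simple_isometry:
  fixes \<zeta> \<zeta>' :: "nat \<Rightarrow> 'w \<Rightarrow> 'v::euclidean_space"
  assumes a: "0 \<le> a"
    and s: "simple_integrand M W a b n \<tau> \<zeta>" and s': "simple_integrand M W a b n' \<tau>' \<zeta>'"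
  shows "integrable M (\<lambda>\<omega>. simple_integral W n \<tau> \<zeta> \<omega> \<bullet> simple_integral W n' \<tau>' \<zeta>' \<omega>)" (is ?i1)
    and "expectation (\<lambda>\<omega>. simple_integral W n \<tau> \<zeta> \<omega> \<bullet> simple_integral W n' \<tau>' \<zeta>' \<omega>) =
      (\<integral>(t, \<omega>). simple_process n \<tau> \<zeta> t \<omega> \<bullet> simple_process n' \<tau>' \<zeta>' t \<omega> \<partial>process_measure M a b)" (is ?e)
proof -
  define c where "c i j = max 0 (min (\<tau> (Suc i)) (\<tau>' (Suc j)) - max (\<tau> i) (\<tau>' j)) * expectation (\<lambda>\<omega>. \<zeta> i \<omega> \<bullet> \<zeta>' j \<omega>)" for i j
  define f where "f i j \<omega> = ((W (\<tau> (Suc i)) \<omega> - W (\<tau> i) \<omega>) *\<^sub>R \<zeta> i \<omega>) \<bullet> ((W (\<tau>' (Suc j)) \<omega> - W (\<tau>' j) \<omega>) *\<^sub>R \<zeta>' j \<omega>)" for i j \<omega>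
  define g where "g i j = (\<lambda>(t, \<omega>). (indicator {\<tau> i<..\<tau> (Suc i)} t * indicator {\<tau>' j<..\<tau>' (Suc j)} t) * (\<zeta> i \<omega> \<bullet> \<zeta>' j \<omega>))" for i j
  have f: "integrable M (f i j) \<and> expectation (f i j) = c i j" if "i < n" "j < n'" for i j
    unfolding f_def[abs_def] c_def
    using simple_integrandD[OF s that(1)] simple_integrandD[OF s' that(2)] a
    by (intro weighted_increments) auto
  have g: "integrable (process_measure M a b) (g i j) \<and> integral\<^sup>L (process_measure M a b) (g i j) = c i j" if "i < n" "j < n'" for i j
  proof -
    note D = simple_integrandD[OF s that(1)] simple_integrandD[OF s' that(2)]
    have z: "integrable M (\<lambda>\<omega>. \<zeta> i \<omega> \<bullet> \<zeta>' j \<omega>)"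
      using D by (intro integrable_inner_bounded) auto
    note o = integral_interval_overlap[OF D(1,2,3) D(7,8,9)]
    show ?thesis
      using integral_pair_mult[OF sigma_finite_interval sigma_finite_measure_axioms o(1) z] o(2)
      unfolding g_def process_measure_def c_def by simp
  qed
  have F: "simple_integral W n \<tau> \<zeta> \<omega> \<bullet> simple_integral W n' \<tau>' \<zeta>' \<omega> = (\<Sum>i<n. \<Sum>j<n'. f i j \<omega>)" for \<omega>
    unfolding simple_integral_def f_def by (simp only: inner_sum_left, simp only: inner_sum_right)
  have G: "(\<lambda>(t, \<omega>). simple_process n \<tau> \<zeta> t \<omega> \<bullet> simple_process n' \<tau>' \<zeta>' t \<omega>) = (\<lambda>p. \<Sum>i<n. \<Sum>j<n'. g i j p)"
    by (rule ext) (simp only: simple_process_def g_def inner_sum_left case_prod_unfold,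
      simp only: inner_sum_right inner_scaleR_left inner_scaleR_right mult.assoc mult.commute mult.left_commute)
  show ?i1 unfolding F by (rule integrable_double_sum) (use f in auto)
  have "(\<integral>\<omega>. (\<Sum>i<n. \<Sum>j<n'. f i j \<omega>) \<partial>M) = (\<Sum>i<n. \<Sum>j<n'. c i j)"
    by (subst integral_double_sum) (use f in \<open>auto intro!: sum.cong\<close>)
  moreover have "(\<integral>p. (\<Sum>i<n. \<Sum>j<n'. g i j p) \<partial>process_measure M a b) = (\<Sum>i<n. \<Sum>j<n'. c i j)"
    by (subst integral_double_sum) (use g in \<open>auto intro!: sum.cong\<close>)
  ultimately show ?e unfolding F G by simp
qed

lemma simple_integral_measurable:
  assumes "0 \<le> a" "simple_integrand M W a b n \<tau> \<zeta>"
  shows "simple_integral W n \<tau> \<zeta> \<in> borel_measurable M"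
  unfolding simple_integral_def[abs_def]
proof (intro borel_measurable_sum)
  fix i assume "i \<in> {..<n}"
  then have "i < n" by simp
  note D = simple_integrandD[OF assms(2) this]
  have [measurable]: "W (\<tau> i) \<in> borel_measurable M" "W (\<tau> (Suc i)) \<in> borel_measurable M" "\<zeta> i \<in> borel_measurable M"
    using D assms(1) by (auto intro: W_measurable)
  show "(\<lambda>\<omega>. (W (\<tau> (Suc i)) \<omega> - W (\<tau> i) \<omega>) *\<^sub>R \<zeta> i \<omega>) \<in> borel_measurable M" by measurable
qed

lemma simple_process_measurable:
  assumes "simple_integrand M W a b n \<tau> \<zeta>"
  shows "(\<lambda>(t, \<omega>). simple_process n \<tau> \<zeta> t \<omega>) \<in> borel_measurable (process_measure M a b)"
  unfolding simple_process_def[abs_def] case_prod_unfold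
proof (intro borel_measurable_sum)
  fix i assume "i \<in> {..<n}"
  then have "i < n" by simp
  note D = simple_integrandD[OF assms this]
  have [measurable]: "\<zeta> i \<in> borel_measurable M" using D by auto
  have [measurable]: "(\<lambda>t. indicator {\<tau> i<..\<tau> (Suc i)} t :: real) \<in> borel_measurable (interval_measure a b)"
    by (rule measurable_restrict_space1) simp
  show "(\<lambda>p. indicator {\<tau> i<..\<tau> (Suc i)} (fst p) *\<^sub>R \<zeta> i (snd p)) \<in> borel_measurable (process_measure M a b)"
    unfolding process_measure_def by measurable
qed

lemma simple_sq_int_finite:
  assumes "0 \<le> a" "simple_integrand M W a b n \<tau> \<zeta>"
  shows "sq_int M (simple_integral W n \<tau> \<zeta>) < \<infinity>"
  using simple_isometry(1)[OF assms assms(2)]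
  by (simp add: sq_int_def power2_norm_eq_inner integrable_iff_bounded)

text \<open>Both facts hold for simple integrands and pass to the limit by continuity of the inner
  product. The first says that an Ito integral is centred: each weight is independent of the
  increment following it.\<close>

lemma
  fixes X X' :: "real \<Rightarrow> 'w \<Rightarrow> 'v::euclidean_space"
  assumes a: "0 \<le> a" and I: "ito_integral M W a b X I"
  shows ito_inner_const: "expectation (\<lambda>\<omega>. I \<omega> \<bullet> c) = 0"
    and ito_isometry: "ito_integral M W a b X' I' \<Longrightarrow>
      expectation (\<lambda>\<omega>. I \<omega> \<bullet> I' \<omega>) = process_inner a b X X'"
proof -
  obtain n \<tau> \<zeta> where s: "\<And>j. simple_integrand M W a b (n j) (\<tau> j) (\<zeta> j)"
    and X_lim: "(\<lambda>j. sqnorm M a b (\<lambda>t \<omega>. X t \<omega> - simple_process (n j) (\<tau> j) (\<zeta> j) t \<omega>)) \<longlonglongrightarrow> 0"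
    and I_lim: "(\<lambda>j. sq_int M (\<lambda>\<omega>. I \<omega> - simple_integral W (n j) (\<tau> j) (\<zeta> j) \<omega>)) \<longlonglongrightarrow> 0"
    and X: "X \<in> adapted_L2 M W 0 a b" and Im: "I \<in> borel_measurable M"
    using I unfolding ito_integral_def sq_int_def by blast
  note m = simple_integral_measurable[OF a s]
  have fin: "sq_int M I < \<infinity>"
    using sq_int_finite_of_limit[OF m Im simple_sq_int_finite[OF a s] I_lim] .
  show "expectation (\<lambda>\<omega>. I \<omega> \<bullet> c) = 0" for c
  proof -
    have "(\<lambda>j. expectation (\<lambda>\<omega>. simple_integral W (n j) (\<tau> j) (\<zeta> j) \<omega> \<bullet> c)) \<longlonglongrightarrow> expectation (\<lambda>\<omega>. I \<omega> \<bullet> c)"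
      using m Im fin I_lim
      by (intro integral_inner_tendsto) (auto simp: sq_int_def emeasure_space_1)
    moreover have "expectation (\<lambda>\<omega>. simple_integral W (n j) (\<tau> j) (\<zeta> j) \<omega> \<bullet> c) = 0" for j
    proof -
      have 1: "integrable M (\<lambda>\<omega>. (\<zeta> j i \<omega> \<bullet> c) * (W (\<tau> j (Suc i)) \<omega> - W (\<tau> j i) \<omega>)) \<and>
          expectation (\<lambda>\<omega>. (\<zeta> j i \<omega> \<bullet> c) * (W (\<tau> j (Suc i)) \<omega> - W (\<tau> j i) \<omega>)) = 0" if i: "i < n j" for i
      proof -
        note D = simple_integrandD[OF s i]
        have z: "integrable M (\<lambda>\<omega>. \<zeta> j i \<omega> \<bullet> c)"
          using D by (intro integrable_inner_bounded) (auto simp: bounded_iff)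
        have zm: "(\<lambda>\<omega>. \<zeta> j i \<omega> \<bullet> c) \<in> borel_measurable (filt M W 0 (\<tau> j i))" using D by simp
        have wm: "(\<lambda>\<omega>. W (\<tau> j (Suc i)) \<omega> - W (\<tau> j i) \<omega>) \<in> borel_measurable (filt M W (\<tau> j i) (\<tau> j (Suc i)))"
          using D by (intro measurable_increment_filt) auto
        have "0 \<le> \<tau> j i" using D a by simp
        with integrable_mult_filt[OF _ _ _ zm wm z integrable_increment] expectation_mult_filt[OF _ _ _ zm wm z integrable_increment]
          expectation_increment[of "\<tau> j i" "\<tau> j (Suc i)"] D
        show ?thesis by auto
      qed
      have "simple_integral W (n j) (\<tau> j) (\<zeta> j) \<omega> \<bullet> c = (\<Sum>i<n j. (\<zeta> j i \<omega> \<bullet> c) * (W (\<tau> j (Suc i)) \<omega> - W (\<tau> j i) \<omega>))" for \<omega>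
        unfolding simple_integral_def inner_sum_left by (simp add: mult.commute)
      then show ?thesis using 1 by (simp add: Bochner_Integration.integral_sum[of "{..<n j}"])
    qed
    ultimately show ?thesis by (simp add: LIMSEQ_const_iff)
  qed
  show "expectation (\<lambda>\<omega>. I \<omega> \<bullet> I' \<omega>) = process_inner a b X X'"
    if I': "ito_integral M W a b X' I'"
  proof -
    obtain n' \<tau>' \<zeta>' where s': "\<And>j. simple_integrand M W a b (n' j) (\<tau>' j) (\<zeta>' j)"
      and X'_lim: "(\<lambda>j. sqnorm M a b (\<lambda>t \<omega>. X' t \<omega> - simple_process (n' j) (\<tau>' j) (\<zeta>' j) t \<omega>)) \<longlonglongrightarrow> 0"
      and I'_lim: "(\<lambda>j. sq_int M (\<lambda>\<omega>. I' \<omega> - simple_integral W (n' j) (\<tau>' j) (\<zeta>' j) \<omega>)) \<longlonglongrightarrow> 0"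
      and X': "X' \<in> adapted_L2 M W 0 a b" and I'm: "I' \<in> borel_measurable M"
      using I' unfolding ito_integral_def sq_int_def by blast
    note m' = simple_integral_measurable[OF a s']
    have fin': "sq_int M I' < \<infinity>"
      using sq_int_finite_of_limit[OF m' I'm simple_sq_int_finite[OF a s'] I'_lim] .
    have 1: "(\<lambda>j. expectation (\<lambda>\<omega>. simple_integral W (n j) (\<tau> j) (\<zeta> j) \<omega> \<bullet> simple_integral W (n' j) (\<tau>' j) (\<zeta>' j) \<omega>))
        \<longlonglongrightarrow> expectation (\<lambda>\<omega>. I \<omega> \<bullet> I' \<omega>)"
      by (rule integral_inner_tendsto[OF m m' Im I'm fin fin' I_lim I'_lim])
    have "(\<lambda>j. \<integral>p. (\<lambda>(t, \<omega>). simple_process (n j) (\<tau> j) (\<zeta> j) t \<omega>) p \<bullet> (\<lambda>(t, \<omega>). simple_process (n' j) (\<tau>' j) (\<zeta>' j) t \<omega>) p \<partial>process_measure M a b)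
        \<longlonglongrightarrow> (\<integral>p. (\<lambda>(t, \<omega>). X t \<omega>) p \<bullet> (\<lambda>(t, \<omega>). X' t \<omega>) p \<partial>process_measure M a b)"
      using X_lim X'_lim X X'
      by (intro integral_inner_tendsto simple_process_measurable[OF s] simple_process_measurable[OF s'])
        (auto simp: adapted_L2_def sqnorm_eq case_prod_unfold)
    then have 2: "(\<lambda>j. \<integral>(t, \<omega>). simple_process (n j) (\<tau> j) (\<zeta> j) t \<omega> \<bullet> simple_process (n' j) (\<tau>' j) (\<zeta>' j) t \<omega> \<partial>process_measure M a b)
        \<longlonglongrightarrow> process_inner a b X X'"
      by (simp add: case_prod_unfold)
    show ?thesis
      using LIMSEQ_unique[OF 1] 2 unfolding simple_isometry(2)[OF a s s'] by simp
  qed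
qed

end


section \<open>Integration over simplices\<close>

text \<open>Fubini over a non-rectangular region, isolated so that it is proved once.
  \<open>\<phi>\<close> is a measure-preserving change of variables under which \<open>D\<close>
  becomes the region over \<open>A\<close> with fibre \<open>B u\<close> above \<open>u\<close>. It
  is instantiated twice: for splitting off the first coordinate of a simplex, and for cutting a
  simplex at an inner coordinate.\<close>

locale fibred_restriction = M1: sigma_finite_measure \<mu> + M2: sigma_finite_measure \<nu>
  for \<mu> :: "'a measure" and \<nu> :: "'b measure" +
  fixes \<kappa> :: "'c measure" and \<phi> :: "'a \<times> 'b \<Rightarrow> 'c" and D A B
  assumes phi [measurable]: "\<phi> \<in> measurable (\<mu> \<Otimes>\<^sub>M \<nu>) \<kappa>"
    and distr_phi: "distr (\<mu> \<Otimes>\<^sub>M \<nu>) \<kappa> \<phi> = \<kappa>"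
    and D [measurable]: "D \<in> sets \<kappa>" and A [measurable]: "A \<in> sets \<mu>"
    and B: "\<And>u. u \<in> A \<Longrightarrow> B u \<in> sets \<nu>"
    and fibre: "\<And>u s. u \<in> space \<mu> \<Longrightarrow> s \<in> space \<nu> \<Longrightarrow> \<phi> (u, s) \<in> D \<longleftrightarrow> u \<in> A \<and> s \<in> B u"
begin

sublocale pair_sigma_finite \<mu> \<nu> ..

lemma space_A: "u \<in> A \<Longrightarrow> u \<in> space \<mu>" using sets.sets_into_space[OF A] by auto

lemma phi_section: "u \<in> A \<Longrightarrow> (\<lambda>s. \<phi> (u, s)) \<in> measurable (restrict_space \<nu> (B u)) (restrict_space \<kappa> D)"
proof (rule measurable_restrict_space3)
  assume u: "u \<in> A"
  show "(\<lambda>s. \<phi> (u, s)) \<in> measurable \<nu> \<kappa>"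
    using space_A[OF u] by measurable
  show "(\<lambda>s. \<phi> (u, s)) \<in> B u \<rightarrow> D"
    using fibre[OF space_A[OF u]] u sets.sets_into_space[OF B[OF u]] by auto
qed

lemma indicator_fibre:
  assumes "u \<in> space \<mu>" "s \<in> space \<nu>"
  shows "indicator D (\<phi> (u, s)) = (indicator A u * indicator (B u) s :: 'd::semiring_1)"
  using fibre[OF assms] by (auto simp: indicator_def)

lemma
  assumes f: "f \<in> borel_measurable (restrict_space \<kappa> D)"
  shows nn_integral_fibred: "(\<integral>\<^sup>+v. f v \<partial>restrict_space \<kappa> D) =
      (\<integral>\<^sup>+u. \<integral>\<^sup>+s. f (\<phi> (u, s)) \<partial>restrict_space \<nu> (B u) \<partial>restrict_space \<mu> A)"
    and nn_integral_fibred_measurable: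
      "(\<lambda>u. \<integral>\<^sup>+s. f (\<phi> (u, s)) \<partial>restrict_space \<nu> (B u)) \<in> borel_measurable (restrict_space \<mu> A)"
proof -
  \<comment> \<open>Extension by zero off \<open>D\<close> reduces the claim to Fubini on the full
    product; after the change of variables the indicator of \<open>D\<close> factors by
    \<open>indicator_fibre\<close>.\<close>
  define g where "g v = f v * indicator D v" for v
  have g [measurable]: "g \<in> borel_measurable \<kappa>"
    using f unfolding g_def by (subst borel_measurable_restrict_space_iff_ennreal[symmetric]) auto
  have eq: "(\<integral>\<^sup>+s. g (\<phi> (u, s)) \<partial>\<nu>) = (\<integral>\<^sup>+s. f (\<phi> (u, s)) \<partial>restrict_space \<nu> (B u)) * indicator A u" if "u \<in> space \<mu>" for u
  proof (cases "u \<in> A")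
    case True
    have "(\<integral>\<^sup>+s. g (\<phi> (u, s)) \<partial>\<nu>) = (\<integral>\<^sup>+s. f (\<phi> (u, s)) * indicator (B u) s \<partial>\<nu>)"
      using True that by (intro nn_integral_cong) (simp add: g_def indicator_fibre)
    then show ?thesis using True B[OF True] by (subst nn_integral_restrict_space) auto
  next
    case False
    have "(\<integral>\<^sup>+s. g (\<phi> (u, s)) \<partial>\<nu>) = (\<integral>\<^sup>+s. 0 \<partial>\<nu>)"
      using False that by (intro nn_integral_cong) (simp add: g_def indicator_fibre)
    then show ?thesis using False by simp
  qed
  have gm: "(\<lambda>u. \<integral>\<^sup>+s. g (\<phi> (u, s)) \<partial>\<nu>) \<in> borel_measurable \<mu>" by measurable
  then have "(\<lambda>u. (\<integral>\<^sup>+s. f (\<phi> (u, s)) \<partial>restrict_space \<nu> (B u)) * indicator A u) \<in> borel_measurable \<mu>"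
    by (rule subst[OF measurable_cong, rotated]) (auto simp: eq)
  then show "(\<lambda>u. \<integral>\<^sup>+s. f (\<phi> (u, s)) \<partial>restrict_space \<nu> (B u)) \<in> borel_measurable (restrict_space \<mu> A)"
    by (subst borel_measurable_restrict_space_iff_ennreal) auto
  have "(\<integral>\<^sup>+v. f v \<partial>restrict_space \<kappa> D) = (\<integral>\<^sup>+v. g v \<partial>distr (\<mu> \<Otimes>\<^sub>M \<nu>) \<kappa> \<phi>)"
    unfolding distr_phi g_def by (subst nn_integral_restrict_space) auto
  also have "\<dots> = (\<integral>\<^sup>+p. g (\<phi> p) \<partial>(\<mu> \<Otimes>\<^sub>M \<nu>))"
    by (rule nn_integral_distr) auto
  also have "\<dots> = (\<integral>\<^sup>+u. \<integral>\<^sup>+s. g (\<phi> (u, s)) \<partial>\<nu> \<partial>\<mu>)"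
    by (subst M2.nn_integral_fst[symmetric]) auto
  also have "\<dots> = (\<integral>\<^sup>+u. (\<integral>\<^sup>+s. f (\<phi> (u, s)) \<partial>restrict_space \<nu> (B u)) * indicator A u \<partial>\<mu>)"
    by (intro nn_integral_cong eq)
  also have "\<dots> = (\<integral>\<^sup>+u. \<integral>\<^sup>+s. f (\<phi> (u, s)) \<partial>restrict_space \<nu> (B u) \<partial>restrict_space \<mu> A)"
    by (subst nn_integral_restrict_space) auto
  finally show "(\<integral>\<^sup>+v. f v \<partial>restrict_space \<kappa> D) =
      (\<integral>\<^sup>+u. \<integral>\<^sup>+s. f (\<phi> (u, s)) \<partial>restrict_space \<nu> (B u) \<partial>restrict_space \<mu> A)" .
qed

lemma
  fixes f :: "'c \<Rightarrow> real"
  assumes f: "integrable (restrict_space \<kappa> D) f"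
  shows integral_fibred: "(\<integral>v. f v \<partial>restrict_space \<kappa> D) =
      (\<integral>u. \<integral>s. f (\<phi> (u, s)) \<partial>restrict_space \<nu> (B u) \<partial>restrict_space \<mu> A)"
    and integrable_fibred: "integrable (restrict_space \<mu> A) (\<lambda>u. \<integral>s. f (\<phi> (u, s)) \<partial>restrict_space \<nu> (B u))"
proof -
  define g where "g v = indicator D v *\<^sub>R f v" for v
  have g: "integrable \<kappa> g"
    using f unfolding g_def by (subst integrable_restrict_space[symmetric]) auto
  then have [measurable]: "g \<in> borel_measurable \<kappa>" by auto
  have gphi: "integrable (\<mu> \<Otimes>\<^sub>M \<nu>) (\<lambda>p. g (\<phi> p))"
    using g by (subst (asm) distr_phi[symmetric], subst (asm) integrable_distr_eq) auto
  have geq: "g (\<phi> (u, s)) = indicator (B u) s *\<^sub>R f (\<phi> (u, s))" if "u \<in> A" "s \<in> space \<nu>" for u s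
    using that space_A by (simp add: g_def indicator_fibre)
  have eq: "(\<integral>s. g (\<phi> (u, s)) \<partial>\<nu>) = indicator A u *\<^sub>R (\<integral>s. f (\<phi> (u, s)) \<partial>restrict_space \<nu> (B u))" if "u \<in> space \<mu>" for u
  proof (cases "u \<in> A")
    case True
    have "(\<integral>s. g (\<phi> (u, s)) \<partial>\<nu>) = (\<integral>s. indicator (B u) s *\<^sub>R f (\<phi> (u, s)) \<partial>\<nu>)"
      using True by (intro Bochner_Integration.integral_cong refl geq)
    then show ?thesis using True B[OF True] by (subst integral_restrict_space) auto
  next
    case False
    have "(\<integral>s. g (\<phi> (u, s)) \<partial>\<nu>) = (\<integral>s. 0 \<partial>\<nu>)"
      using False that by (intro Bochner_Integration.integral_cong) (auto simp: g_def indicator_fibre)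
    then show ?thesis using False by simp
  qed
  have "integrable \<mu> (\<lambda>u. \<integral>s. g (\<phi> (u, s)) \<partial>\<nu>)" by (rule integrable_fst'[OF gphi])
  then have "integrable \<mu> (\<lambda>u. indicator A u *\<^sub>R (\<integral>s. f (\<phi> (u, s)) \<partial>restrict_space \<nu> (B u)))"
    by (subst Bochner_Integration.integrable_cong[OF refl eq[symmetric]]) auto
  then show "integrable (restrict_space \<mu> A) (\<lambda>u. \<integral>s. f (\<phi> (u, s)) \<partial>restrict_space \<nu> (B u))"
    by (subst integrable_restrict_space) auto
  have "(\<integral>v. f v \<partial>restrict_space \<kappa> D) = (\<integral>v. g v \<partial>distr (\<mu> \<Otimes>\<^sub>M \<nu>) \<kappa> \<phi>)"
    unfolding distr_phi g_def by (subst integral_restrict_space) auto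
  also have "\<dots> = (\<integral>p. g (\<phi> p) \<partial>(\<mu> \<Otimes>\<^sub>M \<nu>))"
    by (rule integral_distr) auto
  also have "\<dots> = (\<integral>u. \<integral>s. g (\<phi> (u, s)) \<partial>\<nu> \<partial>\<mu>)"
    by (rule integral_fst'[OF gphi, symmetric])
  also have "\<dots> = (\<integral>u. indicator A u *\<^sub>R (\<integral>s. f (\<phi> (u, s)) \<partial>restrict_space \<nu> (B u)) \<partial>\<mu>)"
    by (intro Bochner_Integration.integral_cong refl eq)
  also have "\<dots> = (\<integral>u. \<integral>s. f (\<phi> (u, s)) \<partial>restrict_space \<nu> (B u) \<partial>restrict_space \<mu> A)"
    by (subst integral_restrict_space) auto
  finally show "(\<integral>v. f v \<partial>restrict_space \<kappa> D) =
      (\<integral>u. \<integral>s. f (\<phi> (u, s)) \<partial>restrict_space \<nu> (B u) \<partial>restrict_space \<mu> A)" .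
qed

text \<open>The set where \<open>P\<close> fails need not be measurable, so the argument integrates
  the indicator of a measurable null set \<open>N\<close> covering it.\<close>

lemma AE_fibred:
  assumes "AE v in restrict_space \<kappa> D. P v"
  shows "AE u in restrict_space \<mu> A. AE s in restrict_space \<nu> (B u). P (\<phi> (u, s))"
proof -
  obtain N where N: "{v \<in> space (restrict_space \<kappa> D). \<not> P v} \<subseteq> N" "emeasure (restrict_space \<kappa> D) N = 0" "N \<in> sets (restrict_space \<kappa> D)"
    using assms by (rule AE_E)
  have m: "(\<lambda>v. indicator N v :: ennreal) \<in> borel_measurable (restrict_space \<kappa> D)" using N(3) by simp
  have "(\<integral>\<^sup>+u. \<integral>\<^sup>+s. indicator N (\<phi> (u, s)) \<partial>restrict_space \<nu> (B u) \<partial>restrict_space \<mu> A) = 0"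
    using nn_integral_fibred[OF m] N by simp
  then have 0: "AE u in restrict_space \<mu> A. (\<integral>\<^sup>+s. indicator N (\<phi> (u, s)) \<partial>restrict_space \<nu> (B u)) = 0"
    by (subst (asm) nn_integral_0_iff_AE[OF nn_integral_fibred_measurable[OF m]])
  show ?thesis
  proof (rule AE_mp[OF 0], rule AE_I2, rule impI)
    fix u assume u: "u \<in> space (restrict_space \<mu> A)" and 0: "(\<integral>\<^sup>+s. indicator N (\<phi> (u, s)) \<partial>restrict_space \<nu> (B u)) = 0"
    have uA: "u \<in> A" using u by (auto simp: space_restrict_space)
    have 1: "AE s in restrict_space \<nu> (B u). indicator N (\<phi> (u, s)) = (0::ennreal)"
      using 0 by (subst (asm) nn_integral_0_iff_AE[OF measurable_compose[OF phi_section[OF uA] m]])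
    show "AE s in restrict_space \<nu> (B u). P (\<phi> (u, s))"
    proof (rule AE_mp[OF 1], rule AE_I2, rule impI)
      fix s assume "s \<in> space (restrict_space \<nu> (B u))" and ns: "indicator N (\<phi> (u, s)) = (0::ennreal)"
      then have "\<phi> (u, s) \<in> space (restrict_space \<kappa> D)"
        using measurable_space[OF phi_section[OF uA]] by auto
      then show "P (\<phi> (u, s))" using N(1) ns by (auto simp: indicator_def split: if_splits)
    qed
  qed
qed

end

section \<open>Two ways of fibring an ordered simplex\<close>

abbreviation lborel_pow :: "nat \<Rightarrow> (nat \<Rightarrow> real) measure" where
  "lborel_pow n \<equiv> PiM {..<n} (\<lambda>_. lborel)"

lemma ordered_simplex_sets [measurable]: "ordered_simplex n a b \<in> sets (lborel_pow n)"
proof -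
  have "ordered_simplex n a b = {t \<in> space (lborel_pow n).
      (\<forall>i\<in>{..<n}. a < t i \<and> t i < b) \<and> (\<forall>i\<in>{..<n}. \<forall>j\<in>{..<n}. i < j \<longrightarrow> t j < t i)}"
    by (fastforce simp: ordered_simplex_def space_PiM)
  also have "\<dots> \<in> sets (lborel_pow n)" by measurable
  finally show ?thesis .
qed

lemma space_simplex_measure [simp]: "space (simplex_measure n a b) = ordered_simplex n a b"
  using sets.sets_into_space[OF ordered_simplex_sets]
  by (auto simp: simplex_measure_def space_restrict_space)

lemma ordered_simplex_undefined: "x \<in> ordered_simplex n a b \<Longrightarrow> n \<le> i \<Longrightarrow> x i = undefined"
  by (auto simp: ordered_simplex_def PiE_def extensional_def)

lemma sigma_finite_PiM_lborel: "finite I \<Longrightarrow> sigma_finite_measure (PiM I (\<lambda>_. lborel :: real measure))"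
  by (rule product_sigma_finite.sigma_finite) (auto simp: product_sigma_finite_def sigma_finite_lborel)

text \<open>The first coordinate of an ordered point is the largest, so the others range over the
  simplex below it. This is the recursion of \<open>iterated_ito\<close>.\<close>

lemma fibred_cons:
  "fibred_restriction lborel (lborel_pow n) (lborel_pow (Suc n)) (\<lambda>(t, x). case_nat t x)
     (ordered_simplex (Suc n) a b) {a<..<b} (\<lambda>t. ordered_simplex n a t)"
proof -
  interpret P: product_sigma_finite "\<lambda>_::nat. lborel :: real measure"
    by standard
  interpret N: sigma_finite_measure "lborel_pow n"
    by (rule sigma_finite_PiM_lborel) simp
  let ?\<phi> = "\<lambda>(t::real, x). case_nat t x"
  have m: "?\<phi> \<in> measurable (lborel \<Otimes>\<^sub>M lborel_pow n) (lborel_pow (Suc n))"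
  proof (rule measurable_PiM_single')
    fix i assume "i \<in> {..<Suc n}"
    then show "(\<lambda>p. ?\<phi> p i) \<in> measurable (lborel \<Otimes>\<^sub>M lborel_pow n) lborel"
      by (cases i) (auto simp: case_prod_unfold)
  next
    show "?\<phi> \<in> space (lborel \<Otimes>\<^sub>M lborel_pow n) \<rightarrow> (\<Pi>\<^sub>E i\<in>{..<Suc n}. space lborel)"
      by (auto simp: space_pair_measure space_PiM PiE_def extensional_def split: nat.split)
  qed
  show ?thesis
  proof (unfold_locales, goal_cases)
    case 1
    show ?case by (rule m)
  next
    \<comment> \<open>Measure preservation is tested on boxes, where both sides are the product of
      the side measures.\<close>
    case 2
    show ?case
    proof (rule P.PiM_eqI)
      fix A :: "nat \<Rightarrow> real set" assume A: "\<And>i. i \<in> {..<Suc n} \<Longrightarrow> A i \<in> sets lborel"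
      have pre: "?\<phi> -` Pi\<^sub>E {..<Suc n} A \<inter> space (lborel \<Otimes>\<^sub>M lborel_pow n) = A 0 \<times> Pi\<^sub>E {..<n} (\<lambda>i. A (Suc i))"
      proof -
        have "case_nat t x \<in> Pi\<^sub>E {..<Suc n} A \<longleftrightarrow> t \<in> A 0 \<and> x \<in> Pi\<^sub>E {..<n} (\<lambda>i. A (Suc i))" for t x
          unfolding PiE_iff extensional_def lessThan_Suc_eq_insert_0 by (auto split: nat.split)
        then show ?thesis by (auto simp: space_pair_measure space_PiM PiE_iff)
      qed
      have "emeasure (distr (lborel \<Otimes>\<^sub>M lborel_pow n) (lborel_pow (Suc n)) ?\<phi>) (Pi\<^sub>E {..<Suc n} A)
          = emeasure (lborel \<Otimes>\<^sub>M lborel_pow n) (A 0 \<times> Pi\<^sub>E {..<n} (\<lambda>i. A (Suc i)))"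
        using A by (subst emeasure_distr[OF m]) (auto simp: pre intro!: sets_PiM_I_finite)
      also have "\<dots> = emeasure lborel (A 0) * (\<Prod>i<n. emeasure lborel (A (Suc i)))"
        using A P.emeasure_PiM[of "{..<n}" "\<lambda>i. A (Suc i)"]
        by (subst N.emeasure_pair_measure_Times) (auto intro!: sets_PiM_I_finite)
      also have "\<dots> = (\<Prod>i<Suc n. emeasure lborel (A i))" by (simp only: prod.lessThan_Suc_shift)
      finally show "emeasure (distr (lborel \<Otimes>\<^sub>M lborel_pow n) (lborel_pow (Suc n)) ?\<phi>) (Pi\<^sub>E {..<Suc n} A)
        = (\<Prod>i<Suc n. emeasure lborel (A i))" .
    qed auto
  next
    \<comment> \<open>The description of the fibres; the remaining goals are measurability of the
      sets involved and are closed at the end.\<close>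
    case (6 t x)
    have x: "x \<in> {..<n} \<rightarrow>\<^sub>E UNIV" using 6(2) by (simp add: space_PiM)
    then have ext: "case_nat t x \<in> {..<Suc n} \<rightarrow>\<^sub>E UNIV"
      by (auto simp: PiE_iff extensional_def split: nat.split)
    show ?case
    proof (intro iffI)
      assume "?\<phi> (t, x) \<in> ordered_simplex (Suc n) a b"
      then have 1: "\<And>i. i < Suc n \<Longrightarrow> a < case_nat t x i \<and> case_nat t x i < b"
        and 2: "\<And>i j. i < j \<Longrightarrow> j < Suc n \<Longrightarrow> case_nat t x j < case_nat t x i"
        by (auto simp: ordered_simplex_def)
      show "t \<in> {a<..<b} \<and> x \<in> ordered_simplex n a t"
        using x 1[of 0] 1[of "Suc i" for i] 2[of 0 "Suc j" for j] 2[of "Suc i" "Suc j" for i j]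
        by (auto simp: ordered_simplex_def)
    next
      assume *: "t \<in> {a<..<b} \<and> x \<in> ordered_simplex n a t"
      then have 1: "\<And>i. i < n \<Longrightarrow> a < x i \<and> x i < t"
        and 2: "\<And>i j. i < j \<Longrightarrow> j < n \<Longrightarrow> x j < x i"
        by (auto simp: ordered_simplex_def)
      show "?\<phi> (t, x) \<in> ordered_simplex (Suc n) a b"
        unfolding ordered_simplex_def using * ext
        by (auto simp: less_Suc_eq_0_disj dest: 1 2 intro: less_trans split: nat.split)
    qed
  qed auto
qed

text \<open>The concatenation of \<open>s\<close> and \<open>u\<close>, written exactly like the
  argument of the coefficient in \<open>back_star_prod\<close> so that it can be folded there. Its
  coordinate \<open>j\<close> is \<open>u 0\<close>, the variable shared by the two factors of a
  product.\<close>

definition simplex_join :: "nat \<Rightarrow> (nat \<Rightarrow> real) \<Rightarrow> (nat \<Rightarrow> real) \<Rightarrow> nat \<Rightarrow> real" where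
  "simplex_join j s u = (\<lambda>i. if i < j then s i else u (i - j))"

text \<open>In an ordered point the first \<open>j\<close> coordinates see the remaining ones only
  through the largest of these, \<open>u 0\<close>. Hence the fibre depends on \<open>u\<close>
  through \<open>u 0\<close> alone, and \<open>m\<close> must be positive for \<open>u 0\<close> to
  be a coordinate.\<close>

lemma fibred_join:
  assumes "0 < m"
  shows "fibred_restriction (lborel_pow m) (lborel_pow j) (lborel_pow (j + m)) (\<lambda>(u, s). simplex_join j s u)
     (ordered_simplex (j + m) a b) (ordered_simplex m a b) (\<lambda>u. ordered_simplex j (u 0) b)"
proof -
  interpret P: product_sigma_finite "\<lambda>_::nat. lborel :: real measure"
    by standard
  interpret N: sigma_finite_measure "lborel_pow j"
    by (rule sigma_finite_PiM_lborel) simp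
  interpret L: sigma_finite_measure "lborel_pow m"
    by (rule sigma_finite_PiM_lborel) simp
  let ?\<phi> = "\<lambda>(u, s). simplex_join j s u"
  let ?P = "lborel_pow m \<Otimes>\<^sub>M lborel_pow j"
  have m: "?\<phi> \<in> measurable ?P (lborel_pow (j + m))"
  proof (rule measurable_PiM_single')
    fix i assume "i \<in> {..<j + m}"
    then show "(\<lambda>p. ?\<phi> p i) \<in> measurable ?P lborel"
      by (cases "i < j") (auto simp: case_prod_unfold simplex_join_def intro!: measurable_compose[OF measurable_fst] measurable_compose[OF measurable_snd] measurable_component_singleton)
  next
    show "?\<phi> \<in> space ?P \<rightarrow> (\<Pi>\<^sub>E i\<in>{..<j + m}. space lborel)"
      by (auto simp: space_pair_measure space_PiM PiE_def extensional_def simplex_join_def)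
  qed
  show ?thesis
  proof (unfold_locales, goal_cases)
    case 1
    show ?case by (rule m)
  next
    case 2
    show ?case
    proof (rule P.PiM_eqI)
      fix A :: "nat \<Rightarrow> real set" assume A: "\<And>i. i \<in> {..<j + m} \<Longrightarrow> A i \<in> sets lborel"
      have pre: "?\<phi> -` Pi\<^sub>E {..<j + m} A \<inter> space ?P = Pi\<^sub>E {..<m} (\<lambda>i. A (j + i)) \<times> Pi\<^sub>E {..<j} A"
      proof -
        have "simplex_join j s u \<in> Pi\<^sub>E {..<j + m} A \<longleftrightarrow> u \<in> Pi\<^sub>E {..<m} (\<lambda>i. A (j + i)) \<and> s \<in> Pi\<^sub>E {..<j} A"
          if u: "u \<in> {..<m} \<rightarrow>\<^sub>E UNIV" and s: "s \<in> {..<j} \<rightarrow>\<^sub>E UNIV" for u s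
        proof
          assume *: "simplex_join j s u \<in> Pi\<^sub>E {..<j + m} A"
          have "u i \<in> A (j + i)" if "i < m" for i
            using PiE_mem[OF *, of "j + i"] that by (simp add: simplex_join_def)
          moreover have "s i \<in> A i" if "i < j" for i
            using PiE_mem[OF *, of i] that by (simp add: simplex_join_def)
          ultimately show "u \<in> Pi\<^sub>E {..<m} (\<lambda>i. A (j + i)) \<and> s \<in> Pi\<^sub>E {..<j} A"
            using u s by (auto simp: PiE_iff)
        next
          assume *: "u \<in> Pi\<^sub>E {..<m} (\<lambda>i. A (j + i)) \<and> s \<in> Pi\<^sub>E {..<j} A"
          have "simplex_join j s u i \<in> A i" if "i < j + m" for i
            using * PiE_mem[of u "{..<m}" "\<lambda>i. A (j + i)" "i - j"] PiE_mem[of s "{..<j}" A i] that by (auto simp: simplex_join_def)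
          then show "simplex_join j s u \<in> Pi\<^sub>E {..<j + m} A"
            using u by (auto simp: PiE_iff extensional_def simplex_join_def)
        qed
        then show ?thesis by (auto simp: space_pair_measure space_PiM PiE_iff)
      qed
      have "emeasure (distr ?P (lborel_pow (j + m)) ?\<phi>) (Pi\<^sub>E {..<j + m} A)
          = emeasure ?P (Pi\<^sub>E {..<m} (\<lambda>i. A (j + i)) \<times> Pi\<^sub>E {..<j} A)"
        using A by (subst emeasure_distr[OF m]) (auto simp: pre intro!: sets_PiM_I_finite)
      also have "\<dots> = (\<Prod>i<m. emeasure lborel (A (j + i))) * (\<Prod>i<j. emeasure lborel (A i))"
        using A P.emeasure_PiM[of "{..<m}" "\<lambda>i. A (j + i)"] P.emeasure_PiM[of "{..<j}" A]
        by (subst N.emeasure_pair_measure_Times) (auto intro!: sets_PiM_I_finite)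
      also have "\<dots> = (\<Prod>i<j + m. emeasure lborel (A i))"
        by (induction m) (simp_all add: mult.commute mult.left_commute)
      finally show "emeasure (distr ?P (lborel_pow (j + m)) ?\<phi>) (Pi\<^sub>E {..<j + m} A)
        = (\<Prod>i<j + m. emeasure lborel (A i))" .
    qed auto
  next
    case (6 u s)
    have u: "u \<in> {..<m} \<rightarrow>\<^sub>E UNIV" and s: "s \<in> {..<j} \<rightarrow>\<^sub>E UNIV" using 6 by (simp_all add: space_PiM)
    then have ext: "simplex_join j s u \<in> {..<j + m} \<rightarrow>\<^sub>E UNIV"
      by (auto simp: PiE_iff extensional_def simplex_join_def)
    show ?case
    proof (intro iffI)
      assume "?\<phi> (u, s) \<in> ordered_simplex (j + m) a b"
      then have 1: "\<And>i. i < j + m \<Longrightarrow> a < simplex_join j s u i \<and> simplex_join j s u i < b"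
        and 2: "\<And>p q. p < q \<Longrightarrow> q < j + m \<Longrightarrow> simplex_join j s u q < simplex_join j s u p"
        by (auto simp: ordered_simplex_def)
      have "u \<in> ordered_simplex m a b"
        unfolding ordered_simplex_def using u 1[of "j + i" for i] 2[of "j + p" "j + q" for p q]
        by (auto simp: simplex_join_def)
      moreover have "s i < b" if "i < j" for i using 1[of i] that by (simp add: simplex_join_def)
      moreover have "u 0 < s i" if "i < j" for i using 2[of i j] that assms by (simp add: simplex_join_def)
      moreover have "s q < s p" if "p < q" "q < j" for p q using 2[of p q] that by (simp add: simplex_join_def)
      ultimately show "u \<in> ordered_simplex m a b \<and> s \<in> ordered_simplex j (u 0) b"
        using s by (auto simp: ordered_simplex_def)
    next
      assume *: "u \<in> ordered_simplex m a b \<and> s \<in> ordered_simplex j (u 0) b"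
      then have 1: "\<And>i. i < m \<Longrightarrow> a < u i \<and> u i < b"
        and 2: "\<And>p q. p < q \<Longrightarrow> q < m \<Longrightarrow> u q < u p"
        and 3: "\<And>i. i < j \<Longrightarrow> u 0 < s i \<and> s i < b"
        and 4: "\<And>p q. p < q \<Longrightarrow> q < j \<Longrightarrow> s q < s p"
        by (auto simp: ordered_simplex_def)
      \<comment> \<open>Reduces every comparison of a coordinate of \<open>s\<close> with one of
        \<open>u\<close> to the bound \<open>u 0 < s i\<close>.\<close>
      have 5: "u i \<le> u 0" if "i < m" for i using 2[of 0 i] that by (cases "i = 0") auto
      have "a < simplex_join j s u i \<and> simplex_join j s u i < b" if "i < j + m" for i
      proof (cases "i < j")
        case True
        then show ?thesis using 3[OF True] 1[of 0] assms by (simp add: simplex_join_def)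
      next
        case False
        then have "i - j < m" using that by arith
        then show ?thesis using False 1[of "i - j"] by (simp add: simplex_join_def)
      qed
      moreover have "simplex_join j s u q < simplex_join j s u p" if "p < q" "q < j + m" for p q
      proof (cases "p < j")
        case True
        show ?thesis
        proof (cases "q < j")
          case True
          then show ?thesis using 4[of p q] that by (simp add: simplex_join_def)
        next
          case False
          then have "q - j < m" using that by arith
          then show ?thesis using False 3[OF \<open>p < j\<close>] 5[of "q - j"] \<open>p < j\<close> by (simp add: simplex_join_def)
        qed
      next
        case False
        then have "p - j < q - j" "q - j < m" using that by arith+
        then show ?thesis using False 2[of "p - j" "q - j"] that by (simp add: simplex_join_def)
      qed
      ultimately show "?\<phi> (u, s) \<in> ordered_simplex (j + m) a b"
        using ext by (auto simp: ordered_simplex_def)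
    qed
  qed auto
qed


section \<open>Parseval's identity for chaos expansions\<close>

lemma simplex_measure_0: "simplex_measure 0 a b = count_space {\<lambda>_. undefined}"
proof -
  have "ordered_simplex 0 a b = {\<lambda>_. undefined}"
    by (auto simp: ordered_simplex_def)
  then show ?thesis
    by (simp add: simplex_measure_def PiM_empty restrict_count_space)
qed

lemma integral_simplex_0: "(\<integral>x. f x \<partial>simplex_measure 0 a b) = (f (\<lambda>_. undefined) :: real)"
  by (simp add: simplex_measure_0 lebesgue_integral_count_space_finite)

lemma L2_simplex_sq_int: "f \<in> L2_simplex n a b \<longleftrightarrow> f \<in> borel_measurable (simplex_measure n a b) \<and> sq_int (simplex_measure n a b) f < \<infinity>"
  by (simp add: L2_simplex_def sq_int_def)

lemmas nn_integral_simplex_cons =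
    fibred_restriction.nn_integral_fibred[OF fibred_cons, folded simplex_measure_def, unfolded prod.case]
  and nn_integral_simplex_cons_measurable =
    fibred_restriction.nn_integral_fibred_measurable[OF fibred_cons, folded simplex_measure_def, unfolded prod.case]
  and integral_simplex_cons =
    fibred_restriction.integral_fibred[OF fibred_cons, folded simplex_measure_def, unfolded prod.case]
  and integrable_simplex_cons =
    fibred_restriction.integrable_fibred[OF fibred_cons, folded simplex_measure_def, unfolded prod.case]
  and AE_simplex_cons =
    fibred_restriction.AE_fibred[OF fibred_cons, folded simplex_measure_def, unfolded prod.case]

lemma simplex_cons_section:
  assumes "t \<in> {a<..<b}" "f \<in> borel_measurable (simplex_measure (Suc n) a b)"
  shows "(\<lambda>x. f (case_nat t x)) \<in> borel_measurable (simplex_measure n a t)"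
  by (rule measurable_compose[OF fibred_restriction.phi_section[OF fibred_cons, folded simplex_measure_def, unfolded prod.case, OF assms(1)] assms(2)])

text \<open>Bounds on kernel sections hold for almost every \<open>t\<close> in the interval but are
  used at \<open>t = u 0\<close> for almost every \<open>u\<close> in a simplex; a null set of first
  coordinates lifts to a null set of points.\<close>

lemma AE_simplex_head:
  assumes "AE t in interval_measure a b. P t"
  shows "AE v in simplex_measure (Suc n) a b. P (v 0)"
proof -
  obtain N where N: "{t \<in> space (interval_measure a b). \<not> P t} \<subseteq> N"
      "emeasure (interval_measure a b) N = 0" "N \<in> sets (interval_measure a b)"
    using assms by (rule AE_E)
  then have Nb: "N \<in> sets borel" and Nab: "N \<subseteq> {a<..<b}" by (auto simp: sets_restrict_space)
  have m0: "(\<lambda>v. v 0) \<in> borel_measurable (simplex_measure (Suc n) a b)"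
    unfolding simplex_measure_def by (intro measurable_restrict_space1) simp
  have m: "(\<lambda>v. indicator N (v 0) :: ennreal) \<in> borel_measurable (simplex_measure (Suc n) a b)"
    using Nb by (intro measurable_compose[OF m0]) simp
  have "(\<integral>\<^sup>+v. indicator N (v 0) \<partial>simplex_measure (Suc n) a b) =
      (\<integral>\<^sup>+t. \<integral>\<^sup>+x. indicator N t \<partial>simplex_measure n a t \<partial>interval_measure a b)"
    using nn_integral_simplex_cons[OF m] by simp
  also have "\<dots> = (\<integral>\<^sup>+t. 0 \<partial>interval_measure a b)"
  proof (rule nn_integral_cong_AE)
    have "AE t in interval_measure a b. t \<notin> N"
      using N by (intro AE_not_in) (auto simp: null_sets_def)
    then show "AE t in interval_measure a b. (\<integral>\<^sup>+x. indicator N t \<partial>simplex_measure n a t) = 0"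
      by eventually_elim (simp add: indicator_def)
  qed
  finally have "(\<integral>\<^sup>+v. indicator N (v 0) \<partial>simplex_measure (Suc n) a b) = 0" by simp
  then have 1: "AE v in simplex_measure (Suc n) a b. indicator N (v 0) = (0::ennreal)"
    by (subst (asm) nn_integral_0_iff_AE[OF m])
  show ?thesis
  proof (rule AE_mp[OF 1], rule AE_I2, rule impI)
    fix v assume "v \<in> space (simplex_measure (Suc n) a b)" "indicator N (v 0) = (0::ennreal)"
    then show "P (v 0)" using N(1) by (auto simp: ordered_simplex_def indicator_def space_restrict_space split: if_splits)
  qed
qed

lemma L2_simplex_section:
  assumes "f \<in> L2_simplex (Suc n) a b"
  shows "AE t in interval_measure a b. (\<lambda>x. f (case_nat t x)) \<in> L2_simplex n a t"
proof -
  have f: "f \<in> borel_measurable (simplex_measure (Suc n) a b)"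
    and fin: "(\<integral>\<^sup>+v. ennreal ((norm (f v))\<^sup>2) \<partial>simplex_measure (Suc n) a b) < \<infinity>"
    using assms by (auto simp: L2_simplex_def)
  have m: "(\<lambda>v. ennreal ((norm (f v))\<^sup>2)) \<in> borel_measurable (simplex_measure (Suc n) a b)" using f by simp
  have "AE t in interval_measure a b. (\<integral>\<^sup>+x. ennreal ((norm (f (case_nat t x)))\<^sup>2) \<partial>simplex_measure n a t) \<noteq> \<infinity>"
    using nn_integral_PInf_AE[OF nn_integral_simplex_cons_measurable[OF m]] fin nn_integral_simplex_cons[OF m] by auto
  then show ?thesis
  proof (rule AE_mp, intro AE_I2 impI)
    fix t assume t: "t \<in> space (interval_measure a b)"
      "(\<integral>\<^sup>+x. ennreal ((norm (f (case_nat t x)))\<^sup>2) \<partial>simplex_measure n a t) \<noteq> \<infinity>"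
    then show "(\<lambda>x. f (case_nat t x)) \<in> L2_simplex n a t"
      using simplex_cons_section[OF _ f, of t]
      by (simp add: L2_simplex_def space_restrict_space less_top)
  qed
qed

lemma integrable_inner_L2_simplex:
  assumes "f \<in> L2_simplex n a b" "g \<in> L2_simplex n a b"
  shows "integrable (simplex_measure n a b) (\<lambda>x. f x \<bullet> g x)"
  using assms by (intro integrable_inner_sq_int) (auto simp: L2_simplex_sq_int)

text \<open>The case distinction on the orders is carried inside \<open>r\<close>, so that
  orthogonality of different orders and the isometry within one order can be proved
  together.\<close>

lemma
  fixes f g :: "(nat \<Rightarrow> real) \<Rightarrow> 'v::euclidean_space"
  assumes "f \<in> L2_simplex (Suc n) a b" "g \<in> L2_simplex (Suc m) a b"
  defines "r \<equiv> \<lambda>t. if n = m then \<integral>x. f (case_nat t x) \<bullet> g (case_nat t x) \<partial>simplex_measure n a t else 0"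
  shows simplex_inner_measurable: "r \<in> borel_measurable (interval_measure a b)"
    and integral_simplex_inner:
      "(\<integral>t. r t \<partial>interval_measure a b) = (if n = m then \<integral>x. f x \<bullet> g x \<partial>simplex_measure (Suc n) a b else 0)"
proof -
  have fg: "integrable (simplex_measure (Suc n) a b) (\<lambda>x. f x \<bullet> g x)" if "n = m"
    using assms(1,2) that by (intro integrable_inner_L2_simplex) auto
  show "r \<in> borel_measurable (interval_measure a b)"
    using borel_measurable_integrable[OF integrable_simplex_cons[OF fg]] unfolding r_def by (cases "n = m") simp_all
  show "(\<integral>t. r t \<partial>interval_measure a b) = (if n = m then \<integral>x. f x \<bullet> g x \<partial>simplex_measure (Suc n) a b else 0)"
    using integral_simplex_cons[OF fg] unfolding r_def by (cases "n = m") simp_all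
qed

lemma AE_interval_iff: "(AE t in lborel. t \<in> {a<..<b::real} \<longrightarrow> P t) \<longleftrightarrow> (AE t in interval_measure a b. P t)"
  by (subst AE_restrict_space_iff) auto

context brownian begin

lemma process_pair: "pair_sigma_finite (interval_measure a b) M"
  by (simp add: pair_sigma_finite_def sigma_finite_interval sigma_finite_measure_axioms)

lemma process_integral:
  fixes \<xi> \<eta> :: "real \<Rightarrow> 'w \<Rightarrow> 'v::euclidean_space"
  assumes "case_prod \<xi> \<in> borel_measurable (process_measure M a b)" "sqnorm M a b \<xi> < \<infinity>"
    "case_prod \<eta> \<in> borel_measurable (process_measure M a b)" "sqnorm M a b \<eta> < \<infinity>"
  shows "integrable (process_measure M a b) (\<lambda>(t, \<omega>). \<xi> t \<omega> \<bullet> \<eta> t \<omega>)"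
    and "process_inner a b \<xi> \<eta> =
      (\<integral>t. expectation (\<lambda>\<omega>. \<xi> t \<omega> \<bullet> \<eta> t \<omega>) \<partial>interval_measure a b)"
    and "integrable (interval_measure a b) (\<lambda>t. expectation (\<lambda>\<omega>. \<xi> t \<omega> \<bullet> \<eta> t \<omega>))"
proof -
  interpret pair_sigma_finite "interval_measure a b" M by (rule process_pair)
  have "integrable (process_measure M a b) (\<lambda>p. (\<lambda>(t, \<omega>). \<xi> t \<omega>) p \<bullet> (\<lambda>(t, \<omega>). \<eta> t \<omega>) p)"
    using assms by (intro integrable_inner_sq_int) (auto simp: sqnorm_eq)
  then show i: "integrable (process_measure M a b) (\<lambda>(t, \<omega>). \<xi> t \<omega> \<bullet> \<eta> t \<omega>)"
    by (simp add: case_prod_unfold)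
  show "process_inner a b \<xi> \<eta> =
      (\<integral>t. expectation (\<lambda>\<omega>. \<xi> t \<omega> \<bullet> \<eta> t \<omega>) \<partial>interval_measure a b)"
    using integral_fst[OF i[unfolded process_measure_def]] by (simp add: process_measure_def)
  show "integrable (interval_measure a b) (\<lambda>t. expectation (\<lambda>\<omega>. \<xi> t \<omega> \<bullet> \<eta> t \<omega>))"
    using integrable_fst[OF i[unfolded process_measure_def]] .
qed

lemma adapted_L2D:
  assumes "\<xi> \<in> adapted_L2 M W r a b" "0 \<le> r"
  shows "case_prod \<xi> \<in> borel_measurable (process_measure M a b)" "sqnorm M a b \<xi> < \<infinity>"
    "\<And>t. t \<in> {a<..<b} \<Longrightarrow> \<xi> t \<in> borel_measurable (filt M W r t)"
    "\<And>t. t \<in> {a<..<b} \<Longrightarrow> \<xi> t \<in> borel_measurable M"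
proof -
  show "case_prod \<xi> \<in> borel_measurable (process_measure M a b)" "sqnorm M a b \<xi> < \<infinity>"
    using assms by (auto simp: adapted_L2_def)
  show m: "\<xi> t \<in> borel_measurable (filt M W r t)" if "t \<in> {a<..<b}" for t
    using assms that by (auto simp: adapted_L2_def)
  show "\<xi> t \<in> borel_measurable M" if "t \<in> {a<..<b}" for t
    by (rule filt_measurable[OF assms(2) m[OF that]])
qed

text \<open>Induction strips one outer integral from each side by the Ito isometry. If one side runs
  out first, a constant meets a centred integral and the result is 0. Measurability of
  \<open>I\<close> and \<open>I'\<close> is a separate assumption because at order 0
  \<open>iterated_ito\<close> only prescribes values almost everywhere.\<close>

lemma iterated_ito_inner:
  fixes f g :: "(nat \<Rightarrow> real) \<Rightarrow> 'v::euclidean_space"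
  assumes "0 \<le> a" "f \<in> L2_simplex n a b" "g \<in> L2_simplex m a b"
    and "iterated_ito M W a n b f I" "iterated_ito M W a m b g I'"
    and "I \<in> borel_measurable M" "I' \<in> borel_measurable M"
  shows "expectation (\<lambda>\<omega>. I \<omega> \<bullet> I' \<omega>) = (if n = m then \<integral>x. f x \<bullet> g x \<partial>simplex_measure n a b else 0)"
  using assms
proof (induction n arbitrary: m b f g I I')
  case 0
  have I: "expectation (\<lambda>\<omega>. I \<omega> \<bullet> I' \<omega>) = expectation (\<lambda>\<omega>. I' \<omega> \<bullet> f (\<lambda>_. undefined))"
    using 0 by (intro integral_cong_AE) (auto simp: inner_commute)
  show ?case
  proof (cases m)
    case 0
    have "expectation (\<lambda>\<omega>. I' \<omega> \<bullet> f (\<lambda>_. undefined)) = expectation (\<lambda>\<omega>. g (\<lambda>_. undefined) \<bullet> f (\<lambda>_. undefined))"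
      using \<open>iterated_ito M W a m b g I'\<close> \<open>I' \<in> borel_measurable M\<close> 0 by (intro integral_cong_AE) auto
    then show ?thesis using 0 I by (simp add: integral_simplex_0 prob_space inner_commute)
  next
    case (Suc m')
    then obtain X where "ito_integral M W a b X I'" using \<open>iterated_ito M W a m b g I'\<close> by auto
    then show ?thesis using I ito_inner_const[OF \<open>0 \<le> a\<close>] Suc by simp
  qed
next
  case (Suc n)
  obtain X where X: "AE t in interval_measure a b. iterated_ito M W a n t (\<lambda>x. f (case_nat t x)) (X t)"
    and iX: "ito_integral M W a b X I"
    using Suc.prems(4) by (auto simp: AE_interval_iff[symmetric])
  show ?case
  proof (cases m)
    case 0
    have "expectation (\<lambda>\<omega>. I \<omega> \<bullet> I' \<omega>) = expectation (\<lambda>\<omega>. I \<omega> \<bullet> g (\<lambda>_. undefined))"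
      using Suc.prems 0 by (intro integral_cong_AE) auto
    then show ?thesis using ito_inner_const[OF \<open>0 \<le> a\<close> iX] 0 by simp
  next
    case m: (Suc m')
    obtain X' where X': "AE t in interval_measure a b. iterated_ito M W a m' t (\<lambda>x. g (case_nat t x)) (X' t)"
      and iX': "ito_integral M W a b X' I'"
      using Suc.prems(5) m by (auto simp: AE_interval_iff[symmetric])
    have a: "X \<in> adapted_L2 M W 0 a b" "X' \<in> adapted_L2 M W 0 a b"
      using iX iX' by (auto simp: ito_integral_def)
    note D = adapted_L2D[OF a(1) order_refl] and D' = adapted_L2D[OF a(2) order_refl]
    note P = process_integral[OF D(1,2) D'(1,2)]
    let ?r = "\<lambda>t. if n = m' then \<integral>x. f (case_nat t x) \<bullet> g (case_nat t x) \<partial>simplex_measure n a t else 0"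
    note g = Suc.prems(3)[unfolded m]
    have "expectation (\<lambda>\<omega>. I \<omega> \<bullet> I' \<omega>) = (\<integral>t. expectation (\<lambda>\<omega>. X t \<omega> \<bullet> X' t \<omega>) \<partial>interval_measure a b)"
      using ito_isometry[OF \<open>0 \<le> a\<close> iX iX'] P(2) by simp
    also have "\<dots> = (\<integral>t. ?r t \<partial>interval_measure a b)"
    proof (rule integral_cong_AE)
      show "AE t in interval_measure a b. expectation (\<lambda>\<omega>. X t \<omega> \<bullet> X' t \<omega>) = ?r t"
        using X X' L2_simplex_section[OF Suc.prems(2)] L2_simplex_section[OF g] AE_space
      proof eventually_elim
        case (elim t)
        have "t \<in> {a<..<b}" using elim(5) by (simp add: space_restrict_space)
        then show ?case using elim D(4) D'(4) by (intro Suc.IH \<open>0 \<le> a\<close>) auto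
      qed
    qed (use P(3) simplex_inner_measurable[OF Suc.prems(2) g] in auto)
    finally show ?thesis unfolding integral_simplex_inner[OF Suc.prems(2) g] m by simp
  qed
qed

lemma L2_FD:
  assumes "\<xi> \<in> L2_F M W S T" "0 \<le> S"
  shows "case_prod \<xi> \<in> borel_measurable (process_measure M S T)" "sqnorm M S T \<xi> < \<infinity>"
    "\<And>t. t \<in> {S<..<T} \<Longrightarrow> \<xi> t \<in> borel_measurable (filt M W S t)"
    "\<And>t. t \<in> {S<..<T} \<Longrightarrow> \<xi> t \<in> borel_measurable M"
  using adapted_L2D[of \<xi> S S T] assms by (auto simp: L2_F_def)

lemma chaos_component_inner:
  fixes F G :: "nat \<Rightarrow> (nat \<Rightarrow> real) \<Rightarrow> 'v::euclidean_space"
  assumes S: "0 \<le> S"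
    and Z: "Z \<in> L2_F M W S T" "AE t in interval_measure S T. iterated_ito M W S n t (\<lambda>x. F n (case_nat t x)) (Z t)"
    and Z': "Z' \<in> L2_F M W S T" "AE t in interval_measure S T. iterated_ito M W S m t (\<lambda>x. G m (case_nat t x)) (Z' t)"
    and F: "F n \<in> L2_simplex (Suc n) S T" and G: "G m \<in> L2_simplex (Suc m) S T"
  shows "process_inner S T Z Z' =
      (if n = m then \<integral>x. F n x \<bullet> G n x \<partial>simplex_measure (Suc n) S T else 0)"
proof -
  note D = L2_FD[OF Z(1) S] and D' = L2_FD[OF Z'(1) S]
  note P = process_integral[OF D(1,2) D'(1,2)]
  let ?r = "\<lambda>t. if n = m then \<integral>x. F n (case_nat t x) \<bullet> G m (case_nat t x) \<partial>simplex_measure n S t else 0"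
  have "process_inner S T Z Z' = (\<integral>t. ?r t \<partial>interval_measure S T)"
    unfolding P(2)
  proof (rule integral_cong_AE)
    show "AE t in interval_measure S T. expectation (\<lambda>\<omega>. Z t \<omega> \<bullet> Z' t \<omega>) = ?r t"
      using Z(2) Z'(2) L2_simplex_section[OF F] L2_simplex_section[OF G] AE_space
    proof eventually_elim
      case (elim t)
      have "t \<in> {S<..<T}" using elim(5) by (simp add: space_restrict_space)
      then show ?case using elim D(4) D'(4) by (intro iterated_ito_inner S) auto
    qed
  qed (use P(3) simplex_inner_measurable[OF F G] in auto)
  then show ?thesis unfolding integral_simplex_inner[OF F G] by simp
qed

text \<open>The inner product of the partial sums converges to that of the processes, and by
  orthogonality of different orders its double sum collapses to the diagonal.\<close>

lemma chaos_parseval: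
  fixes \<xi> \<eta> :: "real \<Rightarrow> 'w \<Rightarrow> 'v::euclidean_space"
  assumes S: "0 \<le> S" and "chaos M W S T \<xi> F" "chaos M W S T \<eta> G"
  shows "(\<lambda>n. \<integral>x. F n x \<bullet> G n x \<partial>simplex_measure (Suc n) S T) sums
     process_inner S T \<xi> \<eta>"
proof -
  obtain Z where Z: "\<And>n. Z n \<in> L2_F M W S T"
      "\<And>n. AE t in interval_measure S T. iterated_ito M W S n t (\<lambda>x. F n (case_nat t x)) (Z n t)"
    and Zlim: "(\<lambda>N. sqnorm M S T (\<lambda>t \<omega>. \<xi> t \<omega> - (\<Sum>n<N. Z n t \<omega>))) \<longlonglongrightarrow> 0"
    using assms(2) unfolding chaos_def AE_interval_iff by blast
  obtain Z' where Z': "\<And>n. Z' n \<in> L2_F M W S T"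
      "\<And>n. AE t in interval_measure S T. iterated_ito M W S n t (\<lambda>x. G n (case_nat t x)) (Z' n t)"
    and Z'lim: "(\<lambda>N. sqnorm M S T (\<lambda>t \<omega>. \<eta> t \<omega> - (\<Sum>n<N. Z' n t \<omega>))) \<longlonglongrightarrow> 0"
    using assms(3) unfolding chaos_def AE_interval_iff by blast
  have FG: "F n \<in> L2_simplex (Suc n) S T" "G n \<in> L2_simplex (Suc n) S T" for n
    using assms by (auto simp: chaos_def)
  have \<xi>\<eta>: "\<xi> \<in> L2_F M W S T" "\<eta> \<in> L2_F M W S T" using assms by (auto simp: chaos_def)
  let ?P = "process_measure M S T"
  define U where "U N p = (\<Sum>n<N. (\<lambda>(t, \<omega>). Z n t \<omega>) p)" for N p
  define V where "V N p = (\<Sum>n<N. (\<lambda>(t, \<omega>). Z' n t \<omega>) p)" for N p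
  note D = L2_FD[OF Z(1) S] and D' = L2_FD[OF Z'(1) S] and Dx = L2_FD[OF \<xi>\<eta>(1) S] and De = L2_FD[OF \<xi>\<eta>(2) S]
  have "(\<lambda>N. \<integral>p. U N p \<bullet> V N p \<partial>?P) \<longlonglongrightarrow> (\<integral>p. (\<lambda>(t, \<omega>). \<xi> t \<omega>) p \<bullet> (\<lambda>(t, \<omega>). \<eta> t \<omega>) p \<partial>?P)"
  proof (rule integral_inner_tendsto)
    show "U N \<in> borel_measurable ?P" "V N \<in> borel_measurable ?P" for N
      unfolding U_def[abs_def] V_def[abs_def] using D(1) D'(1) by (intro borel_measurable_sum; simp)+
    show "(\<lambda>N. sq_int ?P (\<lambda>p. (\<lambda>(t, \<omega>). \<xi> t \<omega>) p - U N p)) \<longlonglongrightarrow> 0"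
      "(\<lambda>N. sq_int ?P (\<lambda>p. (\<lambda>(t, \<omega>). \<eta> t \<omega>) p - V N p)) \<longlonglongrightarrow> 0"
      using Zlim Z'lim by (simp_all add: sqnorm_eq U_def V_def case_prod_unfold)
  qed (use Dx De in \<open>auto simp: sqnorm_eq\<close>)
  moreover have "(\<integral>p. U N p \<bullet> V N p \<partial>?P) = (\<Sum>n<N. \<integral>x. F n x \<bullet> G n x \<partial>simplex_measure (Suc n) S T)" for N
  proof -
    have "(\<integral>p. U N p \<bullet> V N p \<partial>?P) = (\<integral>p. (\<Sum>n<N. \<Sum>m<N. (\<lambda>(t, \<omega>). Z n t \<omega> \<bullet> Z' m t \<omega>) p) \<partial>?P)"
      unfolding U_def V_def by (simp only: inner_sum_left, simp only: inner_sum_right case_prod_unfold)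
    also have "\<dots> = (\<Sum>n<N. \<Sum>m<N. \<integral>(t, \<omega>). Z n t \<omega> \<bullet> Z' m t \<omega> \<partial>?P)"
      by (rule integral_double_sum) (rule process_integral(1)[OF D(1,2) D'(1,2)])
    also have "\<dots> = (\<Sum>n<N. \<Sum>m<N. if n = m then \<integral>x. F n x \<bullet> G n x \<partial>simplex_measure (Suc n) S T else 0)"
      by (intro sum.cong refl chaos_component_inner[OF S Z Z' FG])
    also have "\<dots> = (\<Sum>n<N. \<integral>x. F n x \<bullet> G n x \<partial>simplex_measure (Suc n) S T)"
      by (intro sum.cong refl) (simp add: sum.delta)
    finally show ?thesis .
  qed
  ultimately show ?thesis by (simp add: sums_def case_prod_unfold)
qed

text \<open>Parseval for the four pairs formed from \<open>F\<close> and \<open>G\<close> gives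
  series with the same sum, because all of them expand \<open>\<xi>\<close>. Their alternating
  combination is the series of squared distances \<open>d n\<close>, so a series of nonnegative
  terms sums to 0.\<close>

lemma chaos_unique:
  fixes \<xi> :: "real \<Rightarrow> 'w \<Rightarrow> 'v::euclidean_space"
  assumes S: "0 \<le> S" and F: "chaos M W S T \<xi> F" and G: "chaos M W S T \<xi> G"
  shows "AE x in simplex_measure (Suc n) S T. F n x = G n x"
proof -
  have L2: "F n \<in> L2_simplex (Suc n) S T" "G n \<in> L2_simplex (Suc n) S T" for n
    using assms by (auto simp: chaos_def)
  note i = integrable_inner_L2_simplex
  define d where "d n = (\<integral>x. (F n x - G n x) \<bullet> (F n x - G n x) \<partial>simplex_measure (Suc n) S T)" for n
  have deq: "d n = ((\<integral>x. F n x \<bullet> F n x \<partial>simplex_measure (Suc n) S T) - (\<integral>x. F n x \<bullet> G n x \<partial>simplex_measure (Suc n) S T)) -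
      ((\<integral>x. G n x \<bullet> F n x \<partial>simplex_measure (Suc n) S T) - (\<integral>x. G n x \<bullet> G n x \<partial>simplex_measure (Suc n) S T))" for n
    using i[OF L2(1) L2(1)] i[OF L2(1) L2(2)] i[OF L2(2) L2(1)] i[OF L2(2) L2(2)]
    by (simp add: d_def inner_diff_left inner_diff_right)
  have "d sums 0"
    unfolding deq[abs_def]
    using sums_diff[OF sums_diff[OF chaos_parseval[OF S F F] chaos_parseval[OF S F G]]
        sums_diff[OF chaos_parseval[OF S G F] chaos_parseval[OF S G G]]] by simp
  moreover have "d n \<ge> 0" for n unfolding d_def by (intro integral_nonneg_AE) auto
  ultimately have "d n = 0"
    using suminf_eq_zero_iff[of d] sums_unique[of d 0] by (auto simp: sums_iff)
  moreover have "integrable (simplex_measure (Suc n) S T) (\<lambda>x. (F n x - G n x) \<bullet> (F n x - G n x))"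
    using L2 by (intro integrable_inner_sq_int sq_int_diff_finite borel_measurable_diff) (auto simp: L2_simplex_sq_int)
  ultimately have "AE x in simplex_measure (Suc n) S T. (F n x - G n x) \<bullet> (F n x - G n x) = 0"
    unfolding d_def by (subst (asm) integral_nonneg_eq_0_iff_AE) auto
  then show ?thesis by simp
qed

text \<open>\<open>L2_F_inner\<close> is an iterated integral with time inside; Fubini turns it into
  the integral over the product measure in which the rest of the argument takes place.\<close>

lemma L2_F_inner_eq:
  fixes \<xi> \<eta> :: "real \<Rightarrow> 'w \<Rightarrow> 'v::euclidean_space"
  assumes "0 \<le> S" "\<xi> \<in> L2_F M W S T" "\<eta> \<in> L2_F M W S T"
  shows "L2_F_inner M S T \<xi> \<eta> = process_inner S T \<xi> \<eta>"
proof -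
  interpret pair_sigma_finite "interval_measure S T" M by (rule process_pair)
  note i = process_integral(1)[OF L2_FD(1,2)[OF assms(2,1)] L2_FD(1,2)[OF assms(3,1)]]
  show ?thesis
    using integral_snd[OF i[unfolded process_measure_def]]
    by (simp add: L2_F_inner_def process_measure_def set_lebesgue_integral_def integral_restrict_space)
qed

end

section \<open>Chaos expansions under linear isometries\<close>

lemma isometry_borel_measurable:
  fixes L :: "'v::euclidean_space \<Rightarrow> 'u::euclidean_space"
  assumes "linear L" "f \<in> borel_measurable A" shows "(\<lambda>x. L (f x)) \<in> borel_measurable A"
  using measurable_compose[OF assms(2) borel_measurable_continuous_onI[OF linear_continuous_on[OF linear_conv_bounded_linear[THEN iffD1, OF assms(1)]]]] .

lemma adapted_L2_isometry:
  fixes L :: "'v::euclidean_space \<Rightarrow> 'u::euclidean_space"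
  assumes "linear L" "\<And>v. norm (L v) = norm v" "\<xi> \<in> adapted_L2 M W r a b"
  shows "(\<lambda>t \<omega>. L (\<xi> t \<omega>)) \<in> adapted_L2 M W r a b"
proof -
  have "(\<lambda>p. L (case p of (t, \<omega>) \<Rightarrow> \<xi> t \<omega>)) \<in> borel_measurable (process_measure M a b)"
    using assms(3) by (intro isometry_borel_measurable[OF assms(1)]) (simp add: adapted_L2_def)
  moreover have "(\<lambda>\<omega>. L (\<xi> t \<omega>)) \<in> borel_measurable (filt M W r t)" if "t \<in> {a<..<b}" for t
    using assms(3) that by (intro isometry_borel_measurable[OF assms(1)]) (simp add: adapted_L2_def)
  ultimately show ?thesis
    using assms(2,3) by (simp add: adapted_L2_def sqnorm_def case_prod_unfold)
qed

text \<open>The same partitions with weights \<open>L (\<zeta> j i \<omega>)\<close> approximate the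
  image: linearity moves \<open>L\<close> out of the simple sums, and the isometry leaves the
  approximation errors unchanged.\<close>

lemma ito_integral_isometry:
  fixes L :: "'v::euclidean_space \<Rightarrow> 'u::euclidean_space"
  assumes L: "linear L" "\<And>v. norm (L v) = norm v" and X: "ito_integral M W a b X I"
  shows "ito_integral M W a b (\<lambda>t \<omega>. L (X t \<omega>)) (\<lambda>\<omega>. L (I \<omega>))"
proof -
  obtain n \<tau> \<zeta> where s: "\<And>j. simple_integrand M W a b (n j) (\<tau> j) (\<zeta> j)"
    and lim: "(\<lambda>j. sqnorm M a b (\<lambda>t \<omega>. X t \<omega> - simple_process (n j) (\<tau> j) (\<zeta> j) t \<omega>)) \<longlonglongrightarrow> 0"
      "(\<lambda>j. \<integral>\<^sup>+\<omega>. ennreal ((norm (I \<omega> - simple_integral W (n j) (\<tau> j) (\<zeta> j) \<omega>))\<^sup>2) \<partial>M) \<longlonglongrightarrow> 0"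
    and XI: "X \<in> adapted_L2 M W 0 a b" "I \<in> borel_measurable M"
    using X unfolding ito_integral_def by blast
  define \<zeta>' where "\<zeta>' j i \<omega> = L (\<zeta> j i \<omega>)" for j i \<omega>
  have "norm (L (X t \<omega>) - simple_process (n j) (\<tau> j) (\<zeta>' j) t \<omega>) = norm (X t \<omega> - simple_process (n j) (\<tau> j) (\<zeta> j) t \<omega>)" for j t \<omega>
    unfolding simple_process_def \<zeta>'_def
    by (subst L(2)[symmetric]) (simp add: linear_diff[OF L(1)] linear_sum[OF L(1)] linear_cmul[OF L(1)])
  moreover have "norm (L (I \<omega>) - simple_integral W (n j) (\<tau> j) (\<zeta>' j) \<omega>) = norm (I \<omega> - simple_integral W (n j) (\<tau> j) (\<zeta> j) \<omega>)" for j \<omega>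
    unfolding simple_integral_def \<zeta>'_def
    by (subst L(2)[symmetric]) (simp add: linear_diff[OF L(1)] linear_sum[OF L(1)] linear_cmul[OF L(1)])
  moreover have "simple_integrand M W a b (n j) (\<tau> j) (\<zeta>' j)" for j
    using s[of j] isometry_borel_measurable[OF L(1), of "\<zeta> j i" for i] L(2)
    unfolding simple_integrand_def \<zeta>'_def[abs_def] by (simp add: bounded_iff)
  ultimately show ?thesis
    unfolding ito_integral_def using lim XI adapted_L2_isometry[OF L XI(1)] isometry_borel_measurable[OF L(1) XI(2)]
    by (intro conjI exI[of _ n] exI[of _ \<tau>] exI[of _ \<zeta>']) (auto simp: sqnorm_def)
qed

lemma iterated_ito_isometric_image:
  fixes L :: "'v::euclidean_space \<Rightarrow> 'u::euclidean_space"
  assumes L: "linear L" "\<And>v. norm (L v) = norm v" and "iterated_ito M W a n b f I"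
  shows "iterated_ito M W a n b (\<lambda>x. L (f x)) (\<lambda>\<omega>. L (I \<omega>))"
  using assms(3)
proof (induction n arbitrary: b f I)
  case (Suc n)
  then obtain X where X: "AE t in lborel. t \<in> {a<..<b} \<longrightarrow> iterated_ito M W a n t (\<lambda>x. f (case_nat t x)) (X t)"
    and iX: "ito_integral M W a b X I" by auto
  have "AE t in lborel. t \<in> {a<..<b} \<longrightarrow> iterated_ito M W a n t (\<lambda>x. L (f (case_nat t x))) (\<lambda>\<omega>. L (X t \<omega>))"
    using X by eventually_elim (use Suc.IH in auto)
  then show ?case using ito_integral_isometry[OF L iX] by auto
qed auto

text \<open>Needed for \<open>L = transpose\<close>, to know that the coefficients of the transposed
  kernel are the transposed coefficients.\<close>

lemma chaos_isometric_image:
  fixes L :: "'v::euclidean_space \<Rightarrow> 'u::euclidean_space"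
  assumes L: "linear L" "\<And>v. norm (L v) = norm v" and F: "chaos M W S T \<xi> F"
  shows "chaos M W S T (\<lambda>t \<omega>. L (\<xi> t \<omega>)) (\<lambda>n x. L (F n x))"
proof -
  obtain Z where Z: "\<And>n. Z n \<in> L2_F M W S T"
      "\<And>n. AE t in lborel. t \<in> {S<..<T} \<longrightarrow> iterated_ito M W S n t (\<lambda>x. F n (case_nat t x)) (Z n t)"
    and lim: "(\<lambda>N. sqnorm M S T (\<lambda>t \<omega>. \<xi> t \<omega> - (\<Sum>n<N. Z n t \<omega>))) \<longlonglongrightarrow> 0"
    and L2: "\<xi> \<in> L2_F M W S T" "\<And>n. F n \<in> L2_simplex (Suc n) S T"
    using F unfolding chaos_def by blast
  have "norm (L (\<xi> t \<omega>) - (\<Sum>n<N. L (Z n t \<omega>))) = norm (\<xi> t \<omega> - (\<Sum>n<N. Z n t \<omega>))" for t \<omega> N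
    by (subst L(2)[symmetric]) (simp add: linear_diff[OF L(1)] linear_sum[OF L(1)])
  moreover have "AE t in lborel. t \<in> {S<..<T} \<longrightarrow> iterated_ito M W S n t (\<lambda>x. L (F n (case_nat t x))) (\<lambda>\<omega>. L (Z n t \<omega>))" for n
    using Z(2)[of n] by eventually_elim (use iterated_ito_isometric_image[OF L] in auto)
  moreover have "(\<lambda>t \<omega>. L (\<xi> t \<omega>)) \<in> L2_F M W S T" "(\<lambda>t \<omega>. L (Z n t \<omega>)) \<in> L2_F M W S T" for n
    unfolding L2_F_def by (rule adapted_L2_isometry[OF L], use L2 Z(1) in \<open>simp add: L2_F_def\<close>)+
  moreover have "(\<lambda>x. L (F n x)) \<in> L2_simplex (Suc n) S T" for n
    using L2(2)[of n] isometry_borel_measurable[OF L(1), of "F n"] by (simp add: L2_simplex_def L(2))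
  ultimately show ?thesis
    unfolding chaos_def using lim
    by (intro conjI exI[of _ "\<lambda>n t \<omega>. L (Z n t \<omega>)"]) (auto simp: sqnorm_def)
qed

lemma linear_transpose: "linear (transpose :: real ^ 'm ^ 'n \<Rightarrow> _)"
  by (rule linearI) (simp_all add: transpose_def vec_eq_iff)

lemma norm_transpose: "norm (transpose (A :: real ^ 'm ^ 'n)) = norm A"
proof -
  have "transpose A \<bullet> transpose A = A \<bullet> A"
    unfolding inner_vec_def transpose_def by (simp, rule sum.swap)
  then show ?thesis by (simp add: norm_eq_sqrt_inner)
qed


section \<open>Adjointness of the star products\<close>

text \<open>The part with \<open>X\<close> is a product family. The part with \<open>Y\<close> is
  one too after the injection sending (n, j) to (j, n + j), so it is a subfamily of a summable
  product family.\<close>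

lemma summable_on_convolution_bound:
  fixes w X Y :: "nat \<Rightarrow> real"
  assumes "summable w" "summable X" "summable Y" "\<And>j. 0 \<le> w j" "\<And>n. 0 \<le> X n" "\<And>n. 0 \<le> Y n"
  shows "(\<lambda>(n, j). w j * (X n + Y (n + j))) summable_on UNIV"
proof -
  have prod: "(\<lambda>(j, n). w j * Z n) summable_on UNIV \<times> UNIV" if "summable Z" "\<And>n. 0 \<le> Z n" for Z :: "nat \<Rightarrow> real"
  proof (rule summable_on_SigmaI)
    have Z: "(Z has_sum suminf Z) UNIV"
      using that by (intro norm_summable_imp_has_sum summable_sums) auto
    show "((\<lambda>n. case (j, n) of (j, n) \<Rightarrow> w j * Z n) has_sum w j * suminf Z) UNIV" for j
      using has_sum_cmult_right[OF Z] by simp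
    show "(\<lambda>j. w j * suminf Z) summable_on UNIV"
      using assms by (intro summable_on_cmult_left norm_summable_imp_summable_on) auto
  qed (use assms that in auto)
  have "(\<lambda>(n, j). w j * X n) summable_on UNIV \<longleftrightarrow> (\<lambda>(j, n). w j * X n) summable_on UNIV \<times> UNIV"
    by (rule summable_on_reindex_bij_witness[of _ prod.swap prod.swap]) auto
  then have 1: "(\<lambda>(n, j). w j * X n) summable_on UNIV" using prod[of X] assms by simp
  have "(\<lambda>(j, n). w j * Y n) summable_on (\<lambda>(n, j). (j, n + j)) ` UNIV"
    using prod[of Y] assms by (auto intro: summable_on_subset)
  then have 2: "(\<lambda>(n, j). w j * Y (n + j)) summable_on UNIV"
    by (subst (asm) summable_on_reindex) (auto simp: inj_on_def o_def case_prod_unfold)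
  show ?thesis
    using summable_on_add[OF 1 2] by (simp add: case_prod_unfold distrib_left)
qed

text \<open>Domination by \<open>b\<close> makes \<open>A\<close> summable as an unordered family on
  the quadrant. Its total \<open>t\<close> can be computed along rows or along diagonals, and the
  latter identifies it with \<open>s\<close>.\<close>

lemma sums_diagonals_eq_rows:
  fixes A :: "nat \<Rightarrow> nat \<Rightarrow> real"
  assumes b: "(\<lambda>(n, j). b n j) summable_on UNIV" and A: "\<And>n j. \<bar>A n j\<bar> \<le> b n j"
    and s: "(\<lambda>N. \<Sum>k\<le>N. A k (N - k)) sums s"
  shows "(\<lambda>n. \<Sum>j. A n j) sums s" and "\<And>n. summable (b n)"
proof -
  have abs: "(\<lambda>p. norm ((\<lambda>(n, j). A n j) p)) summable_on UNIV"
    by (rule Infinite_Sum.abs_summable_on_comparison_test'[OF b]) (use A in auto)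
  then have A_on: "(\<lambda>(n, j). A n j) summable_on UNIV" by (rule abs_summable_summable)
  define t where "t = infsum (\<lambda>(n, j). A n j) UNIV"
  have hs: "((\<lambda>(n, j). A n j) has_sum t) (UNIV \<times> UNIV)"
    using A_on by (simp add: t_def)
  have row: "(A n has_sum suminf (A n)) UNIV" and "summable (b n)" for n
  proof -
    have "b n summable_on UNIV"
      using summable_on_SigmaD1[of b UNIV "\<lambda>_. UNIV" n] b by simp
    then show *: "summable (b n)" by (rule summable_on_imp_summable)
    have A_sum: "summable (\<lambda>j. norm (A n j))"
      by (rule summable_comparison_test'[where N=0, OF *]) (simp add: A)
    show "(A n has_sum suminf (A n)) UNIV"
      by (rule norm_summable_imp_has_sum[OF A_sum summable_sums[OF summable_norm_cancel[OF A_sum]]])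
  qed
  then show "summable (b n)" for n by blast
  have "((\<lambda>n. suminf (A n)) has_sum t) UNIV"
    by (rule has_sum_SigmaD[OF hs]) (use row in simp)
  then have rows: "(\<lambda>n. suminf (A n)) sums t" by (rule has_sum_imp_sums)
  \<comment> \<open>The pair (N, k) with \<open>k \<le> N\<close> encodes the entry in row
    \<open>k\<close> and column \<open>N - k\<close>.\<close>
  have "((\<lambda>(N, k). A k (N - k)) has_sum t) (SIGMA N:UNIV. {..N})"
  proof (subst has_sum_reindex_bij_witness[where i="\<lambda>(n, j). (n + j, n)" and j="\<lambda>(N, k). (k, N - k)"
        and T="UNIV \<times> UNIV" and h="\<lambda>(n, j). A n j" and s'=t])
    show "((\<lambda>(n, j). A n j) has_sum t) (UNIV \<times> UNIV)" by (rule hs)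
  qed (simp_all add: split_beta, auto)
  moreover have "((\<lambda>k. case (N, k) of (N, k) \<Rightarrow> A k (N - k)) has_sum (\<Sum>k\<le>N. A k (N - k))) {..N}" for N
    by (rule has_sum_finiteI) simp_all
  ultimately have "((\<lambda>N. \<Sum>k\<le>N. A k (N - k)) has_sum t) UNIV"
    by (rule has_sum_SigmaD)
  then have "(\<lambda>N. \<Sum>k\<le>N. A k (N - k)) sums t" by (rule has_sum_imp_sums)
  then have "t = s" using s by (rule sums_unique2)
  then show "(\<lambda>n. \<Sum>j. A n j) sums s" using rows by simp
qed

section \<open>Matrix norms, and coordinates of joined points\<close>

lemma bounded_bilinear_matrix_vector_mult:
  "bounded_bilinear ((*v) :: real ^ 'm ^ 'n \<Rightarrow> real ^ 'm \<Rightarrow> real ^ 'n)"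
proof -
  have "bilinear ((*v) :: real ^ 'm ^ 'n \<Rightarrow> real ^ 'm \<Rightarrow> real ^ 'n)"
    unfolding bilinear_def
    by (auto intro!: linearI simp: matrix_vector_mult_def vec_eq_iff algebra_simps sum.distrib sum_distrib_left)
  then show ?thesis by (simp add: bilinear_conv_bounded_bilinear)
qed

lemma borel_measurable_matrix_vector_mult [measurable (raw)]:
  fixes f :: "'a \<Rightarrow> real ^ 'm ^ 'n"
  assumes "f \<in> borel_measurable M" "g \<in> borel_measurable M"
  shows "(\<lambda>x. f x *v g x) \<in> borel_measurable M"
  by (rule borel_measurable_continuous_Pair[OF assms])
    (intro bounded_bilinear.continuous_on[OF bounded_bilinear_matrix_vector_mult] continuous_intros)

lemma norm_matrix_vector_mult:
  fixes A :: "real ^ 'm ^ 'n"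
  shows "norm (A *v x) \<le> norm A * norm x"
proof -
  have "(norm (A *v x))\<^sup>2 = (\<Sum>i\<in>UNIV. (A $ i \<bullet> x)\<^sup>2)"
    unfolding power2_norm_eq_inner inner_vec_def[of "A *v x"]
    by (simp only: matrix_vector_mul_component inner_real_def power2_eq_square)
  also have "\<dots> \<le> (\<Sum>i\<in>UNIV. (A $ i \<bullet> A $ i) * (x \<bullet> x))"
    by (intro sum_mono) (simp add: Cauchy_Schwarz_ineq)
  also have "\<dots> = (norm A * norm x)\<^sup>2"
    unfolding power_mult_distrib power2_norm_eq_inner inner_vec_def[of A] sum_distrib_right ..
  finally show ?thesis by (rule power2_le_imp_le) simp
qed

text \<open>\<open>V_norm\<close> uses the operator norm, while \<open>sq_int\<close> uses the
  Frobenius norm. A crude entrywise comparison suffices: the constant depends only on the dimensions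
  and is absorbed into the weights of \<open>star_kernel_section_bound\<close>.\<close>

lemma norm_le_opnorm:
  fixes A :: "real ^ 'm ^ 'n"
  shows "norm A \<le> (CARD('n) * CARD('m)) * opnorm A"
proof -
  have "norm A \<le> (\<Sum>i\<in>UNIV. norm (A $ i))" by (simp add: norm_vec_def L2_set_le_sum)
  also have "\<dots> \<le> (\<Sum>i\<in>UNIV. \<Sum>j\<in>UNIV. \<bar>A $ i $ j\<bar>)" by (intro sum_mono norm_le_l1_cart)
  also have "\<dots> \<le> (\<Sum>i\<in>(UNIV::'n set). \<Sum>j\<in>(UNIV::'m set). opnorm A)"
    unfolding opnorm_def by (intro sum_mono matrix_component_le_onorm)
  finally show ?thesis by simp
qed

lemma inner_transpose_matrix_vector:
  fixes A :: "real ^ 'm ^ 'n"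
  shows "x \<bullet> (transpose A *v y) = (A *v x) \<bullet> y"
  by (metis dot_lmul_matrix inner_commute transpose_matrix_vector)

text \<open>The left-hand sides are the arguments that \<open>tri\<close> passes to its two factors.
  They equal the expected points as functions because points of a simplex are
  \<open>undefined\<close> outside their index range.\<close>

lemma ordered_simplex_joinD:
  assumes "u \<in> ordered_simplex (Suc n) a b" "s \<in> ordered_simplex j (u 0) b"
  shows "restrict (simplex_join j s u) {..j} = s(j := u 0)" "restrict (\<lambda>i. simplex_join j s u (j + i)) {..n} = u"
proof -
  have "s i = undefined" if "j < i" for i using ordered_simplex_undefined[OF assms(2)] that by simp
  then show "restrict (simplex_join j s u) {..j} = s(j := u 0)"
    by (auto simp: fun_eq_iff simplex_join_def restrict_def)
  have "u i = undefined" if "n < i" for i using ordered_simplex_undefined[OF assms(1)] that by simp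
  then show "restrict (\<lambda>i. simplex_join j s u (j + i)) {..n} = u"
    by (auto simp: fun_eq_iff simplex_join_def restrict_def not_le)
qed

lemmas nn_integral_simplex_join =
    fibred_restriction.nn_integral_fibred[OF fibred_join[OF zero_less_Suc], folded simplex_measure_def, unfolded prod.case]
  and nn_integral_simplex_join_measurable =
    fibred_restriction.nn_integral_fibred_measurable[OF fibred_join[OF zero_less_Suc], folded simplex_measure_def, unfolded prod.case]
  and integral_simplex_join =
    fibred_restriction.integral_fibred[OF fibred_join[OF zero_less_Suc], folded simplex_measure_def, unfolded prod.case]
  and integrable_simplex_join =
    fibred_restriction.integrable_fibred[OF fibred_join[OF zero_less_Suc], folded simplex_measure_def, unfolded prod.case]
  and AE_simplex_join =
    fibred_restriction.AE_fibred[OF fibred_join[OF zero_less_Suc], folded simplex_measure_def, unfolded prod.case]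

lemma simplex_join_section:
  assumes "u \<in> ordered_simplex (Suc n) a b" "f \<in> borel_measurable (simplex_measure (j + Suc n) a b)"
  shows "(\<lambda>s. f (simplex_join j s u)) \<in> borel_measurable (simplex_measure j (u 0) b)"
  by (rule measurable_compose[OF fibred_restriction.phi_section[OF fibred_join[OF zero_less_Suc], folded simplex_measure_def, unfolded prod.case, OF assms(1)] assms(2)])

text \<open>Fubini with the smallest coordinate outermost, the order of integration in
  \<open>V_norm\<close>. It is the join with a one-dimensional simplex, which is then identified
  with an interval.\<close>

lemma AE_simplex_last:
  assumes "AE v in simplex_measure (Suc j) a b. P v"
  shows "AE t in interval_measure a b. AE s in simplex_measure j t b. P (s(j := t))"
proof -
  have "AE u in simplex_measure (Suc 0) a b. AE s in simplex_measure j (u 0) b. P (simplex_join j s u)"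
  proof (rule AE_simplex_join)
    show "AE v in simplex_measure (j + Suc 0) a b. P v"
      unfolding add_Suc_right add_0_right by (rule assms)
  qed
  from AE_simplex_cons[OF this] show ?thesis
  proof eventually_elim
    case (elim t)
    have last: "AE s in simplex_measure j t b. P (simplex_join j s (case_nat t (\<lambda>_. undefined)))"
      using bspec[OF elim[unfolded simplex_measure_0 AE_count_space] singletonI] unfolding old.nat.case .
    show "AE s in simplex_measure j t b. P (s(j := t))"
    proof (rule AE_mp[OF last], intro AE_I2 impI)
      fix s assume s: "s \<in> space (simplex_measure j t b)" and P: "P (simplex_join j s (case_nat t (\<lambda>_. undefined)))"
      have "s i = undefined" if "j < i" for i using ordered_simplex_undefined[of s j t b] that s by simp
      then have "simplex_join j s (case_nat t (\<lambda>_. undefined)) = s(j := t)"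
        by (auto simp: fun_eq_iff simplex_join_def split: nat.split)
      then show "P (s(j := t))" using P by simp
    qed
  qed
qed

text \<open>A strictly increasing selection of coordinates takes ordered points to ordered points,
  so \<open>f\<close> is evaluated inside its own simplex.\<close>

lemma measurable_simplex_subsequence:
  assumes h: "\<And>i. i < k \<Longrightarrow> h i < m" "\<And>p q. p < q \<Longrightarrow> q < k \<Longrightarrow> h p < h q"
    and f: "f \<in> borel_measurable (simplex_measure k a b)"
  shows "(\<lambda>v. f (\<lambda>i\<in>{..<k}. v (h i))) \<in> borel_measurable (simplex_measure m a b)"
proof -
  have "(\<lambda>v. \<lambda>i\<in>{..<k}. v (h i)) \<in> measurable (simplex_measure m a b) (simplex_measure k a b)"
    unfolding simplex_measure_def
  proof (rule measurable_restrict_space3)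
    show "(\<lambda>v. \<lambda>i\<in>{..<k}. v (h i)) \<in> measurable (lborel_pow m) (lborel_pow k)"
      using h by (intro measurable_restrict measurable_component_singleton) auto
    show "(\<lambda>v. \<lambda>i\<in>{..<k}. v (h i)) \<in> ordered_simplex m a b \<rightarrow> ordered_simplex k a b"
      using h by (auto simp: ordered_simplex_def)
  qed
  from measurable_compose[OF this f] show ?thesis .
qed

lemma measurable_tri_factors:
  assumes "f \<in> borel_measurable (simplex_measure (Suc j) a b)" "g \<in> borel_measurable (simplex_measure (Suc n) a b)"
  shows "(\<lambda>v. f (restrict v {..j})) \<in> borel_measurable (simplex_measure (j + Suc n) a b)"
    and "(\<lambda>v. g (restrict (\<lambda>i. v (j + i)) {..n})) \<in> borel_measurable (simplex_measure (j + Suc n) a b)"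
  using measurable_simplex_subsequence[OF _ _ assms(1), of "\<lambda>i. i" "j + Suc n"]
    measurable_simplex_subsequence[OF _ _ assms(2), of "\<lambda>i. j + i" "j + Suc n"]
  by (simp_all add: lessThan_Suc_atMost)


lemma le_ennreal_sqrt_imp:
  assumes "ennreal_sqrt x \<le> ennreal c" "0 \<le> c"
  shows "x \<le> ennreal (c\<^sup>2)"
proof -
  have "x \<noteq> \<infinity>" using assms(1) by (auto simp: ennreal_sqrt_def top_unique)
  then have "sqrt (enn2real x) \<le> c" using assms by (simp add: ennreal_sqrt_def)
  then have "enn2real x \<le> c\<^sup>2" by (simp add: real_sqrt_le_iff sqrt_le_D)
  then show ?thesis using \<open>x \<noteq> \<infinity>\<close> by (metis ennreal_enn2real ennreal_leI infinity_ennreal_def less_top)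
qed

lemma opnorm_le_norm: "opnorm (A :: real ^ 'm ^ 'n) \<le> norm A"
  unfolding opnorm_def by (intro onorm_bound norm_matrix_vector_mult) simp

text \<open>The operator norm is 1-Lipschitz for the Frobenius norm, hence continuous.\<close>

lemma borel_measurable_opnorm [measurable]: "opnorm \<in> borel_measurable (borel :: (real ^ 'm ^ 'n) measure)"
proof (rule borel_measurable_continuous_onI)
  have tri: "opnorm A \<le> opnorm B + norm (A - B)" for A B :: "real ^ 'm ^ 'n"
  proof -
    have "opnorm A = onorm (\<lambda>x. B *v x + (A - B) *v x)"
      by (simp add: opnorm_def matrix_vector_mult_add_rdistrib[symmetric])
    also have "\<dots> \<le> opnorm B + opnorm (A - B)"
      unfolding opnorm_def by (intro onorm_triangle matrix_vector_mul_bounded_linear)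
    finally show ?thesis using opnorm_le_norm[of "A - B"] by simp
  qed
  have "dist (opnorm A) (opnorm B) \<le> dist A B" for A B :: "real ^ 'm ^ 'n"
    using tri[of A B] tri[of B A] by (simp add: dist_real_def dist_norm norm_minus_commute abs_le_iff)
  then show "continuous_on UNIV (opnorm :: real ^ 'm ^ 'n \<Rightarrow> real)"
    unfolding continuous_on_iff by (meson le_less_trans)
qed

lemma simplex_last_section:
  assumes t: "t \<in> {a<..<b}" and f: "f \<in> borel_measurable (simplex_measure (Suc j) a b)"
  shows "(\<lambda>s. f (s(j := t))) \<in> borel_measurable (simplex_measure j t b)"
proof -
  let ?u = "case_nat t (\<lambda>_. undefined)"
  have u: "?u \<in> ordered_simplex (Suc 0) a b"
    using t by (auto simp: ordered_simplex_def PiE_iff extensional_def split: nat.split)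
  have "(\<lambda>s. f (simplex_join j s ?u)) \<in> borel_measurable (simplex_measure j t b)"
    using simplex_join_section[OF u, of f j] f by simp
  moreover have "simplex_join j s ?u = s(j := t)" if "s \<in> ordered_simplex j t b" for s
    using ordered_simplex_undefined[OF that]
    by (auto simp: fun_eq_iff simplex_join_def split: nat.split)
  ultimately show ?thesis by (subst measurable_cong[where g="\<lambda>s. f (simplex_join j s ?u)"]) auto
qed

text \<open>\<open>F\<close> is the family known to have summable V-norms, \<open>G\<close> the one
  occurring in a product. The essential supremum bounds almost every section of \<open>F\<close>,
  and since the two agree almost everywhere on the simplex, almost every section of \<open>G\<close>
  inherits the bound.\<close>

lemma star_kernel_section_bound:
  fixes F :: "nat \<Rightarrow> (nat \<Rightarrow> real) \<Rightarrow> real ^ 'd::finite ^ 'd"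
  assumes F: "\<And>n. F n \<in> borel_measurable (simplex_measure (Suc n) S T)"
    and V: "(\<Sum>n. V_norm n S T (F n)) < \<infinity>"
    and G: "\<And>n. AE x in simplex_measure (Suc n) S T. G n x = F n x"
  obtains w :: "nat \<Rightarrow> real" where "summable w" "\<And>j. 0 < w j"
    "\<And>j. AE t in interval_measure S T.
       sq_int (simplex_measure j t T) (\<lambda>s. G j (s(j := t))) \<le> ennreal ((w j)\<^sup>2)"
proof -
  \<comment> \<open>The constant of \<open>norm_le_opnorm\<close> for square matrices.\<close>
  define C where "C = real (CARD('d)) * real (CARD('d))"
  define v where "v j = enn2real (V_norm j S T (F j))" for j
  have C: "0 < C" by (simp add: C_def)
  have fin: "V_norm j S T (F j) < \<infinity>" for j
    using ennreal_suminf_lessD[of "\<lambda>n. V_norm n S T (F n)" \<infinity>] V by simp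
  then have v: "V_norm j S T (F j) = ennreal (v j)" "0 \<le> v j" for j
    by (simp_all add: v_def)
  \<comment> \<open>The summand \<open>(1 / 2) ^ j\<close> only serves to make the weights positive.\<close>
  have "summable v"
    using V by (intro summable_suminf_not_top) (auto simp: v)
  then have "summable (\<lambda>j. C * v j + (1 / 2) ^ j)"
    by (intro summable_add summable_mult) (auto simp: summable_geometric)
  moreover have "0 < C * v j + (1 / 2) ^ j" for j
    using C v(2)[of j] by (intro add_nonneg_pos) auto
  moreover have "AE t in interval_measure S T.
       sq_int (simplex_measure j t T) (\<lambda>s. G j (s(j := t))) \<le> ennreal ((C * v j + (1 / 2) ^ j)\<^sup>2)" for j
    using esssup_AE[of "\<lambda>t. ennreal_sqrt (\<integral>\<^sup>+s. ennreal ((opnorm (F j (s(j := t))))\<^sup>2) \<partial>simplex_measure j t T)" "interval_measure S T"]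
      AE_simplex_last[OF G[of j]] AE_space
  proof eventually_elim
    case (elim t)
    let ?I = "\<integral>\<^sup>+s. ennreal ((opnorm (F j (s(j := t))))\<^sup>2) \<partial>simplex_measure j t T"
    have I: "?I \<le> ennreal ((v j)\<^sup>2)"
      using elim(1) v[of j] by (intro le_ennreal_sqrt_imp) (simp_all add: V_norm_def)
    have "sq_int (simplex_measure j t T) (\<lambda>s. G j (s(j := t)))
        \<le> (\<integral>\<^sup>+s. ennreal (C\<^sup>2) * ennreal ((opnorm (F j (s(j := t))))\<^sup>2) \<partial>simplex_measure j t T)"
      unfolding sq_int_def
    proof (rule nn_integral_mono_AE)
      show "AE s in simplex_measure j t T. ennreal ((norm (G j (s(j := t))))\<^sup>2) \<le> ennreal (C\<^sup>2) * ennreal ((opnorm (F j (s(j := t))))\<^sup>2)"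
        using elim(2)
      proof eventually_elim
        case (elim s)
        have "norm (F j (s(j := t))) \<le> C * opnorm (F j (s(j := t)))"
          using norm_le_opnorm[of "F j (s(j := t))"] by (simp add: C_def)
        then have "(norm (F j (s(j := t))))\<^sup>2 \<le> C\<^sup>2 * (opnorm (F j (s(j := t))))\<^sup>2"
          unfolding power_mult_distrib[symmetric] by (rule power_mono) simp
        then show ?case unfolding elim by (simp add: ennreal_mult[symmetric] ennreal_leI)
      qed
    qed
    also have "\<dots> = ennreal (C\<^sup>2) * ?I"
    proof (rule nn_integral_cmult)
      have "t \<in> {S<..<T}" using elim(3) by (simp add: space_restrict_space)
      from simplex_last_section[OF this F]
      show "(\<lambda>s. ennreal ((opnorm (F j (s(j := t))))\<^sup>2)) \<in> borel_measurable (simplex_measure j t T)"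
        by measurable
    qed
    also have "\<dots> \<le> ennreal (C\<^sup>2) * ennreal ((v j)\<^sup>2)" by (intro mult_left_mono I) simp
    also have "\<dots> = ennreal ((C * v j)\<^sup>2)" by (simp add: ennreal_mult power_mult_distrib)
    also have "\<dots> \<le> ennreal ((C * v j + (1 / 2) ^ j)\<^sup>2)"
      using C v(2)[of j] by (intro ennreal_leI power_mono) auto
    finally show ?case .
  qed
  ultimately show thesis using that by blast
qed


lemma suminf_ennreal_finite_imp:
  fixes e :: "nat \<Rightarrow> ennreal" and f :: "nat \<Rightarrow> real"
  assumes "(\<Sum>j. e j) < \<infinity>" "\<And>j. ennreal \<bar>f j\<bar> \<le> e j"
  shows "summable (\<lambda>j. \<bar>f j\<bar>)"
proof -
  have "(\<Sum>j. ennreal \<bar>f j\<bar>) \<le> (\<Sum>j. e j)" by (intro suminf_le assms) auto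
  then have "(\<Sum>j. ennreal \<bar>f j\<bar>) \<noteq> \<top>" using assms(1) by (auto simp: top_unique)
  then show ?thesis by (intro summable_suminf_not_top) auto
qed

lemma ennreal_mult_add:
  "0 \<le> a \<Longrightarrow> 0 \<le> b \<Longrightarrow> 0 \<le> c \<Longrightarrow> 0 \<le> d \<Longrightarrow> ennreal (a * b + c * d) = ennreal a * ennreal b + ennreal c * ennreal d"
  by (simp add: ennreal_mult)

lemma nn_integral_linear_combination:
  "f \<in> borel_measurable M \<Longrightarrow> g \<in> borel_measurable M \<Longrightarrow>
    (\<integral>\<^sup>+x. a * f x + b * g x \<partial>M) = a * (\<integral>\<^sup>+x. f x \<partial>M) + b * (\<integral>\<^sup>+x. g x \<partial>M)"
  by (simp add: nn_integral_add nn_integral_cmult)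

text \<open>Adjointness for bare coefficient families, free of probability. The forward product
  defines \<open>P\<close> by finite sums, so the series for \<open>s\<close> is given. The work is
  to justify exchanging the infinite sum in \<open>Q\<close> with both integrals, using only section
  bounds on \<open>A\<close>.\<close>

lemma star_adjoint:
  fixes A B :: "nat \<Rightarrow> (nat \<Rightarrow> real) \<Rightarrow> real ^ 'd::finite ^ 'd"
    and X Y P Q :: "nat \<Rightarrow> (nat \<Rightarrow> real) \<Rightarrow> real ^ 'd"
  assumes Am: "\<And>n. A n \<in> borel_measurable (simplex_measure (Suc n) S T)"
    and Bm: "\<And>n. B n \<in> borel_measurable (simplex_measure (Suc n) S T)"
    and AB: "\<And>n. AE v in simplex_measure (Suc n) S T. B n v = transpose (A n v)"
    and w: "summable w" "\<And>j. 0 < w j"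
    and wA: "\<And>j. AE t in interval_measure S T.
       sq_int (simplex_measure j t T) (\<lambda>s. A j (s(j := t))) \<le> ennreal ((w j)\<^sup>2)"
    and X: "\<And>n. X n \<in> L2_simplex (Suc n) S T" "summable (\<lambda>n. enn2real (sq_int (simplex_measure (Suc n) S T) (X n)))"
    and Y: "\<And>n. Y n \<in> L2_simplex (Suc n) S T" "summable (\<lambda>n. enn2real (sq_int (simplex_measure (Suc n) S T) (Y n)))"
    and P: "\<And>n. P n \<in> borel_measurable (simplex_measure (Suc n) S T)"
      "\<And>n. AE v in simplex_measure (Suc n) S T. P n v = (\<Sum>k\<le>n. tri (*v) (n - k) k (A (n - k)) (X k) v)"
    and Q: "\<And>n. Q n \<in> borel_measurable (simplex_measure (Suc n) S T)"
      "\<And>n. AE u in simplex_measure (Suc n) S T. Q n u = (\<Sum>j. (LINT s|simplex_measure j (u 0) T.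
         B j (s(j := u 0)) *v Y (n + j) (simplex_join j s u)))"
    and s: "(\<lambda>n. \<integral>v. P n v \<bullet> Y n v \<partial>simplex_measure (Suc n) S T) sums s"
  shows "(\<lambda>n. \<integral>u. X n u \<bullet> Q n u \<partial>simplex_measure (Suc n) S T) sums s"
proof -
  let ?\<sigma> = "\<lambda>n. simplex_measure (Suc n) S T" and ?\<sigma>' = "\<lambda>j n. simplex_measure (j + Suc n) S T"
    and ?\<rho> = "\<lambda>j u. simplex_measure j (u 0) T"
  define x where "x n = enn2real (sq_int (?\<sigma> n) (X n))" for n
  define y where "y n = enn2real (sq_int (?\<sigma> n) (Y n))" for n
  define b where "b n j = w j * (x n + y (n + j))" for n j
  \<comment> \<open>\<open>H\<close> is the integrand common to both sides, \<open>A\<close> of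
    order \<open>j\<close> applied to \<open>X\<close> of order \<open>n\<close> and paired with
    \<open>Y\<close> of order \<open>n + j\<close>; \<open>D\<close> dominates it. \<open>a\<close>
    integrates \<open>H\<close> over the whole simplex, while \<open>h\<close> and \<open>E\<close>
    integrate \<open>H\<close> and \<open>D\<close> over the upper variables \<open>s\<close> alone,
    with \<open>u\<close> fixed.\<close>
  define H where "H n j v = tri (*v) j n (A j) (X n) v \<bullet> Y (n + j) v" for n j v
  define D where "D n j v = norm (A j (restrict v {..j})) * norm (X n (restrict (\<lambda>i. v (j + i)) {..n})) * norm (Y (n + j) v)" for n j v
  define a where "a n j = (\<integral>v. H n j v \<partial>?\<sigma>' j n)" for n j
  define h where "h n j u = (\<integral>s. H n j (simplex_join j s u) \<partial>?\<rho> j u)" for n j u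
  define E where "E n j u = (\<integral>\<^sup>+s. ennreal (D n j (simplex_join j s u)) \<partial>?\<rho> j u)" for n j u

  \<comment> \<open>The coefficients name this dimension \<open>Suc (n + j)\<close>, the join names
    it \<open>j + Suc n\<close>.\<close>
  have idx: "Suc (n + j) = j + Suc n" for n j :: nat by simp
  have Xm [measurable]: "X n \<in> borel_measurable (?\<sigma> n)"
    and Xf: "sq_int (?\<sigma> n) (X n) = ennreal (x n)" for n
    using X(1)[of n] by (auto simp: x_def L2_simplex_sq_int less_top)
  have Ym [measurable]: "Y n \<in> borel_measurable (?\<sigma> n)"
    and Yf: "sq_int (?\<sigma> n) (Y n) = ennreal (y n)" for n
    using Y(1)[of n] by (auto simp: y_def L2_simplex_sq_int less_top)
  have x0: "0 \<le> x n" and y0: "0 \<le> y n" and w0: "0 \<le> w n" and b0: "0 \<le> b n j" for n j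
    using w(2)[of n] w(2)[of j] by (simp_all add: x_def y_def b_def)
  note [measurable] = measurable_tri_factors(1)[OF Am] measurable_tri_factors(2)[OF Am Xm]
  have Yjm [measurable]: "Y (n + j) \<in> borel_measurable (?\<sigma>' j n)" for n j
    using Ym[of "n + j"] by (simp only: idx)
  have Hm [measurable]: "H n j \<in> borel_measurable (?\<sigma>' j n)" for n j
    unfolding H_def[abs_def] tri_def by measurable
  have Dm [measurable]: "D n j \<in> borel_measurable (?\<sigma>' j n)" for n j
    unfolding D_def[abs_def] by measurable
  have HD: "\<bar>H n j v\<bar> \<le> D n j v" for n j v
  proof -
    have "\<bar>H n j v\<bar> \<le> norm (A j (restrict v {..j}) *v X n (restrict (\<lambda>i. v (j + i)) {..n})) * norm (Y (n + j) v)"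
      unfolding H_def tri_def by (rule Cauchy_Schwarz_ineq2)
    also have "\<dots> \<le> D n j v"
      unfolding D_def by (intro mult_right_mono norm_matrix_vector_mult norm_ge_zero)
    finally show ?thesis .
  qed
  have Dbound: "(\<integral>\<^sup>+v. ennreal (D n j v) \<partial>?\<sigma>' j n) \<le> ennreal (b n j)" for n j
  proof -
    \<comment> \<open>The squared product of the factors with \<open>A\<close> and \<open>X\<close>.
      Integrating first over \<open>s\<close> leaves \<open>X n u\<close> fixed and meets only a
      section of \<open>A\<close>, so \<open>wA\<close> gives the factor
      \<open>(w j)\<^sup>2\<close>.\<close>
    define G where "G v = (norm (A j (restrict v {..j})))\<^sup>2 * (norm (X n (restrict (\<lambda>i. v (j + i)) {..n})))\<^sup>2" for v
    have Gm [measurable]: "G \<in> borel_measurable (?\<sigma>' j n)"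
      unfolding G_def[abs_def] by measurable
    have "(\<integral>\<^sup>+v. ennreal (G v) \<partial>?\<sigma>' j n) =
        (\<integral>\<^sup>+u. \<integral>\<^sup>+s. ennreal (G (simplex_join j s u)) \<partial>?\<rho> j u \<partial>?\<sigma> n)"
      by (rule nn_integral_simplex_join) measurable
    also have "\<dots> \<le> (\<integral>\<^sup>+u. ennreal ((w j)\<^sup>2) * ennreal ((norm (X n u))\<^sup>2) \<partial>?\<sigma> n)"
    proof (rule nn_integral_mono_AE)
      show "AE u in ?\<sigma> n. (\<integral>\<^sup>+s. ennreal (G (simplex_join j s u)) \<partial>?\<rho> j u)
          \<le> ennreal ((w j)\<^sup>2) * ennreal ((norm (X n u))\<^sup>2)"
        using AE_simplex_head[OF wA[of j], of n] AE_space
      proof eventually_elim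
        case (elim u)
        have u: "u \<in> ordered_simplex (Suc n) S T" using elim(2) by simp
        then have u0: "u 0 \<in> {S<..<T}" by (auto simp: ordered_simplex_def)
        have Asec: "(\<lambda>s. A j (s(j := u 0))) \<in> borel_measurable (?\<rho> j u)"
          by (rule simplex_last_section[OF u0 Am])
        have "(\<integral>\<^sup>+s. ennreal (G (simplex_join j s u)) \<partial>?\<rho> j u) =
            (\<integral>\<^sup>+s. ennreal ((norm (A j (s(j := u 0))))\<^sup>2) * ennreal ((norm (X n u))\<^sup>2) \<partial>?\<rho> j u)"
          by (intro nn_integral_cong) (simp add: G_def ordered_simplex_joinD[OF u] ennreal_mult)
        also have "\<dots> = (\<integral>\<^sup>+s. ennreal ((norm (A j (s(j := u 0))))\<^sup>2) \<partial>?\<rho> j u) * ennreal ((norm (X n u))\<^sup>2)"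
          using Asec by (intro nn_integral_multc) measurable
        also have "\<dots> \<le> ennreal ((w j)\<^sup>2) * ennreal ((norm (X n u))\<^sup>2)"
          by (intro mult_right_mono elim(1)[unfolded sq_int_def]) simp
        finally show ?case .
      qed
    qed
    also have "\<dots> = ennreal ((w j)\<^sup>2 * x n)"
      using x0 by (subst nn_integral_cmult) (auto simp: Xf[unfolded sq_int_def] ennreal_mult)
    finally have G: "(\<integral>\<^sup>+v. ennreal (G v) \<partial>?\<sigma>' j n) \<le> ennreal ((w j)\<^sup>2 * x n)" .
    have YI: "(\<integral>\<^sup>+v. ennreal ((norm (Y (n + j) v))\<^sup>2) \<partial>?\<sigma>' j n) = ennreal (y (n + j))"
      using Yf[of "n + j"] by (simp only: idx sq_int_def)
    have pw: "D n j v \<le> (1 / w j) * G v + w j * (norm (Y (n + j) v))\<^sup>2" for v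
    proof -
      \<comment> \<open>Young's inequality with weight \<open>w j\<close>, so that the bound on \<open>D\<close> carries a factor \<open>w j\<close> and is summable over both indices.\<close>
      have young: "p * q \<le> (1 / w j) * p\<^sup>2 + w j * q\<^sup>2" if "0 \<le> p" "0 \<le> q" for p q :: real
      proof -
        have "0 \<le> (p - w j * q)\<^sup>2 + w j * p * q" using that w0[of j] by (intro add_nonneg_nonneg) auto
        then have "w j * (p * q) \<le> w j * ((1 / w j) * p\<^sup>2 + w j * q\<^sup>2)"
          using w(2)[of j] by (simp add: power2_eq_square algebra_simps)
        then show ?thesis using w(2)[of j] by simp
      qed
      show ?thesis
        using young[of "norm (A j (restrict v {..j})) * norm (X n (restrict (\<lambda>i. v (j + i)) {..n}))" "norm (Y (n + j) v)"]
        by (simp add: D_def G_def power_mult_distrib)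
    qed
    have "(\<integral>\<^sup>+v. ennreal (D n j v) \<partial>?\<sigma>' j n) \<le>
        (\<integral>\<^sup>+v. ennreal (1 / w j) * ennreal (G v) + ennreal (w j) * ennreal ((norm (Y (n + j) v))\<^sup>2) \<partial>?\<sigma>' j n)"
    proof (rule nn_integral_mono)
      fix v
      have "0 \<le> G v" by (simp add: G_def)
      then show "ennreal (D n j v) \<le> ennreal (1 / w j) * ennreal (G v) + ennreal (w j) * ennreal ((norm (Y (n + j) v))\<^sup>2)"
        using w0[of j] ennreal_leI[OF pw[of v]] ennreal_mult_add[of "1 / w j" "G v" "w j" "(norm (Y (n + j) v))\<^sup>2"] by simp
    qed
    also have "\<dots> = ennreal (1 / w j) * (\<integral>\<^sup>+v. ennreal (G v) \<partial>?\<sigma>' j n) + ennreal (w j) * ennreal (y (n + j))"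
      unfolding YI[symmetric] by (rule nn_integral_linear_combination) measurable
    also have "\<dots> \<le> ennreal (1 / w j) * ennreal ((w j)\<^sup>2 * x n) + ennreal (w j) * ennreal (y (n + j))"
      by (intro add_right_mono mult_left_mono G) simp
    also have "\<dots> = ennreal ((1 / w j) * ((w j)\<^sup>2 * x n) + w j * y (n + j))"
      using w0[of j] x0[of n] y0[of "n + j"] by (intro ennreal_mult_add[symmetric]) auto
    also have "(1 / w j) * ((w j)\<^sup>2 * x n) + w j * y (n + j) = b n j"
      using w(2)[of j] by (simp add: b_def power2_eq_square algebra_simps)
    finally show ?thesis .
  qed
  have Hint: "integrable (?\<sigma>' j n) (H n j)" and ab: "\<bar>a n j\<bar> \<le> b n j" for n j
  proof -
    have *: "(\<integral>\<^sup>+v. ennreal (norm (H n j v)) \<partial>?\<sigma>' j n) \<le> ennreal (b n j)"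
      by (rule order_trans[OF nn_integral_mono Dbound]) (use HD in \<open>auto intro: ennreal_leI\<close>)
    then show i: "integrable (?\<sigma>' j n) (H n j)"
      by (intro integrableI_bounded[OF Hm] le_less_trans[OF *]) simp
    have "ennreal (norm (a n j)) \<le> ennreal (b n j)"
      unfolding a_def by (rule order_trans[OF integral_norm_bound_ennreal[OF i] *])
    then show "\<bar>a n j\<bar> \<le> b n j" using b0 by simp
  qed
  have b_on: "(\<lambda>(n, j). b n j) summable_on UNIV"
    using summable_on_convolution_bound[OF w(1) X(2) Y(2) w0] by (simp add: b_def x_def y_def)
  have diag: "(\<integral>v. P N v \<bullet> Y N v \<partial>?\<sigma> N) = (\<Sum>k\<le>N. a k (N - k))" for N
  proof -
    \<comment> \<open>Here \<open>k\<close> is the order of \<open>X\<close> and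
      \<open>N - k\<close> that of \<open>A\<close>; for \<open>k \<le> N\<close> the dimension
      \<open>(N - k) + Suc k\<close> is \<open>Suc N\<close>.\<close>
    have i: "integrable (?\<sigma> N) (H k (N - k))" if "k \<le> N" for k
      using Hint[of "N - k" k] that by simp
    have "(\<integral>v. P N v \<bullet> Y N v \<partial>?\<sigma> N) = (\<integral>v. (\<Sum>k\<le>N. H k (N - k) v) \<partial>?\<sigma> N)"
    proof (rule integral_cong_AE)
      show "AE v in ?\<sigma> N. P N v \<bullet> Y N v = (\<Sum>k\<le>N. H k (N - k) v)"
        using P(2)[of N] by eventually_elim (auto simp: H_def inner_sum_left intro!: sum.cong)
    qed (use P(1) i in \<open>auto intro!: borel_measurable_sum borel_measurable_integrable\<close>)
    also have "\<dots> = (\<Sum>k\<le>N. \<integral>v. H k (N - k) v \<partial>?\<sigma> N)"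
      using i by (intro Bochner_Integration.integral_sum) auto
    also have "\<dots> = (\<Sum>k\<le>N. a k (N - k))"
      by (intro sum.cong refl) (simp add: a_def)
    finally show ?thesis .
  qed
  have diag_sums: "(\<lambda>N. \<Sum>k\<le>N. a k (N - k)) sums s" using s unfolding diag .
  note rows = sums_diagonals_eq_rows[OF b_on ab diag_sums]
  have "(\<integral>u. X n u \<bullet> Q n u \<partial>?\<sigma> n) = (\<Sum>j. a n j)" for n
  proof -
    have Em [measurable]: "E n j \<in> borel_measurable (?\<sigma> n)" for j
      unfolding E_def[abs_def] by (rule nn_integral_simplex_join_measurable) measurable
    have EI: "(\<integral>\<^sup>+u. E n j u \<partial>?\<sigma> n) \<le> ennreal (b n j)" for j
    proof -
      have "(\<lambda>v. ennreal (D n j v)) \<in> borel_measurable (?\<sigma>' j n)" by measurable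
      from nn_integral_simplex_join[OF this] Dbound[of j n] show ?thesis
        unfolding E_def by (simp only:)
    qed
    \<comment> \<open>Tonelli for the dominating functions: row \<open>n\<close> of \<open>b\<close>
      is summable, so the sum of all \<open>E n j u\<close> over \<open>j\<close> is finite for
      almost every \<open>u\<close>. At such points the integrals and series below converge
      absolutely.\<close>
    have "(\<integral>\<^sup>+u. (\<Sum>j. E n j u) \<partial>?\<sigma> n) = (\<Sum>j. \<integral>\<^sup>+u. E n j u \<partial>?\<sigma> n)"
      by (rule nn_integral_suminf) measurable
    also have "\<dots> \<le> (\<Sum>j. ennreal (b n j))" by (intro suminf_le EI) auto
    also have "\<dots> = ennreal (\<Sum>j. b n j)" using b0 rows(2)[of n] by (intro suminf_ennreal2) auto
    finally have "(\<integral>\<^sup>+u. (\<Sum>j. E n j u) \<partial>?\<sigma> n) \<noteq> \<infinity>" by (auto simp: top_unique)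
    then have E_fin: "AE u in ?\<sigma> n. (\<Sum>j. E n j u) \<noteq> \<infinity>"
      by (intro nn_integral_PInf_AE) measurable
    have hE: "ennreal \<bar>h n j u\<bar> \<le> E n j u" if "u \<in> ordered_simplex (Suc n) S T" "E n j u < \<infinity>" for j u
    proof -
      have m: "(\<lambda>s. H n j (simplex_join j s u)) \<in> borel_measurable (?\<rho> j u)"
        by (rule simplex_join_section[OF that(1) Hm])
      have *: "(\<integral>\<^sup>+s. ennreal (norm (H n j (simplex_join j s u))) \<partial>?\<rho> j u) \<le> E n j u"
        unfolding E_def by (intro nn_integral_mono ennreal_leI) (use HD in auto)
      then have "integrable (?\<rho> j u) (\<lambda>s. H n j (simplex_join j s u))"
        using that(2) m by (intro integrableI_bounded) (auto intro: le_less_trans)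
      from order_trans[OF integral_norm_bound_ennreal[OF this] *] show ?thesis by (simp add: h_def)
    qed
    have h_int: "integrable (?\<sigma> n) (h n j)" and a_h: "a n j = (\<integral>u. h n j u \<partial>?\<sigma> n)" for j
      using integrable_simplex_join[OF Hint[of j n]] integral_simplex_join[OF Hint[of j n]]
      by (simp_all add: h_def[abs_def] a_def)
    have good: "AE u in ?\<sigma> n. u \<in> ordered_simplex (Suc n) S T \<and> (\<Sum>j. E n j u) < \<infinity> \<and> (\<forall>j. E n j u < \<infinity>)"
      using E_fin AE_space
    proof eventually_elim
      case (elim u)
      then have "(\<Sum>j. E n j u) < \<infinity>" by (simp add: less_top)
      then show ?case using ennreal_suminf_lessD[of "\<lambda>j. E n j u" \<infinity>] elim by auto
    qed
    have h_sum: "AE u in ?\<sigma> n. summable (\<lambda>j. norm (h n j u))"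
      using good
    proof eventually_elim
      case (elim u)
      then show ?case using suminf_ennreal_finite_imp[of "\<lambda>j. E n j u" "\<lambda>j. h n j u"] hE[of u] by simp
    qed
    \<comment> \<open>Together with \<open>h_sum\<close> this is the hypothesis for integrating the
      series of the \<open>h n j\<close> term by term.\<close>
    have h_norm: "summable (\<lambda>j. \<integral>u. norm (h n j u) \<partial>?\<sigma> n)"
    proof (rule summable_comparison_test'[where N=0, OF rows(2)[of n]])
      fix j
      have "ennreal (\<integral>u. norm (h n j u) \<partial>?\<sigma> n) = (\<integral>\<^sup>+u. ennreal (norm (h n j u)) \<partial>?\<sigma> n)"
        using h_int[of j] by (intro nn_integral_eq_integral[symmetric]) auto
      also have "\<dots> \<le> (\<integral>\<^sup>+u. E n j u \<partial>?\<sigma> n)"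
      proof (rule nn_integral_mono_AE)
        show "AE u in ?\<sigma> n. ennreal (norm (h n j u)) \<le> E n j u"
          using good by eventually_elim (use hE in simp)
      qed
      also note EI[of j]
      finally show "norm (\<integral>u. norm (h n j u) \<partial>?\<sigma> n) \<le> b n j" using b0 by (simp add: integral_nonneg_AE)
    qed
    \<comment> \<open>The kernels are transposes of each other only off a null set of each simplex.
      Cutting at the last coordinate and lifting to \<open>u 0\<close> gives this for almost every
      \<open>s\<close>; there are countably many \<open>j\<close>, so one exceptional set of
      \<open>u\<close> serves all of them.\<close>
    have AB': "AE u in ?\<sigma> n. \<forall>j. AE s in ?\<rho> j u. B j (s(j := u 0)) = transpose (A j (s(j := u 0)))"
      unfolding AE_all_countable
      by (intro allI AE_simplex_head[where P="\<lambda>t. AE s in simplex_measure j t T. B j (s(j := t)) = transpose (A j (s(j := t)))" for j]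
        AE_simplex_last AB)
    have "AE u in ?\<sigma> n. X n u \<bullet> Q n u = (\<Sum>j. h n j u)"
      using good Q(2)[of n] AB'
    proof eventually_elim
      case (elim u)
      have u: "u \<in> ordered_simplex (Suc n) S T" and Esum: "(\<Sum>j. E n j u) < \<infinity>" and Ej: "\<And>j. E n j u < \<infinity>"
        using elim(1) by auto
      have u0: "u 0 \<in> {S<..<T}" using u by (auto simp: ordered_simplex_def)
      define g where "g j s = B j (s(j := u 0)) *v Y (n + j) (simplex_join j s u)" for j s
      have gm [measurable]: "g j \<in> borel_measurable (?\<rho> j u)" for j
        unfolding g_def[abs_def]
        by (intro borel_measurable_matrix_vector_mult simplex_last_section[OF u0 Bm] simplex_join_section[OF u Yjm])
      have Hg: "AE s in ?\<rho> j u. H n j (simplex_join j s u) = X n u \<bullet> g j s" for j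
        using spec[OF elim(3), of j] AE_space
        by eventually_elim
          (simp add: H_def tri_def g_def ordered_simplex_joinD[OF u] inner_transpose_matrix_vector del: transpose_matrix_vector)
      show ?case
        \<comment> \<open>Where \<open>X n u = 0\<close>, the series defining \<open>Q n u\<close> may diverge.\<close>
      proof (cases "X n u = 0")
        case True
        have "h n j u = 0" for j
        proof -
          have "h n j u = (\<integral>s. 0 \<partial>?\<rho> j u)"
            unfolding h_def by (intro Bochner_Integration.integral_cong refl)
              (simp add: H_def tri_def ordered_simplex_joinD[OF u] True)
          then show ?thesis by simp
        qed
        then show ?thesis using True by simp
      next
        case False
        \<comment> \<open>Dividing \<open>D\<close> by the norm of \<open>X n u\<close> bounds the
          integrand \<open>g\<close> of the backward product, which does not contain
          \<open>X\<close>.\<close>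
        define c where "c = 1 / norm (X n u)"
        have c: "0 < c" using False by (simp add: c_def)
        have gE: "(\<integral>\<^sup>+s. ennreal (norm (g j s)) \<partial>?\<rho> j u) \<le> ennreal c * E n j u" for j
        proof -
          have "(\<integral>\<^sup>+s. ennreal (norm (g j s)) \<partial>?\<rho> j u) \<le>
              (\<integral>\<^sup>+s. ennreal c * ennreal (D n j (simplex_join j s u)) \<partial>?\<rho> j u)"
          proof (rule nn_integral_mono_AE)
            show "AE s in ?\<rho> j u. ennreal (norm (g j s)) \<le> ennreal c * ennreal (D n j (simplex_join j s u))"
              using spec[OF elim(3), of j] AE_space
            proof eventually_elim
              case (elim s)
              have "norm (g j s) \<le> norm (A j (s(j := u 0))) * norm (Y (n + j) (simplex_join j s u))"
                using norm_matrix_vector_mult[of "B j (s(j := u 0))" "Y (n + j) (simplex_join j s u)"] elim(1)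
                unfolding g_def by (simp only: norm_transpose)
              also have "\<dots> = c * D n j (simplex_join j s u)"
                using False elim(2) by (simp add: D_def c_def ordered_simplex_joinD[OF u])
              finally show ?case using c by (simp add: ennreal_mult'[symmetric] ennreal_leI)
            qed
          qed
          also have "\<dots> = ennreal c * E n j u"
            unfolding E_def
            by (intro nn_integral_cmult measurable_compose[OF _ measurable_ennreal] simplex_join_section[OF u Dm])
          finally show ?thesis .
        qed
        have gi: "integrable (?\<rho> j u) (g j)" for j
          using gE[of j] Ej[of j]
          by (intro integrableI_bounded) (auto simp: ennreal_mult_less_top intro: le_less_trans)
        have hj: "h n j u = X n u \<bullet> (\<integral>s. g j s \<partial>?\<rho> j u)" for j
        proof -
          have "h n j u = (\<integral>s. X n u \<bullet> g j s \<partial>?\<rho> j u)"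
            unfolding h_def using Hg[of j] simplex_join_section[OF u Hm[of n j]]
            by (intro integral_cong_AE) auto
          then show ?thesis using gi by simp
        qed
        \<comment> \<open>Absolute convergence of the vector series defining \<open>Q n u\<close>;
          only then may the inner product with \<open>X n u\<close> be taken inside the sum.\<close>
        have "(\<Sum>j. ennreal c * E n j u) < \<infinity>"
          using Esum by (simp add: ennreal_mult_less_top)
        then have "summable (\<lambda>j. \<bar>norm (\<integral>s. g j s \<partial>?\<rho> j u)\<bar>)"
          by (rule suminf_ennreal_finite_imp)
            (unfold abs_norm_cancel, rule order_trans[OF integral_norm_bound_ennreal[OF gi] gE])
        then have "summable (\<lambda>j. \<integral>s. g j s \<partial>?\<rho> j u)"
          unfolding abs_norm_cancel by (rule summable_norm_cancel)
        from bounded_linear.suminf[OF bounded_linear_inner_right this, of "X n u"]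
        show ?thesis using elim(2) by (simp add: hj g_def)
      qed
    qed
    then have "(\<integral>u. X n u \<bullet> Q n u \<partial>?\<sigma> n) = (\<integral>u. (\<Sum>j. h n j u) \<partial>?\<sigma> n)"
      using Xm Q(1)[of n] integrable_suminf[OF h_int h_sum h_norm]
      by (intro integral_cong_AE) auto
    also have "\<dots> = (\<Sum>j. a n j)"
      unfolding a_h by (rule integral_suminf[OF h_int h_sum h_norm])
    finally show ?thesis .
  qed
  then show ?thesis using rows(1) by simp
qed

context brownian begin

lemma chaos_coefficient_L2: "chaos M W S T \<xi> F \<Longrightarrow> F n \<in> L2_simplex (Suc n) S T"
  unfolding chaos_def by blast

lemma chaos_coefficient_measurable:
  "chaos M W S T \<xi> F \<Longrightarrow> F n \<in> borel_measurable (simplex_measure (Suc n) S T)"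
  by (drule chaos_coefficient_L2[where n=n]) (simp add: L2_simplex_def)

lemma summable_chaos_coefficients:
  assumes S: "0 \<le> S" and F: "chaos M W S T \<xi> F"
  shows "summable (\<lambda>n. enn2real (sq_int (simplex_measure (Suc n) S T) (F n)))"
proof -
  have "enn2real (sq_int (simplex_measure (Suc n) S T) (F n)) = (\<integral>x. F n x \<bullet> F n x \<partial>simplex_measure (Suc n) S T)" for n
  proof -
    have "sq_int (simplex_measure (Suc n) S T) (F n) = ennreal (\<integral>x. F n x \<bullet> F n x \<partial>simplex_measure (Suc n) S T)"
      using chaos_coefficient_L2[OF F, of n] by (intro integral_inner_self[symmetric]) (auto simp: L2_simplex_sq_int)
    then show ?thesis by (simp add: integral_nonneg_AE)
  qed
  then show ?thesis using chaos_parseval[OF S F F] by (simp add: sums_iff)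
qed

text \<open>Uniqueness of coefficients transfers the norm bound from \<open>F\<close> to
  \<open>A\<close> and shows that \<open>B\<close> consists of the transposes of \<open>A\<close>.
  After \<open>star_adjoint\<close>, the same series sums to both inner products by
  Parseval.\<close>

lemma star_duality:
  fixes K :: "real \<Rightarrow> 'w \<Rightarrow> real ^ 'd::finite ^ 'd" and X Y KX KY :: "real \<Rightarrow> 'w \<Rightarrow> real ^ 'd"
  assumes S: "0 \<le> S" and K: "K \<in> star_kernels M W S T"
    and KX: "star_prod (*v) M W S T K X KX"
    and KY: "back_star_prod (*v) M W S T (\<lambda>t \<omega>. transpose (K t \<omega>)) Y KY"
  shows "process_inner S T KX Y = process_inner S T X KY"
proof -
  obtain F where F: "chaos M W S T K F" "(\<Sum>n. V_norm n S T (F n)) < \<infinity>"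
    using K by (auto simp: star_kernels_def)
  obtain A FX P where A: "chaos M W S T K A" and FX: "chaos M W S T X FX" and P: "chaos M W S T KX P"
    and P_eq: "\<And>n. AE t in simplex_measure (Suc n) S T. P n t = (\<Sum>k\<le>n. tri (*v) (n - k) k (A (n - k)) (FX k) t)"
    using KX unfolding star_prod_def by blast
  obtain B FY Q where B: "chaos M W S T (\<lambda>t \<omega>. transpose (K t \<omega>)) B" and FY: "chaos M W S T Y FY"
    and Q: "chaos M W S T KY Q"
    and Q_eq: "\<And>n. AE t in simplex_measure (Suc n) S T. Q n t = (\<Sum>j. (LINT s|simplex_measure j (t 0) T.
              B j (s(j := t 0)) *v FY (n + j) (\<lambda>i. if i < j then s i else t (i - j))))"
    using KY unfolding back_star_prod_def by blast
  note m = chaos_coefficient_measurable and L2 = chaos_coefficient_L2 and sm = summable_chaos_coefficients[OF S]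
  obtain w where w: "summable w" "\<And>j. 0 < w j"
    "\<And>j. AE t in interval_measure S T.
       sq_int (simplex_measure j t T) (\<lambda>s. A j (s(j := t))) \<le> ennreal ((w j)\<^sup>2)"
    using star_kernel_section_bound[OF m[OF F(1)] F(2) chaos_unique[OF S A F(1)]] by blast
  have AB: "AE v in simplex_measure (Suc n) S T. B n v = transpose (A n v)" for n
    using chaos_unique[OF S B chaos_isometric_image[OF linear_transpose norm_transpose A]] .
  have "(\<lambda>n. \<integral>u. FX n u \<bullet> Q n u \<partial>simplex_measure (Suc n) S T) sums process_inner S T KX Y"
    by (rule star_adjoint[OF m[OF A] m[OF B] AB w L2[OF FX] sm[OF FX] L2[OF FY] sm[OF FY] m[OF P] P_eq m[OF Q]
        Q_eq[folded simplex_join_def] chaos_parseval[OF S P FY]])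
  then show ?thesis using chaos_parseval[OF S FX Q] by (rule sums_unique2)
qed

end


section \<open>Adjointness of the asterisk products\<close>

text \<open>Presents \<open>process_measure\<close> and \<open>field_measure\<close> as restrictions
  of full products over \<open>lborel\<close>, so that integrands can be extended by zero and
  integrated in any order.\<close>

lemma restrict_space_pair_measure:
  assumes A: "sigma_finite_measure A" and B: "sigma_finite_measure B" and \<Omega> [measurable]: "\<Omega> \<in> sets A"
  shows "restrict_space A \<Omega> \<Otimes>\<^sub>M B = restrict_space (A \<Otimes>\<^sub>M B) (\<Omega> \<times> space B)"
proof (rule pair_measure_eqI)
  interpret B: sigma_finite_measure B by fact
  show "sigma_finite_measure (restrict_space A \<Omega>)"
    by (rule sigma_finite_measure_restrict_space[OF A \<Omega>])
  show "sigma_finite_measure B" by fact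
  have \<Omega>A: "\<Omega> \<subseteq> space A" using sets.sets_into_space[OF \<Omega>] .
  let ?L = "restrict_space A \<Omega> \<Otimes>\<^sub>M B" and ?R = "restrict_space (A \<Otimes>\<^sub>M B) (\<Omega> \<times> space B)"
  have sp: "space ?L = \<Omega> \<times> space B" "space ?R = \<Omega> \<times> space B"
    using \<Omega>A by (auto simp: space_restrict_space space_pair_measure)
  have 1: "(\<lambda>p. (fst p, snd p)) \<in> measurable ?R ?L"
  proof (rule measurable_Pair)
    show "fst \<in> measurable ?R (restrict_space A \<Omega>)"
      using measurable_restrict_space1[OF measurable_fst] sp by (intro measurable_restrict_space2) auto
    show "snd \<in> measurable ?R B" by (intro measurable_restrict_space1 measurable_snd)
  qed
  have fst: "fst \<in> measurable ?L A"
    by (rule measurable_compose[OF measurable_fst]) (simp add: measurable_restrict_space1)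
  have 2: "(\<lambda>p. (fst p, snd p)) \<in> measurable ?L ?R"
    using sp by (intro measurable_restrict_space2 measurable_Pair fst measurable_snd) auto
  show "sets ?L = sets ?R"
  proof (intro subset_antisym subsetI)
    fix X assume X: "X \<in> sets ?L"
    from measurable_sets[OF 1 X] sets.sets_into_space[OF X] sp show "X \<in> sets ?R" by (simp add: Int_absorb2 vimage_def)
  next
    fix X assume X: "X \<in> sets ?R"
    from measurable_sets[OF 2 X] sets.sets_into_space[OF X] sp show "X \<in> sets ?L" by (simp add: Int_absorb2 vimage_def)
  qed
  fix X Y assume X: "X \<in> sets (restrict_space A \<Omega>)" and Y: "Y \<in> sets B"
  then have XA: "X \<in> sets A" "X \<subseteq> \<Omega>" by (auto simp: sets_restrict_space)
  have "emeasure ?R (X \<times> Y) = emeasure (A \<Otimes>\<^sub>M B) (X \<times> Y)"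
    using XA sets.sets_into_space[OF Y] by (intro emeasure_restrict_space) auto
  also have "\<dots> = emeasure A X * emeasure B Y" using XA Y by (intro B.emeasure_pair_measure_Times)
  also have "emeasure A X = emeasure (restrict_space A \<Omega>) X"
    using XA by (intro emeasure_restrict_space[symmetric]) auto
  finally show "emeasure (restrict_space A \<Omega>) X * emeasure B Y = emeasure ?R (X \<times> Y)" by simp
qed

text \<open>A lossy arithmetic-geometric mean inequality, from
  \<open>p * q \<le> (p + q)\<^sup>2\<close>. It turns a Cauchy-Schwarz bound into a sum without
  taking square roots in \<open>ennreal\<close>.\<close>

lemma ennreal_le_sum_of_power2_le_mult:
  assumes "a\<^sup>2 \<le> p * (q :: ennreal)" shows "a \<le> p + q"
proof (cases "p + q = \<infinity>")
  case False
  then obtain p' q' where pq: "p = ennreal p'" "q = ennreal q'" "0 \<le> p'" "0 \<le> q'"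
    by (metis ennreal_add_eq_top ennreal_cases infinity_ennreal_def)
  have "a \<noteq> \<infinity>"
    using assms pq by (auto simp: ennreal_mult[symmetric] top_unique power2_eq_square)
  then obtain a' where a: "a = ennreal a'" "0 \<le> a'" by (cases a) auto
  have "a'\<^sup>2 \<le> p' * q'"
    using assms a pq by (simp add: ennreal_power ennreal_mult[symmetric])
  also have "\<dots> \<le> p' * q' + (p'\<^sup>2 + q'\<^sup>2 + p' * q')" using pq(3,4) by simp
  also have "\<dots> = (p' + q')\<^sup>2" by (simp add: power2_eq_square algebra_simps)
  finally have "a' \<le> p' + q'" by (rule power2_le_imp_le) (use pq(3,4) in simp)
  then have "ennreal a' \<le> ennreal (p' + q')" by (rule ennreal_leI)
  then show ?thesis unfolding a(1) pq(1,2) ennreal_plus[OF pq(3,4)] .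
qed auto

text \<open>If \<open>c = 0\<close>, then \<open>v\<close> need not be integrable; its integral is then the junk value \<open>0\<close>.\<close>

lemma integral_inner_const:
  fixes v :: "'a \<Rightarrow> 'v::euclidean_space"
  assumes "v \<in> borel_measurable N" "integrable N g" "\<And>x. x \<in> space N \<Longrightarrow> norm (v x) * norm c \<le> g x"
  shows "(\<integral>x. v x \<partial>N) \<bullet> c = (\<integral>x. v x \<bullet> c \<partial>N)"
proof (cases "c = 0")
  case False
  have "integrable N (\<lambda>x. g x / norm c)" using assms(2) by simp
  then have "integrable N v"
    by (rule Bochner_Integration.integrable_bound[OF _ assms(1)])
      (use assms(3) False in \<open>auto simp: pos_le_divide_eq intro: order_trans[OF _ abs_ge_self]\<close>)
  then show ?thesis by simp
qed simp

lemma triangle_sets: "triangle S T \<in> sets (lborel \<Otimes>\<^sub>M lborel)"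
proof -
  have "triangle S T = {p \<in> space (lborel \<Otimes>\<^sub>M lborel). S < snd p \<and> snd p < fst p \<and> fst p < T}"
    by (auto simp: triangle_def space_pair_measure)
  also have "\<dots> \<in> sets (lborel \<Otimes>\<^sub>M lborel)" by measurable
  finally show ?thesis .
qed

context brownian begin

lemma process_measure_restrict: "process_measure M S T = restrict_space (lborel \<Otimes>\<^sub>M M) ({S<..<T} \<times> space M)"
  unfolding process_measure_def
  by (rule restrict_space_pair_measure) (auto simp: sigma_finite_lborel sigma_finite_measure_axioms)

lemma field_measure_restrict:
  "field_measure M S T = restrict_space ((lborel \<Otimes>\<^sub>M lborel) \<Otimes>\<^sub>M M) (triangle S T \<times> space M)"
proof -
  have "sigma_finite_measure (lborel \<Otimes>\<^sub>M lborel :: (real \<times> real) measure)"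
    unfolding lborel_prod by (rule sigma_finite_lborel)
  then show ?thesis
    unfolding field_measure_def
    by (rule restrict_space_pair_measure[OF _ sigma_finite_measure_axioms triangle_sets])
qed

lemma process_extension_measurable:
  fixes Z :: "real \<Rightarrow> 'w \<Rightarrow> 'v::euclidean_space"
  assumes "case_prod Z \<in> borel_measurable (process_measure M S T)"
  shows "(\<lambda>p. indicator {S<..<T} (fst p) *\<^sub>R Z (fst p) (snd p)) \<in> borel_measurable (lborel \<Otimes>\<^sub>M M)"
proof -
  have "(\<lambda>p. indicator ({S<..<T} \<times> space M) p *\<^sub>R (case p of (t, \<omega>) \<Rightarrow> Z t \<omega>)) \<in> borel_measurable (lborel \<Otimes>\<^sub>M M)"
    using assms unfolding process_measure_restrict by (subst (asm) borel_measurable_restrict_space_iff) auto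
  then show ?thesis
    by (rule measurable_cong[THEN iffD1, rotated]) (auto simp: space_pair_measure indicator_def)
qed

lemma process_extension_sq_int:
  fixes Z :: "real \<Rightarrow> 'w \<Rightarrow> 'v::euclidean_space"
  assumes Z: "case_prod Z \<in> borel_measurable (process_measure M S T)"
  shows "(\<integral>\<^sup>+t. sq_int M (\<lambda>\<omega>. indicator {S<..<T} t *\<^sub>R Z t \<omega>) \<partial>lborel) = sqnorm M S T Z"
proof -
  let ?f = "\<lambda>p. ennreal ((norm (indicator {S<..<T} (fst p) *\<^sub>R Z (fst p) (snd p)))\<^sup>2)"
  have m: "?f \<in> borel_measurable (lborel \<Otimes>\<^sub>M M)"
    using process_extension_measurable[OF Z] by measurable
  have "sqnorm M S T Z = (\<integral>\<^sup>+p. ennreal ((norm (Z (fst p) (snd p)))\<^sup>2) * indicator ({S<..<T} \<times> space M) p \<partial>(lborel \<Otimes>\<^sub>M M))"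
    unfolding sqnorm_def process_measure_restrict case_prod_unfold
    by (rule nn_integral_restrict_space) simp
  also have "\<dots> = (\<integral>\<^sup>+p. ?f p \<partial>(lborel \<Otimes>\<^sub>M M))"
    by (intro nn_integral_cong) (auto simp: space_pair_measure indicator_def)
  also have "\<dots> = (\<integral>\<^sup>+t. sq_int M (\<lambda>\<omega>. indicator {S<..<T} t *\<^sub>R Z t \<omega>) \<partial>lborel)"
    unfolding sq_int_def by (subst nn_integral_fst[OF m, symmetric]) (simp only: fst_conv snd_conv)
  finally show ?thesis by simp
qed

text \<open>The forward side is represented by \<open>k\<close> because \<open>ast_prod\<close> is a
  pointwise Bochner integral, for which neither measurability nor existence is given in advance. Its
  product with \<open>Y\<close> is replaced by an integrable function equal to it almost
  everywhere.\<close>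

lemma ast_duality:
  fixes J :: "real \<Rightarrow> real \<Rightarrow> 'w \<Rightarrow> real ^ 'd::finite ^ 'd" and X Y JY :: "real \<Rightarrow> 'w \<Rightarrow> real ^ 'd"
  assumes S: "0 \<le> S" and J: "J \<in> L2_F_ast M W S T" and X: "X \<in> L2_F M W S T" and Y: "Y \<in> L2_F M W S T"
    and JY: "back_ast_prod (*v) M W S T (\<lambda>t s \<omega>. transpose (J t s \<omega>)) Y JY"
  obtains k where "integrable (process_measure M S T) k"
    "AE (t, \<omega>) in process_measure M S T. ast_prod (*v) S J X t \<omega> \<bullet> Y t \<omega> = k (t, \<omega>)"
    "(\<integral>p. k p \<partial>process_measure M S T) = process_inner S T X JY"
proof -
  let ?P = "(lborel :: real measure) \<Otimes>\<^sub>M M"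
  interpret BM: pair_sigma_finite "lborel :: real measure" M ..
  interpret MB: pair_sigma_finite M "lborel :: real measure" ..
  interpret PB: pair_sigma_finite "(lborel :: real measure) \<Otimes>\<^sub>M M" "lborel :: real measure"
    unfolding pair_sigma_finite_def by (intro conjI BM.P.sigma_finite_measure_axioms sigma_finite_lborel)
  note DX = L2_FD[OF X S] and DY = L2_FD[OF Y S]
  have JYL: "JY \<in> L2_F M W S T" using JY by (simp add: back_ast_prod_def)
  note DJY = L2_FD[OF JYL S]

  \<comment> \<open>Extension by zero makes all integrals run over the whole line, so the triangular
    constraint on (t, s) no longer depends on the order of integration.\<close>
  define J0 where "J0 t s \<omega> = indicator (triangle S T) (t, s) *\<^sub>R J t s \<omega>" for t s \<omega>
  define X0 where "X0 t \<omega> = indicator {S<..<T} t *\<^sub>R X t \<omega>" for t \<omega>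
  define Y0 where "Y0 t \<omega> = indicator {S<..<T} t *\<^sub>R Y t \<omega>" for t \<omega>

  have X0m: "(\<lambda>p. X0 (fst p) (snd p)) \<in> borel_measurable ?P" and Y0m: "(\<lambda>p. Y0 (fst p) (snd p)) \<in> borel_measurable ?P"
    using process_extension_measurable[OF DX(1)] process_extension_measurable[OF DY(1)] by (simp_all add: X0_def Y0_def)
  have J0m: "(\<lambda>p. J0 (fst (fst p)) (snd (fst p)) (snd p)) \<in> borel_measurable ((lborel \<Otimes>\<^sub>M lborel) \<Otimes>\<^sub>M M)"
  proof -
    have J: "(\<lambda>((t, s), \<omega>). J t s \<omega>) \<in> borel_measurable (field_measure M S T)"
      using J by (simp add: L2_F_ast_def)
    have T: "triangle S T \<times> space M \<inter> space ((lborel \<Otimes>\<^sub>M lborel) \<Otimes>\<^sub>M M) \<in> sets ((lborel \<Otimes>\<^sub>M lborel) \<Otimes>\<^sub>M M)"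
      by (intro sets.Int pair_measureI triangle_sets sets.top)
    show ?thesis
      by (rule measurable_cong[THEN iffD1, OF _ borel_measurable_restrict_space_iff[OF T, THEN iffD1, OF J[unfolded field_measure_restrict]]])
        (auto simp: J0_def space_pair_measure indicator_def)
  qed
  have Xc [measurable (raw)]: "(\<lambda>x. X0 (f x) (g x)) \<in> borel_measurable N"
    if "f \<in> borel_measurable N" "g \<in> measurable N M" for N :: "'n measure" and f g
    using measurable_compose[OF measurable_Pair X0m, of f N g] that by simp
  have Yc [measurable (raw)]: "(\<lambda>x. Y0 (f x) (g x)) \<in> borel_measurable N"
    if "f \<in> borel_measurable N" "g \<in> measurable N M" for N :: "'n measure" and f g
    using measurable_compose[OF measurable_Pair Y0m, of f N g] that by simp
  have Jc [measurable (raw)]: "(\<lambda>x. J0 (f x) (h x) (g x)) \<in> borel_measurable N"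
    if "f \<in> borel_measurable N" "h \<in> borel_measurable N" "g \<in> measurable N M" for N :: "'n measure" and f g h
    using measurable_compose[OF measurable_Pair[OF measurable_Pair] J0m, of f N h g] that by simp

  define h where "h t s \<omega> = (J0 t s \<omega> *v X0 s \<omega>) \<bullet> Y0 t \<omega>" for t s \<omega>
  define V where "V t s \<omega> = norm (J0 t s \<omega>) * norm (X0 s \<omega>) * norm (Y0 t \<omega>)" for t s \<omega>
  have V0: "0 \<le> V t s \<omega>" for t s \<omega> by (simp add: V_def)
  have hV: "\<bar>h t s \<omega>\<bar> \<le> V t s \<omega>" for t s \<omega>
  proof -
    have "\<bar>h t s \<omega>\<bar> \<le> norm (J0 t s \<omega> *v X0 s \<omega>) * norm (Y0 t \<omega>)"
      unfolding h_def by (rule Cauchy_Schwarz_ineq2)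
    also have "\<dots> \<le> V t s \<omega>"
      unfolding V_def by (intro mult_right_mono norm_matrix_vector_mult norm_ge_zero)
    finally show ?thesis .
  qed

  define jj where "jj t s = sq_int M (J0 t s)" for t s
  define xx where "xx s = sq_int M (X0 s)" for s
  define yy where "yy t = sq_int M (Y0 t)" for t
  have jjm [measurable]: "(\<lambda>p. jj (fst p) (snd p)) \<in> borel_measurable (lborel \<Otimes>\<^sub>M lborel)"
    unfolding jj_def sq_int_def by measurable
  have xxm [measurable]: "xx \<in> borel_measurable lborel" and yym [measurable]: "yy \<in> borel_measurable lborel"
    unfolding xx_def[abs_def] yy_def[abs_def] sq_int_def by measurable
  have xx_fin: "(\<integral>\<^sup>+s. xx s \<partial>lborel) < \<infinity>" and yy_fin: "(\<integral>\<^sup>+t. yy t \<partial>lborel) < \<infinity>"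
    using process_extension_sq_int[OF DX(1)] process_extension_sq_int[OF DY(1)] DX(2) DY(2) by (simp_all add: xx_def yy_def X0_def[abs_def] Y0_def[abs_def])
  have jj_fin: "(\<integral>\<^sup>+t. \<integral>\<^sup>+s. jj t s \<partial>lborel \<partial>lborel) < \<infinity>"
  proof -
    have "field_sqnorm M S T J = (\<integral>\<^sup>+p. ennreal ((norm (J (fst (fst p)) (snd (fst p)) (snd p)))\<^sup>2) * indicator (triangle S T \<times> space M) p \<partial>((lborel \<Otimes>\<^sub>M lborel) \<Otimes>\<^sub>M M))"
      unfolding field_sqnorm_def field_measure_restrict case_prod_unfold
      using triangle_sets by (intro nn_integral_restrict_space) simp
    also have "\<dots> = (\<integral>\<^sup>+p. ennreal ((norm (J0 (fst (fst p)) (snd (fst p)) (snd p)))\<^sup>2) \<partial>((lborel \<Otimes>\<^sub>M lborel) \<Otimes>\<^sub>M M))"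
      by (intro nn_integral_cong) (auto simp: space_pair_measure indicator_def J0_def)
    also have "\<dots> = (\<integral>\<^sup>+p. jj (fst p) (snd p) \<partial>(lborel \<Otimes>\<^sub>M lborel))"
      unfolding jj_def sq_int_def using J0m by (subst nn_integral_fst[symmetric]) auto
    also have "\<dots> = (\<integral>\<^sup>+t. \<integral>\<^sup>+s. jj t s \<partial>lborel \<partial>lborel)"
      by (subst lborel.nn_integral_fst[symmetric]) auto
    finally show ?thesis using J by (simp add: L2_F_ast_def)
  qed

  \<comment> \<open>\<open>J t s\<close> is measurable for increments after \<open>s\<close> and
    \<open>X s\<close> for those up to \<open>s\<close>, so second moments multiply. Off the
    triangle both sides vanish, so the identity holds for all times.\<close>
  have ind: "(\<integral>\<^sup>+\<omega>. ennreal ((norm (J0 t s \<omega>) * norm (X0 s \<omega>))\<^sup>2) \<partial>M) = jj t s * xx s" for t s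
  proof (cases "(t, s) \<in> triangle S T")
    case True
    then have st: "S < s" "s < t" "t < T" by (auto simp: triangle_def)
    have Jf: "J t s \<in> borel_measurable (filt M W s t)" using J True by (auto simp: L2_F_ast_def)
    have Xf: "X s \<in> borel_measurable (filt M W S s)" using DX(3)[of s] st by simp
    have "(\<integral>\<^sup>+\<omega>. ennreal ((norm (J0 t s \<omega>) * norm (X0 s \<omega>))\<^sup>2) \<partial>M) =
        (\<integral>\<^sup>+\<omega>. ennreal ((norm (X s \<omega>))\<^sup>2) * ennreal ((norm (J t s \<omega>))\<^sup>2) \<partial>M)"
      using True st by (intro nn_integral_cong) (simp add: J0_def X0_def power_mult_distrib ennreal_mult mult.commute)
    also have "\<dots> = (\<integral>\<^sup>+\<omega>. ennreal ((norm (X s \<omega>))\<^sup>2) \<partial>M) * (\<integral>\<^sup>+\<omega>. ennreal ((norm (J t s \<omega>))\<^sup>2) \<partial>M)"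
      using st S Jf Xf by (intro nn_integral_mult_filt[where r=S and c=s and t=t]) auto
    also have "\<dots> = jj t s * xx s"
      using True st by (simp add: jj_def xx_def sq_int_def J0_def X0_def mult.commute)
    finally show ?thesis .
  next
    case False
    then show ?thesis by (simp add: J0_def jj_def sq_int_def)
  qed
  \<comment> \<open>\<open>Y t\<close> may depend on both other factors, so Cauchy-Schwarz separates
    it first and independence is used on the rest. The bound \<open>jj t s * xx s * yy t\<close> is
    not obviously integrable in (t, s), whereas the sum replacing it is: one term by the field norm
    of \<open>J\<close>, the other as a product.\<close>
  have Vb: "(\<integral>\<^sup>+\<omega>. ennreal (V t s \<omega>) \<partial>M) \<le> jj t s + xx s * yy t" for t s
  proof -
    have "(\<integral>\<^sup>+\<omega>. ennreal (norm (J0 t s \<omega>) * norm (X0 s \<omega>)) * ennreal (norm (Y0 t \<omega>)) \<partial>M)\<^sup>2 \<le>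
        (\<integral>\<^sup>+\<omega>. (ennreal (norm (J0 t s \<omega>) * norm (X0 s \<omega>)))\<^sup>2 \<partial>M) * (\<integral>\<^sup>+\<omega>. (ennreal (norm (Y0 t \<omega>)))\<^sup>2 \<partial>M)"
      by (rule Cauchy_Schwarz_nn_integral) measurable
    also have "(\<integral>\<^sup>+\<omega>. (ennreal (norm (J0 t s \<omega>) * norm (X0 s \<omega>)))\<^sup>2 \<partial>M) = jj t s * xx s"
      unfolding ind[symmetric] by (intro nn_integral_cong) (simp add: ennreal_power)
    also have "(\<integral>\<^sup>+\<omega>. (ennreal (norm (Y0 t \<omega>)))\<^sup>2 \<partial>M) = yy t"
      unfolding yy_def sq_int_def by (intro nn_integral_cong) (simp add: ennreal_power)
    also have "(\<integral>\<^sup>+\<omega>. ennreal (norm (J0 t s \<omega>) * norm (X0 s \<omega>)) * ennreal (norm (Y0 t \<omega>)) \<partial>M) = (\<integral>\<^sup>+\<omega>. ennreal (V t s \<omega>) \<partial>M)"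
      unfolding V_def by (intro nn_integral_cong) (simp add: ennreal_mult)
    finally show ?thesis by (intro ennreal_le_sum_of_power2_le_mult) (simp add: mult.assoc)
  qed
  have Vm: "(\<lambda>p. V (fst (fst p)) (snd p) (snd (fst p))) \<in> borel_measurable (?P \<Otimes>\<^sub>M lborel)"
    unfolding V_def by measurable
  have hm: "(\<lambda>p. h (fst (fst p)) (snd p) (snd (fst p))) \<in> borel_measurable (?P \<Otimes>\<^sub>M lborel)"
    unfolding h_def by measurable
  have Vint: "integrable (?P \<Otimes>\<^sub>M lborel) (\<lambda>p. V (fst (fst p)) (snd p) (snd (fst p)))"
  proof (rule integrableI_bounded[OF Vm])
    have [measurable]: "(\<lambda>\<omega>. V t s \<omega>) \<in> borel_measurable M" for t s unfolding V_def by measurable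
    have "(\<integral>\<^sup>+p. ennreal (V (fst (fst p)) (snd p) (snd (fst p))) \<partial>(?P \<Otimes>\<^sub>M lborel)) =
        (\<integral>\<^sup>+p. \<integral>\<^sup>+s. ennreal (V (fst p) s (snd p)) \<partial>lborel \<partial>?P)"
      using Vm by (subst lborel.nn_integral_fst[symmetric]) auto
    also have "\<dots> = (\<integral>\<^sup>+t. \<integral>\<^sup>+\<omega>. \<integral>\<^sup>+s. ennreal (V t s \<omega>) \<partial>lborel \<partial>M \<partial>lborel)"
    proof -
      have "(\<lambda>p. \<integral>\<^sup>+s. ennreal (V (fst p) s (snd p)) \<partial>lborel) \<in> borel_measurable ?P"
        unfolding V_def by measurable
      from nn_integral_fst[OF this] show ?thesis by simp
    qed
    also have "\<dots> = (\<integral>\<^sup>+t. \<integral>\<^sup>+s. \<integral>\<^sup>+\<omega>. ennreal (V t s \<omega>) \<partial>M \<partial>lborel \<partial>lborel)"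
    proof (intro nn_integral_cong)
      fix t :: real
      have "(\<lambda>(\<omega>, s). ennreal (V t s \<omega>)) \<in> borel_measurable (M \<Otimes>\<^sub>M lborel)"
        unfolding V_def case_prod_unfold by measurable
      from MB.Fubini'[OF this]
      show "(\<integral>\<^sup>+\<omega>. \<integral>\<^sup>+s. ennreal (V t s \<omega>) \<partial>lborel \<partial>M) = (\<integral>\<^sup>+s. \<integral>\<^sup>+\<omega>. ennreal (V t s \<omega>) \<partial>M \<partial>lborel)" by simp
    qed
    also have "\<dots> \<le> (\<integral>\<^sup>+t. \<integral>\<^sup>+s. jj t s + xx s * yy t \<partial>lborel \<partial>lborel)"
      by (intro nn_integral_mono Vb)
    also have "\<dots> = (\<integral>\<^sup>+t. (\<integral>\<^sup>+s. jj t s \<partial>lborel) + (\<integral>\<^sup>+s. xx s \<partial>lborel) * yy t \<partial>lborel)"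
    proof (intro nn_integral_cong)
      fix t :: real
      have "(\<lambda>s. jj t s) \<in> borel_measurable lborel" unfolding jj_def sq_int_def by measurable
      then show "(\<integral>\<^sup>+s. jj t s + xx s * yy t \<partial>lborel) = (\<integral>\<^sup>+s. jj t s \<partial>lborel) + (\<integral>\<^sup>+s. xx s \<partial>lborel) * yy t"
        by (simp add: nn_integral_add nn_integral_multc)
    qed
    also have "\<dots> = (\<integral>\<^sup>+t. \<integral>\<^sup>+s. jj t s \<partial>lborel \<partial>lborel) + (\<integral>\<^sup>+s. xx s \<partial>lborel) * (\<integral>\<^sup>+t. yy t \<partial>lborel)"
    proof -
      have "(\<lambda>t. \<integral>\<^sup>+s. jj t s \<partial>lborel) \<in> borel_measurable lborel" unfolding jj_def sq_int_def by measurable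
      then show ?thesis by (simp add: nn_integral_add nn_integral_cmult)
    qed
    also have "\<dots> < \<infinity>" using xx_fin yy_fin jj_fin by (simp add: ennreal_mult_less_top)
    finally show "(\<integral>\<^sup>+p. ennreal (norm (V (fst (fst p)) (snd p) (snd (fst p)))) \<partial>(?P \<Otimes>\<^sub>M lborel)) < \<infinity>"
      using V0 by simp
  qed
  have hint: "integrable (?P \<Otimes>\<^sub>M lborel) (\<lambda>p. h (fst (fst p)) (snd p) (snd (fst p)))"
    by (rule Bochner_Integration.integrable_bound[OF Vint hm]) (use hV V0 in auto)
  \<comment> \<open>Integrating \<open>h\<close> over \<open>s\<close> first gives the forward side;
    integrating over \<open>t\<close> and the sample point first will give the backward
    side.\<close>
  define k where "k p = (\<integral>s. h (fst p) s (snd p) \<partial>lborel)" for p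
  have k_int: "integrable ?P k"
    using PB.integrable_fst'[OF hint] by (simp add: k_def[abs_def])
  have k_out: "k p = 0" if "fst p \<notin> {S<..<T}" for p
    using that by (simp add: k_def h_def Y0_def)
  have k_ind: "indicator ({S<..<T} \<times> space M) p *\<^sub>R k p = k p" if "p \<in> space ?P" for p
    using k_out[of p] that by (cases p) (auto simp: indicator_def space_pair_measure)
  have IM: "{S<..<T} \<times> space M \<inter> space ?P \<in> sets ?P"
    by (intro sets.Int sets.top pair_measureI) auto
  have kP: "integrable (process_measure M S T) k"
    unfolding process_measure_restrict integrable_restrict_space[OF IM]
    by (rule Bochner_Integration.integrable_cong[OF refl k_ind, THEN iffD2, OF _ k_int])
  have kI: "(\<integral>p. k p \<partial>process_measure M S T) = (\<integral>p. k p \<partial>?P)"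
    unfolding process_measure_restrict integral_restrict_space[OF IM]
    by (rule Bochner_Integration.integral_cong[OF refl k_ind])

  \<comment> \<open>For almost every (t, \<omega>) the dominating function is integrable in
    \<open>s\<close>, which lets the factor \<open>Y t \<omega>\<close> be taken inside the
    integral.\<close>
  have "AE p in ?P. integrable lborel (\<lambda>s. V (fst p) s (snd p))"
    using PB.AE_integrable_fst'[OF Vint] by simp
  then have "AE p in ?P. p \<in> {S<..<T} \<times> space M \<longrightarrow> ast_prod (*v) S J X (fst p) (snd p) \<bullet> Y (fst p) (snd p) = k p"
    using AE_space
  proof eventually_elim
    case (elim p)
    obtain t \<omega> where p: "p = (t, \<omega>)" by (cases p)
    show ?case
    proof
      assume "p \<in> {S<..<T} \<times> space M"
      then have t: "t \<in> {S<..<T}" and \<omega> [measurable]: "\<omega> \<in> space M" using p by auto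
      have "ast_prod (*v) S J X t \<omega> = (\<integral>s. J0 t s \<omega> *v X0 s \<omega> \<partial>lborel)"
        unfolding ast_prod_def set_lebesgue_integral_def
        by (intro Bochner_Integration.integral_cong refl)
          (use t in \<open>auto simp: J0_def X0_def indicator_def triangle_def\<close>)
      moreover have "(\<integral>s. J0 t s \<omega> *v X0 s \<omega> \<partial>lborel) \<bullet> Y t \<omega> = (\<integral>s. (J0 t s \<omega> *v X0 s \<omega>) \<bullet> Y t \<omega> \<partial>lborel)"
      proof (rule integral_inner_const)
        show "(\<lambda>s. J0 t s \<omega> *v X0 s \<omega>) \<in> borel_measurable lborel" by measurable
        show "integrable lborel (\<lambda>s. V t s \<omega>)" using elim p by simp
        show "norm (J0 t s \<omega> *v X0 s \<omega>) * norm (Y t \<omega>) \<le> V t s \<omega>" for s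
          using t mult_right_mono[OF norm_matrix_vector_mult[of "J0 t s \<omega>" "X0 s \<omega>"], of "norm (Y t \<omega>)"]
          by (simp add: V_def Y0_def)
      qed
      ultimately show "ast_prod (*v) S J X (fst p) (snd p) \<bullet> Y (fst p) (snd p) = k p"
        using p t by (simp add: k_def h_def Y0_def)
    qed
  qed
  then have AE_k: "AE (t, \<omega>) in process_measure M S T. ast_prod (*v) S J X t \<omega> \<bullet> Y t \<omega> = k (t, \<omega>)"
    unfolding process_measure_restrict by (subst AE_restrict_space_iff[OF IM]) (simp add: case_prod_unfold)

  have hc: "integrable (?P \<Otimes>\<^sub>M lborel) (\<lambda>(p, s). h (fst p) s (snd p))"
    and Vc: "integrable (?P \<Otimes>\<^sub>M lborel) (\<lambda>(p, s). V (fst p) s (snd p))"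
    using hint Vint by (simp_all add: case_prod_unfold)
  \<comment> \<open>The same triple integral with \<open>s\<close> kept outermost; it remains to
    recognise \<open>l s\<close> as the expectation of the inner product of \<open>X s\<close> with
    \<open>JY s\<close>.\<close>
  define l where "l s = (\<integral>p. h (fst p) s (snd p) \<partial>?P)" for s
  have l_int: "integrable lborel l" and l_I: "(\<integral>s. l s \<partial>lborel) = (\<integral>p. k p \<partial>?P)"
    using PB.integrable_snd[OF hc] PB.integral_snd[OF hc] PB.integral_fst[OF hc]
    by (simp_all add: l_def[abs_def] k_def)
  have l_out: "indicator {S<..<T} s *\<^sub>R l s = l s" for s
    by (auto simp: l_def h_def X0_def indicator_def)

  have "AE s in lborel. s \<in> {S<..<T} \<longrightarrow> expectation (\<lambda>\<omega>. X s \<omega> \<bullet> JY s \<omega>) = l s"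
    using PB.AE_integrable_snd[OF hc] PB.AE_integrable_snd[OF Vc] conjunct2[OF JY[unfolded back_ast_prod_def]]
  proof eventually_elim
    case (elim s)
    show ?case
    proof
      assume s: "s \<in> {S<..<T}"
      define G where "G \<omega> = (LINT t:{s<..<T}|lborel. transpose (J t s \<omega>) *v Y t \<omega>)" for \<omega>
      have JY_b: "\<forall>b\<in>Basis. AE \<omega> in M. JY s \<omega> \<bullet> b = real_cond_exp M (filt M W 0 s) (\<lambda>\<omega>. G \<omega> \<bullet> b) \<omega>"
        using elim(3) s by (simp add: G_def)
      have G_eq: "G \<omega> = (\<integral>t. transpose (J0 t s \<omega>) *v Y0 t \<omega> \<partial>lborel)" for \<omega>
        unfolding G_def set_lebesgue_integral_def
        by (intro Bochner_Integration.integral_cong refl)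
          (use s in \<open>auto simp: J0_def Y0_def indicator_def triangle_def transpose_def vec_eq_iff matrix_vector_mult_def\<close>)
      have Gm [measurable]: "G \<in> borel_measurable M"
      proof -
        have "(\<lambda>(\<omega>, t). transpose (J0 t s \<omega>) *v Y0 t \<omega>) \<in> borel_measurable (M \<Otimes>\<^sub>M lborel)"
          unfolding case_prod_unfold
          by (intro borel_measurable_matrix_vector_mult isometry_borel_measurable[OF linear_transpose] Jc Yc) measurable
        from lborel.borel_measurable_lebesgue_integral[OF this] show ?thesis by (simp add: G_eq[abs_def])
      qed
      \<comment> \<open>\<open>X\<close> is adapted to increments from \<open>S\<close>, whereas the
        conditional expectation is taken with respect to increments from 0.\<close>
      have Xf: "X s \<in> borel_measurable (filt M W 0 s)"
        using measurable_filt_mono[OF DX(3)[OF s] S order_refl] .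
      have Xm [measurable]: "X s \<in> borel_measurable M" and JYm [measurable]: "JY s \<in> borel_measurable M"
        using DX(4) DJY(4) s by auto
      have hcs: "integrable ?P (\<lambda>(t, \<omega>). h t s \<omega>)" and Vcs: "integrable ?P (\<lambda>(t, \<omega>). V t s \<omega>)"
        using elim(1,2) by (simp_all add: case_prod_unfold)
      \<comment> \<open>The equation moves \<open>X s\<close> under the integral over
        \<open>t\<close>; the inequality gives the integrable majorant needed before
        \<open>X s\<close> can be pulled through the conditional expectation.\<close>
      have XG: "AE \<omega> in M. X s \<omega> \<bullet> G \<omega> = (\<integral>t. h t s \<omega> \<partial>lborel) \<and> norm (X s \<omega>) * norm (G \<omega>) \<le> (\<integral>t. V t s \<omega> \<partial>lborel)"
        using BM.AE_integrable_snd[OF Vcs] AE_space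
      proof eventually_elim
        case (elim \<omega>)
        have [measurable]: "\<omega> \<in> space M" by (rule elim(2))
        let ?v = "\<lambda>t. transpose (J0 t s \<omega>) *v Y0 t \<omega>"
        have vV: "norm (?v t) * norm (X s \<omega>) \<le> V t s \<omega>" for t
        proof -
          have "norm (?v t) \<le> norm (J0 t s \<omega>) * norm (Y0 t \<omega>)"
            using norm_matrix_vector_mult[of "transpose (J0 t s \<omega>)" "Y0 t \<omega>"] by (simp only: norm_transpose)
          from mult_right_mono[OF this, of "norm (X s \<omega>)"] show ?thesis
            using s by (simp add: V_def X0_def mult_ac)
        qed
        have "X s \<omega> \<bullet> G \<omega> = (\<integral>t. ?v t \<bullet> X s \<omega> \<partial>lborel)"
          unfolding G_eq inner_commute[of "X s \<omega>"]
        proof (rule integral_inner_const[OF _ elim(1) vV])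
          show "?v \<in> borel_measurable lborel"
            by (intro borel_measurable_matrix_vector_mult isometry_borel_measurable[OF linear_transpose] Jc Yc) measurable
        qed
        also have "\<dots> = (\<integral>t. h t s \<omega> \<partial>lborel)"
          using s by (intro Bochner_Integration.integral_cong refl)
            (simp add: h_def X0_def inner_commute[of _ "X s \<omega>"] inner_transpose_matrix_vector del: transpose_matrix_vector)
        finally have 1: "X s \<omega> \<bullet> G \<omega> = (\<integral>t. h t s \<omega> \<partial>lborel)" .
        have "norm (X s \<omega>) * norm (G \<omega>) \<le> norm (X s \<omega>) * (\<integral>t. norm (?v t) \<partial>lborel)"
          unfolding G_eq by (intro mult_left_mono integral_norm_bound) simp
        also have "\<dots> = (\<integral>t. norm (?v t) * norm (X s \<omega>) \<partial>lborel)" by (simp del: transpose_matrix_vector)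
        also have "\<dots> \<le> (\<integral>t. V t s \<omega> \<partial>lborel)"
          by (rule integral_mono'[OF elim(1) vV V0])
        finally show ?case using 1 by simp
      qed
      have VI: "integrable M (\<lambda>\<omega>. \<integral>t. V t s \<omega> \<partial>lborel)" by (rule BM.integrable_snd[OF Vcs])
      interpret F: finite_measure_subalgebra M "filt M W 0 s"
        by unfold_locales (rule subalgebra_filt[OF order_refl])
      \<comment> \<open>One coordinate at a time, as \<open>back_ast_prod\<close> specifies the
        conditional expectation componentwise.\<close>
      have b: "integrable M (\<lambda>\<omega>. (X s \<omega> \<bullet> b) * (G \<omega> \<bullet> b))"
        and "integrable M (\<lambda>\<omega>. (X s \<omega> \<bullet> b) * (JY s \<omega> \<bullet> b)) \<and>
          expectation (\<lambda>\<omega>. (X s \<omega> \<bullet> b) * (JY s \<omega> \<bullet> b)) = expectation (\<lambda>\<omega>. (X s \<omega> \<bullet> b) * (G \<omega> \<bullet> b))"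
        if b: "b \<in> Basis" for b
      proof -
        show i: "integrable M (\<lambda>\<omega>. (X s \<omega> \<bullet> b) * (G \<omega> \<bullet> b))"
        proof (rule Bochner_Integration.integrable_bound[OF VI])
          show "AE \<omega> in M. norm ((X s \<omega> \<bullet> b) * (G \<omega> \<bullet> b)) \<le> norm (\<integral>t. V t s \<omega> \<partial>lborel)"
            using XG
          proof eventually_elim
            case (elim \<omega>)
            have "norm ((X s \<omega> \<bullet> b) * (G \<omega> \<bullet> b)) \<le> norm (X s \<omega>) * norm (G \<omega>)"
              unfolding real_norm_def abs_mult using b
              by (intro mult_mono Basis_le_norm) auto
            also have "\<dots> \<le> (\<integral>t. V t s \<omega> \<partial>lborel)" using elim by blast
            also have "\<dots> \<le> norm (\<integral>t. V t s \<omega> \<partial>lborel)" by simp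
            finally show ?case .
          qed
        qed measurable
        have Xb: "(\<lambda>\<omega>. X s \<omega> \<bullet> b) \<in> borel_measurable (filt M W 0 s)" using Xf by simp
        have Gb: "(\<lambda>\<omega>. G \<omega> \<bullet> b) \<in> borel_measurable M" by measurable
        \<comment> \<open>The defining property of the conditional expectation, tested with a
          function measurable at time \<open>s\<close>. What it asks to be integrable is the product
          with \<open>X\<close>, and this is what \<open>i\<close> provides.\<close>
        note ce = F.real_cond_exp_intg[OF i Xb Gb]
        have eq: "AE \<omega> in M. (X s \<omega> \<bullet> b) * real_cond_exp M (filt M W 0 s) (\<lambda>\<omega>. G \<omega> \<bullet> b) \<omega> = (X s \<omega> \<bullet> b) * (JY s \<omega> \<bullet> b)"
          using bspec[OF JY_b b] by eventually_elim simp
        have m: "(\<lambda>\<omega>. (X s \<omega> \<bullet> b) * (JY s \<omega> \<bullet> b)) \<in> borel_measurable M" by measurable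
        show "integrable M (\<lambda>\<omega>. (X s \<omega> \<bullet> b) * (JY s \<omega> \<bullet> b)) \<and>
          expectation (\<lambda>\<omega>. (X s \<omega> \<bullet> b) * (JY s \<omega> \<bullet> b)) = expectation (\<lambda>\<omega>. (X s \<omega> \<bullet> b) * (G \<omega> \<bullet> b))"
          using integrable_cong_AE_imp[OF ce(1) m] integral_cong_AE[OF _ m eq] ce eq by auto
      qed
      note b' = this
      have "expectation (\<lambda>\<omega>. X s \<omega> \<bullet> JY s \<omega>) = (\<Sum>b\<in>Basis. expectation (\<lambda>\<omega>. (X s \<omega> \<bullet> b) * (JY s \<omega> \<bullet> b)))"
        unfolding euclidean_inner[of "X s \<omega>" "JY s \<omega>" for \<omega>] using b'(2) by (intro Bochner_Integration.integral_sum) auto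
      also have "\<dots> = (\<Sum>b\<in>Basis. expectation (\<lambda>\<omega>. (X s \<omega> \<bullet> b) * (G \<omega> \<bullet> b)))"
        using b'(2) by (intro sum.cong refl) auto
      also have "\<dots> = expectation (\<lambda>\<omega>. X s \<omega> \<bullet> G \<omega>)"
        unfolding euclidean_inner[of "X s \<omega>" "G \<omega>" for \<omega>] using b'(1) by (intro Bochner_Integration.integral_sum[symmetric]) auto
      also have "\<dots> = (\<integral>\<omega>. \<integral>t. h t s \<omega> \<partial>lborel \<partial>M)"
        using XG BM.integrable_snd[OF hcs] by (intro integral_cong_AE) auto
      also have "\<dots> = l s"
        using BM.integral_snd[OF hcs] by (simp add: l_def case_prod_unfold)
      finally show "expectation (\<lambda>\<omega>. X s \<omega> \<bullet> JY s \<omega>) = l s" .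
    qed
  qed
  then have AE_l: "AE s in interval_measure S T. expectation (\<lambda>\<omega>. X s \<omega> \<bullet> JY s \<omega>) = l s"
    by (simp only: AE_interval_iff)
  note PI = process_integral[OF DX(1,2) DJY(1,2)]
  have l_int': "integrable (interval_measure S T) l"
    by (subst integrable_restrict_space) (use l_int in \<open>auto simp only: l_out, auto\<close>)
  have "process_inner S T X JY = (\<integral>s. l s \<partial>interval_measure S T)"
    unfolding PI(2) using PI(3) l_int' by (intro integral_cong_AE AE_l) auto
  also have "\<dots> = (\<integral>s. l s \<partial>lborel)"
    by (subst integral_restrict_space) (simp_all only: l_out, simp)
  finally have "(\<integral>p. k p \<partial>process_measure M S T) = process_inner S T X JY"
    unfolding kI l_I by simp
  then show thesis using that[OF kP AE_k] by blast
qed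

end

theorem theorem4p15:
  fixes M :: "'w measure" and W :: "real \<Rightarrow> 'w \<Rightarrow> real" and S T :: real
    and J Q :: "real \<Rightarrow> real \<Rightarrow> 'w \<Rightarrow> real ^ 'd::finite ^ 'd"
    and K R :: "real \<Rightarrow> 'w \<Rightarrow> real ^ 'd ^ 'd"
    and \<phi> \<psi> X Y :: "real \<Rightarrow> 'w \<Rightarrow> real ^ 'd"
  assumes "prob_space M" and "complete_measure M" and "brownian_motion M W"
    and "0 \<le> S" and "S < T"
    and "J \<in> ast_kernels M W S T" and "K \<in> star_kernels M W S T"
    and "resolvent M W S T J K Q R"
    and "\<phi> \<in> L2_F M W S T" and "\<psi> \<in> L2_F M W S T"
    and "forward_solution M W S T J K \<phi> X"
    and "backward_solution M W S T (\<lambda>t s \<omega>. transpose (J t s \<omega>)) (\<lambda>t \<omega>. transpose (K t \<omega>)) \<psi> Y"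
  shows "L2_F_inner M S T X \<psi> = L2_F_inner M S T \<phi> Y"
proof -
  interpret brownian M W
    using assms(1,3) by (intro brownian.intro brownian_axioms.intro)
  let ?P = "process_measure M S T"
  note S = \<open>0 \<le> S\<close>
  obtain KX where X: "X \<in> L2_F M W S T" and KX: "star_prod (*v) M W S T K X KX"
    and X_eq: "AE (t, \<omega>) in ?P. X t \<omega> = \<phi> t \<omega> + ast_prod (*v) S J X t \<omega> + KX t \<omega>"
    using assms(11) by (auto simp: forward_solution_def)
  obtain JY KY where Y: "Y \<in> L2_F M W S T"
    and JY: "back_ast_prod (*v) M W S T (\<lambda>t s \<omega>. transpose (J t s \<omega>)) Y JY"
    and KY: "back_star_prod (*v) M W S T (\<lambda>t \<omega>. transpose (K t \<omega>)) Y KY"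
    and Y_eq: "AE (t, \<omega>) in ?P. Y t \<omega> = \<psi> t \<omega> + JY t \<omega> + KY t \<omega>"
    using assms(12) unfolding backward_solution_def by blast
  have L: "JY \<in> L2_F M W S T" "KX \<in> L2_F M W S T" "KY \<in> L2_F M W S T"
    using JY KX KY by (auto simp: back_ast_prod_def star_prod_def back_star_prod_def chaos_def)
  have int: "integrable ?P (\<lambda>(t, \<omega>). \<xi> t \<omega> \<bullet> \<eta> t \<omega>)"
    if "\<xi> \<in> L2_F M W S T" "\<eta> \<in> L2_F M W S T" for \<xi> \<eta> :: "real \<Rightarrow> 'w \<Rightarrow> real ^ 'd"
    by (rule process_integral(1)[OF L2_FD(1,2)[OF that(1) S] L2_FD(1,2)[OF that(2) S]])
  have "J \<in> L2_F_ast M W S T" using assms(6) by (simp add: ast_kernels_def)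
  then obtain k where k: "integrable ?P k"
    "AE (t, \<omega>) in ?P. ast_prod (*v) S J X t \<omega> \<bullet> Y t \<omega> = k (t, \<omega>)"
    "(\<integral>p. k p \<partial>?P) = process_inner S T X JY"
    by (rule ast_duality[OF S _ X Y JY])
  have KK: "process_inner S T KX Y = process_inner S T X KY"
    by (rule star_duality[OF S assms(7) KX KY])

  \<comment> \<open>The equations are rearranged under a single integral, because they hold almost
    everywhere on the product space and each term separately is integrable.\<close>
  have "process_inner S T X \<psi> =
      (\<integral>p. (case p of (t, \<omega>) \<Rightarrow> X t \<omega> \<bullet> Y t \<omega>) - (case p of (t, \<omega>) \<Rightarrow> X t \<omega> \<bullet> JY t \<omega>) - (case p of (t, \<omega>) \<Rightarrow> X t \<omega> \<bullet> KY t \<omega>) \<partial>?P)"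
  proof (rule integral_cong_AE)
    show "AE p in ?P. (case p of (t, \<omega>) \<Rightarrow> X t \<omega> \<bullet> \<psi> t \<omega>) =
        (case p of (t, \<omega>) \<Rightarrow> X t \<omega> \<bullet> Y t \<omega>) - (case p of (t, \<omega>) \<Rightarrow> X t \<omega> \<bullet> JY t \<omega>) - (case p of (t, \<omega>) \<Rightarrow> X t \<omega> \<bullet> KY t \<omega>)"
      using Y_eq by eventually_elim (auto simp: inner_add_right)
  qed (intro borel_measurable_diff borel_measurable_integrable int X Y L assms)+
  also have "\<dots> = process_inner S T X Y - (\<integral>p. k p \<partial>?P) - process_inner S T KX Y"
    unfolding k(3) KK by (simp only: Bochner_Integration.integral_diff Bochner_Integration.integrable_diff int X L Y)
  \<comment> \<open>\<open>k\<close> stands in for the product of \<open>ast_prod\<close> with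
    \<open>Y\<close>, so that the difference splits into terms of known integrability; the pointwise
    identity for \<open>k\<close> is used only afterwards.\<close>
  also have "\<dots> = (\<integral>p. (case p of (t, \<omega>) \<Rightarrow> X t \<omega> \<bullet> Y t \<omega>) - k p - (case p of (t, \<omega>) \<Rightarrow> KX t \<omega> \<bullet> Y t \<omega>) \<partial>?P)"
    by (simp only: Bochner_Integration.integral_diff Bochner_Integration.integrable_diff int X L Y k(1))
  also have "\<dots> = process_inner S T \<phi> Y"
  proof (rule integral_cong_AE)
    show "AE p in ?P. (case p of (t, \<omega>) \<Rightarrow> X t \<omega> \<bullet> Y t \<omega>) - k p - (case p of (t, \<omega>) \<Rightarrow> KX t \<omega> \<bullet> Y t \<omega>) =
        (case p of (t, \<omega>) \<Rightarrow> \<phi> t \<omega> \<bullet> Y t \<omega>)"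
      using X_eq k(2) by eventually_elim (auto simp: inner_add_left)
  qed (intro borel_measurable_diff borel_measurable_integrable int k X Y L assms)+
  finally show ?thesis
    unfolding L2_F_inner_eq[OF S X assms(10)] L2_F_inner_eq[OF S assms(9) Y] .
qed

end
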